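(* There exists a universal constant $C$ such that for every $N\ge 1$, all densities $p,q\in[0,1]$ with $q \le \min\{p,1-p\}$, and every $\epsilon\in(0,1)$, $$t^* - C\left(1 + \log\left(\frac{1}{1-\epsilon}\right)\right) \;\le\; \mathrm{t}_{\mathrm{mix}}(\epsilon) \;\le\; t^* + C\left(1 + \log\left(\frac{1}{\epsilon}\right) + \log\left(\frac{1}{1-p}\right)\right),$$ with the convention $\log(1/0)=+\infty$.
   Context: For $N \ge 1$ and $p,q\in[0,1]$, the SSEP on $[N]=\{1,\dots,N\}$ with reservoirs of densities $p$ (at site $1$) and $q$ (at site $N$) is the continuous-time Markov process $(\eta_t)_{t\ge 0}$ on $\Omega = \{0,1\}^N$ with generator acting on $\varphi:\Omega\to\mathbb{R}$ by $$L\varphi(\eta) = \sum_{i=1}^{N-1} N^2\big(\varphi(\eta^{i\leftrightarrow i+1}) - \varphi(\eta)\big) + N^2\big[p\,\varphi(\eta^{1,1}) + (1-p)\varphi(\eta^{1,0}) - \varphi(\eta)\big] + N^2\big[q\,\varphi(\eta^{N,1}) + (1-q)\varphi(\eta^{N,0}) - \varphi(\eta)\big],$$ where $\eta^{i\leftrightarrow i+1}$ is obtained from $\eta$ by swapping coordinates $i$ and $i+1$, and $\eta^{i,0}$, $\eta^{i,1}$ are obtained by resetting coordinate $i$ to $0$, resp. $1$. Let $\pi$ be its unique invariant distribution, $\mathrm{d}_{\mathrm{TV}}(\mu,\nu) = \max_{A\subset\Omega}|\mu(A)-\nu(A)|$, $d(t) = \max_{\eta\in\Omega} \mathrm{d}_{\mathrm{TV}}(\mathbb{P}_\eta[\eta_t\in\cdot],\pi)$,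 where $\mathbb{P}_\eta$ is the law of the process started from $\eta$, and $\mathrm{t}_{\mathrm{mix}}(\epsilon) = \inf\{t\ge 0: d(t)\le \epsilon\}$. The weight of $\eta\in\Omega$ is $S(\eta) = \sum_{i\in[N]}\eta(i)$. Let $\mathbb{E}^0_{\mathbf{1}}$ denote expectation for the process with both reservoir densities equal to $0$ (i.e. the generator above with $p=q=0$), started from the configuration $\mathbf{1}$ in which every site is occupied. Then, with $p$ the left reservoir density of the original process, $$t^* := \inf\{t\ge 0: \mathbb{E}^0_{\mathbf{1}}[S(\eta_t)] \le \sqrt{Np}\vee 1\}.$$ *)

theory Defs
  imports "HOL-Probability.Probability"
begin

definition configs :: "nat \<Rightarrow> (nat \<Rightarrow> nat) set" where
  "configs N = ({1..N} \<rightarrow>\<^sub>E {0, 1})"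

definition ssep_gen ::
  "nat \<Rightarrow> real \<Rightarrow> real \<Rightarrow> ((nat \<Rightarrow> nat) \<Rightarrow> real) \<Rightarrow> (nat \<Rightarrow> nat) \<Rightarrow> real" where
  "ssep_gen N p q \<phi> \<eta> =
     (\<Sum>i\<in>{1..<N}. (real N)\<^sup>2 * (\<phi> (\<eta>(i := \<eta> (i + 1), i + 1 := \<eta> i)) - \<phi> \<eta>))
     + (real N)\<^sup>2 * (p * \<phi> (\<eta>(1 := 1)) + (1 - p) * \<phi> (\<eta>(1 := 0)) - \<phi> \<eta>)
     + (real N)\<^sup>2 * (q * \<phi> (\<eta>(N := 1)) + (1 - q) * \<phi> (\<eta>(N := 0)) - \<phi> \<eta>)"

text \<open>On the finite state space, the Markov process with generator \<open>L\<close> has the transition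
  semigroup \<open>exp (t L) = (\<Sum>k. t^k / k! L^k)\<close>.\<close>

definition ssep_semigroup ::
  "nat \<Rightarrow> real \<Rightarrow> real \<Rightarrow> real \<Rightarrow> ((nat \<Rightarrow> nat) \<Rightarrow> real) \<Rightarrow> (nat \<Rightarrow> nat) \<Rightarrow> real" where
  "ssep_semigroup N p q t \<phi> \<eta> = (\<Sum>k. t ^ k / fact k * (ssep_gen N p q ^^ k) \<phi> \<eta>)"

text \<open>The law of \<open>\<eta>\<^sub>t\<close> under \<open>P\<^sub>\<eta>\<close>. The lemmas \<open>pmf_ssep_law\<close> and \<open>expectation_ssep_law\<close>
  below show that for \<open>\<eta> \<in> configs N\<close>, \<open>p, q \<in> [0, 1]\<close> and \<open>t \<ge> 0\<close> the argument of
  \<^const>\<open>embed_pmf\<close> is a probability mass function.\<close>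

definition ssep_law ::
  "nat \<Rightarrow> real \<Rightarrow> real \<Rightarrow> (nat \<Rightarrow> nat) \<Rightarrow> real \<Rightarrow> (nat \<Rightarrow> nat) pmf" where
  "ssep_law N p q \<eta> t = embed_pmf (\<lambda>\<xi>. ssep_semigroup N p q t (indicator {\<xi>}) \<eta>)"

definition ssep_invariant :: "nat \<Rightarrow> real \<Rightarrow> real \<Rightarrow> (nat \<Rightarrow> nat) pmf \<Rightarrow> bool" where
  "ssep_invariant N p q \<pi> \<longleftrightarrow> set_pmf \<pi> \<subseteq> configs N \<and>
     (\<forall>t\<ge>0. bind_pmf \<pi> (\<lambda>\<eta>. ssep_law N p q \<eta> t) = \<pi>)"

definition ssep_stationary :: "nat \<Rightarrow> real \<Rightarrow> real \<Rightarrow> (nat \<Rightarrow> nat) pmf" where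
  "ssep_stationary N p q = (THE \<pi>. ssep_invariant N p q \<pi>)"

definition dTV :: "'a set \<Rightarrow> 'a pmf \<Rightarrow> 'a pmf \<Rightarrow> real" where
  "dTV \<Omega> \<mu> \<nu> = (MAX A\<in>Pow \<Omega>. \<bar>measure_pmf.prob \<mu> A - measure_pmf.prob \<nu> A\<bar>)"

definition ssep_dist :: "nat \<Rightarrow> real \<Rightarrow> real \<Rightarrow> real \<Rightarrow> real" where
  "ssep_dist N p q t =
     (MAX \<eta>\<in>configs N. dTV (configs N) (ssep_law N p q \<eta> t) (ssep_stationary N p q))"

text \<open>Both times are infima in the extended reals, where the infimum of the empty set is
  \<open>\<infinity>\<close>.\<close>

definition tmix :: "nat \<Rightarrow> real \<Rightarrow> real \<Rightarrow> real \<Rightarrow> ereal" where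
  "tmix N p q \<epsilon> = (INF t\<in>{t. 0 \<le> t \<and> ssep_dist N p q t \<le> \<epsilon>}. ereal t)"

definition weight :: "nat \<Rightarrow> (nat \<Rightarrow> nat) \<Rightarrow> real" where
  "weight N \<eta> = (\<Sum>i\<in>{1..N}. real (\<eta> i))"

definition full_config :: "nat \<Rightarrow> nat \<Rightarrow> nat" where
  "full_config N = (\<lambda>i\<in>{1..N}. 1)"

definition tstar :: "nat \<Rightarrow> real \<Rightarrow> ereal" where
  "tstar N p = (INF t\<in>{t. 0 \<le> t \<and>
     measure_pmf.expectation (ssep_law N 0 0 (full_config N) t) (weight N)
       \<le> max (sqrt (real N * p)) 1}. ereal t)"

text \<open>\<open>log (1 / x)\<close> for \<open>x \<ge> 0\<close>, with \<open>log (1 / 0) = \<infinity>\<close>.\<close>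

definition log_inv :: "real \<Rightarrow> ereal" where
  "log_inv x = (if x = 0 then \<infinity> else ereal (ln (1 / x)))"


lemma finite_configs: "finite (configs N)"
  unfolding configs_def by (intro finite_PiE) auto

lemma configs_upd: "\<eta> \<in> configs N \<Longrightarrow> i \<in> {1..N} \<Longrightarrow> x \<in> {0, 1} \<Longrightarrow> \<eta>(i := x) \<in> configs N"
  unfolding configs_def by (auto simp: PiE_iff extensional_def)

lemma configs_swap:
  "\<eta> \<in> configs N \<Longrightarrow> i \<in> {1..<N} \<Longrightarrow> \<eta>(i := \<eta> (i + 1), i + 1 := \<eta> i) \<in> configs N"
  by (intro configs_upd) (auto simp: configs_def PiE_iff)

text \<open>The generator is \<open>A - c\<close> for a positive operator \<open>A\<close> and the total jump rate \<open>c\<close>.\<close>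

definition ssep_pos ::
  "nat \<Rightarrow> real \<Rightarrow> real \<Rightarrow> ((nat \<Rightarrow> nat) \<Rightarrow> real) \<Rightarrow> (nat \<Rightarrow> nat) \<Rightarrow> real" where
  "ssep_pos N p q \<phi> \<eta> =
     (\<Sum>i\<in>{1..<N}. (real N)\<^sup>2 * \<phi> (\<eta>(i := \<eta> (i + 1), i + 1 := \<eta> i)))
     + (real N)\<^sup>2 * (p * \<phi> (\<eta>(1 := 1)) + (1 - p) * \<phi> (\<eta>(1 := 0)))
     + (real N)\<^sup>2 * (q * \<phi> (\<eta>(N := 1)) + (1 - q) * \<phi> (\<eta>(N := 0)))"

definition ssep_rate :: "nat \<Rightarrow> real" where
  "ssep_rate N = (real N)\<^sup>2 * (real (card {1..<N}) + 2)"

lemma ssep_gen_eq: "ssep_gen N p q \<phi> \<eta> = ssep_pos N p q \<phi> \<eta> - ssep_rate N * \<phi> \<eta>"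
  unfolding ssep_gen_def ssep_pos_def ssep_rate_def
  by (simp add: right_diff_distrib sum_subtractf) (simp add: algebra_simps)

lemma ssep_rate_nonneg: "0 \<le> ssep_rate N"
  by (simp add: ssep_rate_def)

lemma ssep_pos_diff:
  "ssep_pos N p q (\<lambda>\<xi>. \<phi> \<xi> - a * \<psi> \<xi>) \<eta> = ssep_pos N p q \<phi> \<eta> - a * ssep_pos N p q \<psi> \<eta>"
  unfolding ssep_pos_def
  by (simp add: right_diff_distrib sum_subtractf) (simp add: algebra_simps sum_distrib_left)

lemma ssep_pos_pow_diff:
  "(ssep_pos N p q ^^ k) (\<lambda>\<xi>. \<phi> \<xi> - a * \<psi> \<xi>) =
     (\<lambda>\<eta>. (ssep_pos N p q ^^ k) \<phi> \<eta> - a * (ssep_pos N p q ^^ k) \<psi> \<eta>)"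
  by (induction k) (auto simp: ssep_pos_diff)

lemma ssep_pos_mono:
  assumes "p \<in> {0..1}" "q \<in> {0..1}" "\<eta> \<in> configs N"
    and "\<And>\<xi>. \<xi> \<in> configs N \<Longrightarrow> \<phi> \<xi> \<le> \<psi> \<xi>"
  shows "ssep_pos N p q \<phi> \<eta> \<le> ssep_pos N p q \<psi> \<eta>"
proof (cases "N = 0")
  case False
  then show ?thesis unfolding ssep_pos_def
    using assms configs_upd[OF assms(3)] configs_swap[OF assms(3)]
    by (intro add_mono sum_mono mult_left_mono) auto
qed (simp add: ssep_pos_def)

lemma ssep_pos_const: "ssep_pos N p q (\<lambda>_. a) \<eta> = ssep_rate N * a"
  unfolding ssep_pos_def ssep_rate_def by (simp add: algebra_simps)

lemma ssep_pos_pow_bounds: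
  assumes "p \<in> {0..1}" "q \<in> {0..1}"
    and "\<And>\<xi>. \<xi> \<in> configs N \<Longrightarrow> a \<le> \<phi> \<xi> \<and> \<phi> \<xi> \<le> b"
  shows "\<eta> \<in> configs N \<Longrightarrow> ssep_rate N ^ k * a \<le> (ssep_pos N p q ^^ k) \<phi> \<eta> \<and>
           (ssep_pos N p q ^^ k) \<phi> \<eta> \<le> ssep_rate N ^ k * b"
proof (induction k arbitrary: \<eta>)
  case (Suc k)
  have "ssep_pos N p q (\<lambda>_. ssep_rate N ^ k * a) \<eta> \<le> ssep_pos N p q ((ssep_pos N p q ^^ k) \<phi>) \<eta>"
    "ssep_pos N p q ((ssep_pos N p q ^^ k) \<phi>) \<eta> \<le> ssep_pos N p q (\<lambda>_. ssep_rate N ^ k * b) \<eta>"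
    by (intro ssep_pos_mono assms(1,2) Suc.prems; use Suc.IH in simp)+
  then show ?case by (simp add: ssep_pos_const mult.assoc)
qed (use assms in auto)

lemma binomial_shift:
  fixes x :: real
  shows "(\<Sum>i\<le>Suc k. real (Suc k choose i) * x ^ (Suc k - i) * a i) =
    (\<Sum>i\<le>k. real (k choose i) * x ^ (k - i) * (a (Suc i) + x * a i))"
proof -
  have "(\<Sum>i\<le>Suc k. real (Suc k choose i) * x ^ (Suc k - i) * a i) =
      x ^ Suc k * a 0 + (\<Sum>i\<le>k. real (k choose Suc i) * x ^ (k - i) * a (Suc i))
      + (\<Sum>i\<le>k. real (k choose i) * x ^ (k - i) * a (Suc i))"
    by (subst sum.atMost_Suc_shift) (simp add: algebra_simps sum.distrib)
  also have "x ^ Suc k * a 0 + (\<Sum>i\<le>k. real (k choose Suc i) * x ^ (k - i) * a (Suc i)) =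
      (\<Sum>i\<le>Suc k. real (k choose i) * x ^ (Suc k - i) * a i)"
    by (simp add: sum.atMost_Suc_shift del: sum.atMost_Suc)
  also have "\<dots> = (\<Sum>i\<le>k. real (k choose i) * x ^ (k - i) * (x * a i))"
    by (simp add: Suc_diff_le algebra_simps)
  finally show ?thesis by (simp add: distrib_left sum.distrib)
qed

lemma ssep_gen_pow:
  "(ssep_gen N p q ^^ k) \<phi> \<eta> =
     (\<Sum>i\<le>k. real (k choose i) * (- ssep_rate N) ^ (k - i) * (ssep_pos N p q ^^ i) \<phi> \<eta>)"
proof (induction k arbitrary: \<phi>)
  case (Suc k)
  have eq: "ssep_gen N p q \<phi> = (\<lambda>\<xi>. ssep_pos N p q \<phi> \<xi> - ssep_rate N * \<phi> \<xi>)"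
    by (rule ext) (rule ssep_gen_eq)
  have "(ssep_gen N p q ^^ Suc k) \<phi> \<eta> = (ssep_gen N p q ^^ k) (ssep_gen N p q \<phi>) \<eta>"
    by (simp only: funpow_Suc_right o_def)
  also have "\<dots> = (\<Sum>i\<le>k. real (k choose i) * (- ssep_rate N) ^ (k - i) *
      ((ssep_pos N p q ^^ Suc i) \<phi> \<eta> + (- ssep_rate N) * (ssep_pos N p q ^^ i) \<phi> \<eta>))"
    unfolding Suc.IH eq ssep_pos_pow_diff by (simp add: funpow_swap1)
  finally show ?case by (simp only: binomial_shift)
qed simp

lemma ssep_semigroup_sums:
  fixes t :: real and \<phi> :: "(nat \<Rightarrow> nat) \<Rightarrow> real"
  assumes "p \<in> {0..1}" "q \<in> {0..1}" "\<eta> \<in> configs N"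
  defines "v \<equiv> \<lambda>j. t ^ j / fact j * (ssep_pos N p q ^^ j) \<phi> \<eta>"
  shows "(\<lambda>k. t ^ k / fact k * (ssep_gen N p q ^^ k) \<phi> \<eta>) sums
           (exp (- ssep_rate N * t) * (\<Sum>j. v j))"
    and "summable v"
proof -
  define c where "c = ssep_rate N"
  have c: "c \<ge> 0" by (simp add: c_def ssep_rate_nonneg)
  define B where "B = (\<Sum>\<xi>\<in>configs N. \<bar>\<phi> \<xi>\<bar>)"
  have "\<bar>\<phi> \<xi>\<bar> \<le> B" if "\<xi> \<in> configs N" for \<xi>
    unfolding B_def by (rule member_le_sum) (use that finite_configs in auto)
  then have B: "- B \<le> \<phi> \<xi> \<and> \<phi> \<xi> \<le> B" if "\<xi> \<in> configs N" for \<xi>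
    using that by (fastforce simp: abs_le_iff)
  then have bound: "\<bar>(ssep_pos N p q ^^ j) \<phi> \<eta>\<bar> \<le> c ^ j * B" for j
    using ssep_pos_pow_bounds[of p q N "- B" \<phi> B \<eta> j] assms(1-3)
    by (simp add: abs_le_iff c_def minus_le_iff)
  have "summable (\<lambda>j. (\<bar>t\<bar> * c) ^ j /\<^sub>R fact j * B)"
    by (intro summable_mult2 summable_exp_generic)
  moreover have "norm (norm (v j)) \<le> (\<bar>t\<bar> * c) ^ j /\<^sub>R fact j * B" for j
    using mult_left_mono[OF bound[of j], of "\<bar>t\<bar> ^ j / fact j"]
    by (simp add: v_def abs_mult power_abs power_mult_distrib field_simps)
  ultimately have v: "summable (\<lambda>j. norm (v j))"
    by (blast intro: summable_comparison_test')
  define u where "u = (\<lambda>i. (- c * t) ^ i /\<^sub>R fact i)"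
  have u: "summable (\<lambda>i. norm (u i))"
    unfolding u_def by (rule summable_norm_exp)
  have "(\<lambda>k. \<Sum>i\<le>k. v i * u (k - i)) sums ((\<Sum>j. v j) * (\<Sum>i. u i))"
    by (rule Cauchy_product_sums[OF v u])
  moreover have "(\<Sum>i. u i) = exp (- c * t)"
    by (simp add: u_def exp_def)
  moreover have "(\<Sum>i\<le>k. v i * u (k - i)) = t ^ k / fact k * (ssep_gen N p q ^^ k) \<phi> \<eta>" for k
  proof -
    have "v i * u (k - i) = t ^ k / fact k *
        (real (k choose i) * (- c) ^ (k - i) * (ssep_pos N p q ^^ i) \<phi> \<eta>)" if "i \<le> k" for i
    proof -
      have "t ^ k = t ^ i * t ^ (k - i)" using that by (simp flip: power_add)
      then show ?thesis using that unfolding v_def u_def power_mult_distrib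
        by (simp add: binomial_fact field_simps)
    qed
    then show ?thesis by (simp add: ssep_gen_pow sum_distrib_left c_def)
  qed
  ultimately show "(\<lambda>k. t ^ k / fact k * (ssep_gen N p q ^^ k) \<phi> \<eta>) sums
      (exp (- ssep_rate N * t) * (\<Sum>j. v j))"
    by (simp add: c_def mult.commute)
  show "summable v" using v by (rule summable_norm_cancel)
qed

lemma ssep_semigroup_nonneg:
  assumes "p \<in> {0..1}" "q \<in> {0..1}" "\<eta> \<in> configs N" "0 \<le> t"
    and "\<And>\<xi>. \<xi> \<in> configs N \<Longrightarrow> 0 \<le> \<phi> \<xi>"
  shows "0 \<le> ssep_semigroup N p q t \<phi> \<eta>"
proof -
  define B where "B = (\<Sum>\<xi>\<in>configs N. \<phi> \<xi>)"
  have "\<phi> \<xi> \<le> B" if "\<xi> \<in> configs N" for \<xi>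
    unfolding B_def by (rule member_le_sum) (use that finite_configs assms(5) in auto)
  then have B: "0 \<le> \<phi> \<xi> \<and> \<phi> \<xi> \<le> B" if "\<xi> \<in> configs N" for \<xi>
    using that assms(5) by blast
  then have "0 \<le> (ssep_pos N p q ^^ j) \<phi> \<eta>" for j
    using ssep_pos_pow_bounds[of p q N 0 \<phi> B \<eta> j] assms(1-3) by simp
  then have "0 \<le> (\<Sum>j. t ^ j / fact j * (ssep_pos N p q ^^ j) \<phi> \<eta>)"
    using assms(4) by (intro suminf_nonneg ssep_semigroup_sums(2)[OF assms(1-3)]) auto
  moreover have "ssep_semigroup N p q t \<phi> \<eta> =
      exp (- ssep_rate N * t) * (\<Sum>j. t ^ j / fact j * (ssep_pos N p q ^^ j) \<phi> \<eta>)"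
    unfolding ssep_semigroup_def
    using sums_unique[OF ssep_semigroup_sums(1)[OF assms(1-3), of t \<phi>]] by simp
  ultimately show ?thesis by simp
qed

lemma ssep_gen_cong:
  assumes "\<eta> \<in> configs N" "\<And>\<xi>. \<xi> \<in> configs N \<Longrightarrow> \<phi> \<xi> = \<psi> \<xi>"
  shows "ssep_gen N p q \<phi> \<eta> = ssep_gen N p q \<psi> \<eta>"
proof (cases "N = 0")
  case False
  have "(\<Sum>i\<in>{1..<N}. (real N)\<^sup>2 * (\<phi> (\<eta>(i := \<eta> (i + 1), i + 1 := \<eta> i)) - \<phi> \<eta>)) =
      (\<Sum>i\<in>{1..<N}. (real N)\<^sup>2 * (\<psi> (\<eta>(i := \<eta> (i + 1), i + 1 := \<eta> i)) - \<psi> \<eta>))"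
    using assms configs_swap[OF assms(1)] by (intro sum.cong) auto
  then show ?thesis unfolding ssep_gen_def
    using False assms configs_upd[OF assms(1)] by simp
qed (simp add: ssep_gen_def)

lemma ssep_gen_sum:
  "ssep_gen N p q (\<lambda>\<xi>. \<Sum>x\<in>X. a x * f x \<xi>) \<eta> = (\<Sum>x\<in>X. a x * ssep_gen N p q (f x) \<eta>)"
proof (induction X rule: infinite_finite_induct)
  case (insert x X)
  have "ssep_gen N p q (\<lambda>\<xi>. a x * f x \<xi> + (\<Sum>x\<in>X. a x * f x \<xi>)) \<eta> =
      a x * ssep_gen N p q (f x) \<eta> + ssep_gen N p q (\<lambda>\<xi>. \<Sum>x\<in>X. a x * f x \<xi>) \<eta>"
    unfolding ssep_gen_def
    by (simp add: right_diff_distrib distrib_left sum.distrib sum_subtractf sum_distrib_left)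
       (simp add: algebra_simps)
  then show ?case using insert by simp
qed (simp_all add: ssep_gen_def)

lemma ssep_gen_pow_expand:
  "\<eta> \<in> configs N \<Longrightarrow> (ssep_gen N p q ^^ k) \<phi> \<eta> =
     (\<Sum>\<xi>\<in>configs N. \<phi> \<xi> * (ssep_gen N p q ^^ k) (indicator {\<xi>}) \<eta>)"
proof (induction k arbitrary: \<eta>)
  case 0
  have "\<phi> \<xi> * indicator {\<xi>} \<eta> = (if \<xi> = \<eta> then \<phi> \<eta> else 0)" for \<xi>
    by (auto simp: indicator_def)
  with 0 show ?case by (simp add: finite_configs)
next
  case (Suc k)
  have "(ssep_gen N p q ^^ Suc k) \<phi> \<eta> = ssep_gen N p q (\<lambda>\<zeta>.
      \<Sum>\<xi>\<in>configs N. \<phi> \<xi> * (ssep_gen N p q ^^ k) (indicator {\<xi>}) \<zeta>) \<eta>"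
    unfolding funpow.simps o_def by (rule ssep_gen_cong[OF Suc.prems Suc.IH])
  then show ?case by (simp add: ssep_gen_sum)
qed

lemma ssep_semigroup_expand:
  assumes "p \<in> {0..1}" "q \<in> {0..1}" "\<eta> \<in> configs N"
  shows "ssep_semigroup N p q t \<phi> \<eta> =
           (\<Sum>\<xi>\<in>configs N. \<phi> \<xi> * ssep_semigroup N p q t (indicator {\<xi>}) \<eta>)"
proof -
  have sm: "summable (\<lambda>k. t ^ k / fact k * (ssep_gen N p q ^^ k) \<psi> \<eta>)" for \<psi>
    using ssep_semigroup_sums(1)[OF assms] by (rule sums_summable)
  have "ssep_semigroup N p q t \<phi> \<eta> = (\<Sum>k. \<Sum>\<xi>\<in>configs N.
      \<phi> \<xi> * (t ^ k / fact k * (ssep_gen N p q ^^ k) (indicator {\<xi>}) \<eta>))"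
    unfolding ssep_semigroup_def ssep_gen_pow_expand[OF assms(3), where \<phi> = \<phi>]
    by (simp add: sum_distrib_left mult.left_commute)
  also have "\<dots> = (\<Sum>\<xi>\<in>configs N. \<Sum>k.
      \<phi> \<xi> * (t ^ k / fact k * (ssep_gen N p q ^^ k) (indicator {\<xi>}) \<eta>))"
    by (intro suminf_sum summable_mult sm)
  finally show ?thesis
    by (simp only: ssep_semigroup_def suminf_mult[OF sm])
qed

lemma ssep_semigroup_one: "ssep_semigroup N p q t (\<lambda>_. 1) \<eta> = 1"
proof -
  have gen0: "ssep_gen N p q (\<lambda>_. a) = (\<lambda>_. 0)" for a
    by (rule ext) (simp add: ssep_gen_def algebra_simps)
  have "(ssep_gen N p q ^^ k) (\<lambda>_. 1) = (\<lambda>_. if k = 0 then 1 else 0)" for k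
    by (induction k) (auto simp: gen0)
  then have "(\<lambda>k. t ^ k / fact k * (ssep_gen N p q ^^ k) (\<lambda>_. 1) \<eta>) =
      (\<lambda>k. if k = 0 then 1 else 0)"
    by (auto simp: fun_eq_iff)
  moreover have "(\<Sum>k::nat. if k = 0 then 1 else 0 :: real) = 1"
    using sums_single[of 0 "\<lambda>_. 1 :: real"] by (simp add: sums_iff)
  ultimately show ?thesis unfolding ssep_semigroup_def by simp
qed

lemma ssep_semigroup_outside:
  assumes "p \<in> {0..1}" "q \<in> {0..1}" "\<eta> \<in> configs N" "\<xi> \<notin> configs N"
  shows "ssep_semigroup N p q t (indicator {\<xi>}) \<eta> = 0"
proof -
  have "(\<Sum>\<zeta>\<in>configs N. indicator {\<xi>} \<zeta> * ssep_semigroup N p q t (indicator {\<zeta>}) \<eta>) = 0"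
    using assms(4) by (intro sum.neutral) (auto simp: indicator_def)
  then show ?thesis
    by (simp only: ssep_semigroup_expand[OF assms(1-3), where \<phi> = "indicator {\<xi>}"])
qed

lemma pmf_ssep_law:
  assumes "p \<in> {0..1}" "q \<in> {0..1}" "\<eta> \<in> configs N" "0 \<le> t"
  shows "pmf (ssep_law N p q \<eta> t) \<xi> = ssep_semigroup N p q t (indicator {\<xi>}) \<eta>"
  unfolding ssep_law_def
proof (rule pmf_embed_pmf)
  let ?f = "\<lambda>\<xi>. ssep_semigroup N p q t (indicator {\<xi>}) \<eta>"
  show nn: "0 \<le> ?f x" for x by (rule ssep_semigroup_nonneg[OF assms]) simp
  have "(\<integral>\<^sup>+x. ennreal (?f x) \<partial>count_space UNIV) = (\<Sum>x\<in>configs N. ennreal (?f x))"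
    by (rule nn_integral_count_space')
       (use finite_configs ssep_semigroup_outside[OF assms(1-3)] in auto)
  also have "\<dots> = ennreal (\<Sum>x\<in>configs N. ?f x)"
    by (rule sum_ennreal) (rule nn)
  also have "(\<Sum>x\<in>configs N. ?f x) = 1"
    using ssep_semigroup_expand[OF assms(1-3), of t "\<lambda>_. 1"] by (simp add: ssep_semigroup_one)
  finally show "(\<integral>\<^sup>+x. ennreal (?f x) \<partial>count_space UNIV) = 1" by simp
qed

lemma set_pmf_ssep_law:
  assumes "p \<in> {0..1}" "q \<in> {0..1}" "\<eta> \<in> configs N" "0 \<le> t"
  shows "set_pmf (ssep_law N p q \<eta> t) \<subseteq> configs N"
  using ssep_semigroup_outside[OF assms(1-3)]
  by (auto simp: set_pmf_iff pmf_ssep_law[OF assms] intro: ccontr)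

lemma expectation_ssep_law:
  assumes "p \<in> {0..1}" "q \<in> {0..1}" "\<eta> \<in> configs N" "0 \<le> t"
  shows "measure_pmf.expectation (ssep_law N p q \<eta> t) \<phi> = ssep_semigroup N p q t \<phi> \<eta>"
proof -
  have "measure_pmf.expectation (ssep_law N p q \<eta> t) \<phi> =
      (\<Sum>\<xi>\<in>configs N. \<phi> \<xi> * pmf (ssep_law N p q \<eta> t) \<xi>)"
    by (rule integral_measure_pmf_real) (use finite_configs set_pmf_ssep_law[OF assms] in auto)
  then show ?thesis
    by (simp add: pmf_ssep_law[OF assms] ssep_semigroup_expand[OF assms(1-3), of t \<phi>])
qed

end

theory Submission
  imports Defs
begin

text \<open>By monotone coupling, two copies of the process started from configurations differing at one
  site differ at time \<open>s\<close> with probability the survival probability of a walk killed at both ends,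
  so the expected number of discrepancies at time \<open>s\<close> is the quantity \<open>E\<^sup>0\<^sub>1 S\<close> defining
  \<open>t\<^sup>*\<close>. This suffices for the upper bound when \<open>N p \<le> 1\<close>. Otherwise one shows that the semigroup
  at a constant time maps \<open>[-1, 1]\<close>-valued functions to functions whose discrete gradient is
  \<open>O (1 / sqrt (N p (1 - p)))\<close>, and absorbs the remaining \<open>sqrt (N p)\<close> discrepancies.

  For the regularization, reveal the environment: the set of sites whose content comes from the
  left reservoir (an independent Bernoulli(\<open>p\<close>) variable), together with the site of a discrepancy.
  Given the environment, the discrepancy has a law \<open>\<nu>\<close> on this set, and Bessel's inequality bounds
  the gradient by the square root of \<open>\<Sum>\<nu>\<^sup>2 / (p (1 - p))\<close>. The expectation of \<open>\<Sum>\<nu>\<^sup>2\<close>, the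
  probability that two conditionally independent copies of the discrepancy coincide, is shown to
  be \<open>O (1 / N)\<close> by Lyapunov functions: copies on the same site separate as soon as a neighbouring
  site belongs to the environment, and a separated pair rarely meets again. The density of the
  environment near the pair is controlled by negative dependence and a Chernoff bound.

  For the lower bound, the weight has variance at most its mean by negative correlations, and
  Chebyshev's inequality distinguishes the process started from the full configuration from
  equilibrium.\<close>

text \<open>No path space and no coupling is constructed. Every probabilistic statement is an
  identity or inequality between generators, transported to the semigroups: closed subsystems by
  \<open>sgp_intertwine\<close>, bounds by drifts (\<open>sgp_antimono\<close>,
  \<open>sgp_le_deriv\<close>, \<open>sgp_time_antimono\<close>). Since \<open>\<nu>\<close> is a
  real vector, the revealed process has an infinite state space; this is why the semigroup theory is
  set up for bounded functions with a pointwise continuity condition and not for matrices. The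
  obstacle in the spreading estimate is that the environment is thin near the right end: in
  equilibrium a site \<open>k\<close> belongs to it with probability \<open>lin N k\<close> only.
  Hence the sum of \<open>\<nu> k\<close> squared is first controlled with the weight
  \<open>lin\<close>, and one unit of time turns a bound W on it into O(1/N) + O(W / n^2) only. Four
  units yield the factor n^(-8), about 1/N. One unit before them fills the environment and one unit
  after them removes the weight, whence the constant time 6.\<close>

section \<open>Semigroups of sub-Markov generators\<close>

definition sgp :: "(('z \<Rightarrow> real) \<Rightarrow> 'z \<Rightarrow> real) \<Rightarrow> real \<Rightarrow> ('z \<Rightarrow> real) \<Rightarrow> 'z \<Rightarrow> real" where
  "sgp L t F z = (\<Sum>k. t ^ k / fact k * (L ^^ k) F z)"

definition bounded_fn :: "'z set \<Rightarrow> ('z \<Rightarrow> real) \<Rightarrow> bool" where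
  "bounded_fn Z F \<longleftrightarrow> (\<exists>K. \<forall>z\<in>Z. \<bar>F z\<bar> \<le> K)"

lemma bounded_fnI: "(\<And>z. z \<in> Z \<Longrightarrow> \<bar>F z\<bar> \<le> K) \<Longrightarrow> bounded_fn Z F"
  unfolding bounded_fn_def by blast

lemma bounded_fnE:
  assumes "bounded_fn Z F"
  obtains K where "0 \<le> K" "\<And>z. z \<in> Z \<Longrightarrow> \<bar>F z\<bar> \<le> K"
proof -
  obtain K where K: "\<And>z. z \<in> Z \<Longrightarrow> \<bar>F z\<bar> \<le> K"
    using assms unfolding bounded_fn_def by blast
  show thesis
    by (rule that[of "\<bar>K\<bar>"]) (use K in \<open>fastforce+\<close>)
qed

lemma bounded_fnD: "bounded_fn Z F \<Longrightarrow> \<exists>K\<ge>0. \<forall>z\<in>Z. \<bar>F z\<bar> \<le> K"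
  by (erule bounded_fnE) blast

lemma bounded_fn_const [simp]: "bounded_fn Z (\<lambda>_. a)"
  by (rule bounded_fnI) auto

lemma bounded_fn_lin:
  assumes "bounded_fn Z F" "bounded_fn Z G"
  shows "bounded_fn Z (\<lambda>z. a * F z + G z)"
proof -
  obtain K where K: "0 \<le> K" "\<And>z. z \<in> Z \<Longrightarrow> \<bar>F z\<bar> \<le> K" using bounded_fnD[OF assms(1)] by blast
  obtain M where M: "0 \<le> M" "\<And>z. z \<in> Z \<Longrightarrow> \<bar>G z\<bar> \<le> M" using bounded_fnD[OF assms(2)] by blast
  show ?thesis
  proof (rule bounded_fnI)
    fix z assume z: "z \<in> Z"
    have "\<bar>a * F z + G z\<bar> \<le> \<bar>a\<bar> * \<bar>F z\<bar> + \<bar>G z\<bar>" by (metis abs_mult abs_triangle_ineq)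
    also have "\<dots> \<le> \<bar>a\<bar> * K + M" by (intro add_mono mult_left_mono K M z) auto
    finally show "\<bar>a * F z + G z\<bar> \<le> \<bar>a\<bar> * K + M" .
  qed
qed

lemma bounded_fn_add: "bounded_fn Z F \<Longrightarrow> bounded_fn Z G \<Longrightarrow> bounded_fn Z (\<lambda>z. F z + G z)"
  using bounded_fn_lin[of Z F G 1] by simp

lemma bounded_fn_cmult: "bounded_fn Z F \<Longrightarrow> bounded_fn Z (\<lambda>z. a * F z)"
  using bounded_fn_lin[of Z F "\<lambda>_. 0" a] by simp

lemma bounded_fn_diff: "bounded_fn Z F \<Longrightarrow> bounded_fn Z G \<Longrightarrow> bounded_fn Z (\<lambda>z. F z - G z)"
  using bounded_fn_lin[of Z G F "-1"] by simp

lemma bounded_fn_mult: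
  assumes "bounded_fn Z F" "bounded_fn Z G"
  shows "bounded_fn Z (\<lambda>z. F z * G z)"
proof -
  obtain K where K: "0 \<le> K" "\<And>z. z \<in> Z \<Longrightarrow> \<bar>F z\<bar> \<le> K" using bounded_fnD[OF assms(1)] by blast
  obtain M where M: "0 \<le> M" "\<And>z. z \<in> Z \<Longrightarrow> \<bar>G z\<bar> \<le> M" using bounded_fnD[OF assms(2)] by blast
  show ?thesis
    by (rule bounded_fnI[of _ _ "K * M"]) (use K M in \<open>auto simp: abs_mult intro!: mult_mono\<close>)
qed

lemma bounded_fn_sum:
  "(\<And>i. i \<in> I \<Longrightarrow> bounded_fn Z (F i)) \<Longrightarrow> bounded_fn Z (\<lambda>z. \<Sum>i\<in>I. F i z)"
  by (induction I rule: infinite_finite_induct) (auto intro: bounded_fn_add)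

lemma bounded_fn_finite: "finite Z \<Longrightarrow> bounded_fn Z F"
  by (rule bounded_fnI[of _ _ "\<Sum>z\<in>Z. \<bar>F z\<bar>"]) (auto intro: member_le_sum)

lemmas bounded_fn_intros =
  bounded_fn_const bounded_fn_add bounded_fn_diff bounded_fn_mult bounded_fn_cmult bounded_fn_sum

text \<open>The condition \<open>L_pos\<close> is the maximum principle: \<open>L + c\<close> is a positive operator.\<close>

locale subgen =
  fixes Z :: "'z set" and L :: "('z \<Rightarrow> real) \<Rightarrow> 'z \<Rightarrow> real" and c :: real
  assumes c_nonneg: "0 \<le> c"
    and L_lin: "z \<in> Z \<Longrightarrow> L (\<lambda>x. a * F x + G x) z = a * L F z + L G z"
    and L_pos: "(\<And>x. x \<in> Z \<Longrightarrow> 0 \<le> F x) \<Longrightarrow> z \<in> Z \<Longrightarrow> 0 \<le> L F z + c * F z"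
    and L_one: "z \<in> Z \<Longrightarrow> L (\<lambda>_. 1) z \<le> 0"
    and L_cont: "(\<And>x. x \<in> Z \<Longrightarrow> (\<lambda>n. Fn n x) \<longlonglongrightarrow> F x) \<Longrightarrow> z \<in> Z \<Longrightarrow>
      (\<lambda>n. L (Fn n) z) \<longlonglongrightarrow> L F z"
begin

lemma L_zero: "z \<in> Z \<Longrightarrow> L (\<lambda>_. 0) z = 0"
  using L_lin[of z "-1" "\<lambda>_. 0" "\<lambda>_. 0"] by simp

lemma L_cmult: "z \<in> Z \<Longrightarrow> L (\<lambda>x. a * F x) z = a * L F z"
  using L_lin[of z a F "\<lambda>_. 0"] by (simp add: L_zero)

lemma L_add: "z \<in> Z \<Longrightarrow> L (\<lambda>x. F x + G x) z = L F z + L G z"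
  using L_lin[of z 1 F G] by simp

lemma L_diff: "z \<in> Z \<Longrightarrow> L (\<lambda>x. F x - G x) z = L F z - L G z"
  using L_lin[of z "-1" G F] by simp

lemma L_sum: "z \<in> Z \<Longrightarrow> L (\<lambda>x. \<Sum>i\<in>I. F i x) z = (\<Sum>i\<in>I. L (F i) z)"
  by (induction I rule: infinite_finite_induct) (auto simp: L_zero L_add)

text \<open>The maximum principle applied to \<open>F - G\<close> and \<open>G - F\<close>, which
  both vanish on \<open>Z\<close>: values outside \<open>Z\<close> are never seen, although
  functions are total.\<close>

lemma L_cong:
  assumes "\<And>x. x \<in> Z \<Longrightarrow> F x = G x" "z \<in> Z"
  shows "L F z = L G z"
proof -
  have "0 \<le> L (\<lambda>x. F x - G x) z + c * (F z - G z)" using assms by (intro L_pos) auto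
  moreover have "0 \<le> L (\<lambda>x. G x - F x) z + c * (G z - F z)" using assms by (intro L_pos) auto
  ultimately show ?thesis using assms by (simp add: L_diff)
qed

text \<open>\<open>L + c\<close> is positive, so \<open>F\<close> can be compared with the constants
  \<open>K\<close> and \<open>- K\<close>, and \<open>L 1 \<le> 0\<close> bounds the image of these
  constants.\<close>

lemma Lc_bound:
  assumes "\<And>x. x \<in> Z \<Longrightarrow> \<bar>F x\<bar> \<le> K" "z \<in> Z"
  shows "\<bar>L F z + c * F z\<bar> \<le> c * K"
proof -
  have K: "0 \<le> K" using assms by fastforce
  have "0 \<le> L (\<lambda>x. K * 1 - F x) z + c * (K * 1 - F z)"
    using assms(1) by (intro L_pos assms(2)) (auto simp: abs_le_iff)
  moreover have "0 \<le> L (\<lambda>x. K * 1 + F x) z + c * (K * 1 + F z)"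
    using assms(1) by (intro L_pos assms(2)) (smt (verit) abs_le_iff)
  moreover have "L (\<lambda>x. K * 1) z \<le> 0"
    using L_one[OF assms(2)] K by (subst L_cmult[OF assms(2)]) (auto intro: mult_nonneg_nonpos)
  ultimately show ?thesis using assms(2)
    by (simp add: L_diff L_add algebra_simps abs_le_iff)
qed

lemma L_bound:
  assumes "\<And>x. x \<in> Z \<Longrightarrow> \<bar>F x\<bar> \<le> K" "z \<in> Z"
  shows "\<bar>L F z\<bar> \<le> 2 * c * K"
proof -
  have "\<bar>c * F z\<bar> \<le> c * K" using assms c_nonneg by (auto simp: abs_mult intro: mult_left_mono)
  with Lc_bound[of F K z] assms show ?thesis by (simp add: abs_le_iff)
qed

lemma bounded_L: "bounded_fn Z F \<Longrightarrow> bounded_fn Z (L F)"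
  by (erule bounded_fnE, rule bounded_fnI, rule L_bound)

lemma bounded_pow: "bounded_fn Z F \<Longrightarrow> bounded_fn Z ((L ^^ k) F)"
  by (induction k) (auto intro: bounded_L)

lemma pow_bound:
  assumes "\<And>x. x \<in> Z \<Longrightarrow> \<bar>F x\<bar> \<le> K"
  shows "z \<in> Z \<Longrightarrow> \<bar>(L ^^ k) F z\<bar> \<le> (2 * c) ^ k * K"
proof (induction k arbitrary: z)
  case (Suc k)
  have "\<bar>L ((L ^^ k) F) z\<bar> \<le> 2 * c * ((2 * c) ^ k * K)" by (rule L_bound) (use Suc in auto)
  then show ?case by (simp add: mult_ac)
qed (use assms in auto)

lemma pow_lin: "z \<in> Z \<Longrightarrow> (L ^^ k) (\<lambda>x. a * F x + G x) z = a * (L ^^ k) F z + (L ^^ k) G z"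
proof (induction k arbitrary: z)
  case (Suc k)
  have "L ((L ^^ k) (\<lambda>x. a * F x + G x)) z = L (\<lambda>x. a * (L ^^ k) F x + (L ^^ k) G x) z"
    by (rule L_cong) (use Suc in auto)
  then show ?case by (simp add: L_lin[OF Suc.prems])
qed auto

lemma sgp_abs_summable:
  assumes "\<And>x. x \<in> Z \<Longrightarrow> \<bar>F x\<bar> \<le> K" "z \<in> Z"
  shows "summable (\<lambda>k. \<bar>t ^ k / fact k * (L ^^ k) F z\<bar>)"
    and "(\<Sum>k. \<bar>t ^ k / fact k * (L ^^ k) F z\<bar>) \<le> exp (2 * c * \<bar>t\<bar>) * K"
proof -
  have le: "\<bar>t ^ k / fact k * (L ^^ k) F z\<bar> \<le> (2 * c * \<bar>t\<bar>) ^ k /\<^sub>R fact k * K" for k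
    using mult_left_mono[OF pow_bound[of F K z k], of "\<bar>t\<bar> ^ k / fact k"] assms
    by (simp add: abs_mult power_abs power_mult_distrib divide_simps mult_ac)
  have s: "(\<lambda>k. (2 * c * \<bar>t\<bar>) ^ k /\<^sub>R fact k * K) sums (exp (2 * c * \<bar>t\<bar>) * K)"
    by (intro sums_mult2 exp_converges)
  show sm: "summable (\<lambda>k. \<bar>t ^ k / fact k * (L ^^ k) F z\<bar>)"
    by (rule summable_comparison_test'[OF sums_summable[OF s], of 0]) (use le in auto)
  show "(\<Sum>k. \<bar>t ^ k / fact k * (L ^^ k) F z\<bar>) \<le> exp (2 * c * \<bar>t\<bar>) * K"
    using suminf_le[OF le sm sums_summable[OF s]] sums_unique[OF s] by simp
qed

lemma sgp_summable:
  assumes "bounded_fn Z F" "z \<in> Z"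
  shows "summable (\<lambda>k. t ^ k / fact k * (L ^^ k) F z)"
  using assms by (elim bounded_fnE) (rule summable_rabs_cancel[OF sgp_abs_summable(1)])

lemma sgp_abs_le:
  assumes "\<And>x. x \<in> Z \<Longrightarrow> \<bar>F x\<bar> \<le> K" "z \<in> Z"
  shows "\<bar>sgp L t F z\<bar> \<le> exp (2 * c * \<bar>t\<bar>) * K"
proof -
  have "\<bar>sgp L t F z\<bar> \<le> (\<Sum>k. \<bar>t ^ k / fact k * (L ^^ k) F z\<bar>)"
    unfolding sgp_def by (rule summable_rabs, rule sgp_abs_summable(1)[where K = K]) (use assms in auto)
  also have "\<dots> \<le> exp (2 * c * \<bar>t\<bar>) * K" by (rule sgp_abs_summable(2)) (use assms in auto)
  finally show ?thesis .
qed

lemma bounded_sgp: "bounded_fn Z F \<Longrightarrow> bounded_fn Z (sgp L t F)"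
  by (elim bounded_fnE) (rule bounded_fnI, rule sgp_abs_le)

lemma sgp_0 [simp]: "sgp L 0 F z = F z"
proof -
  have "(\<lambda>k. 0 ^ k / fact k * (L ^^ k) F z) = (\<lambda>k. if k = 0 then F z else 0)"
    by (auto simp: fun_eq_iff)
  then show ?thesis unfolding sgp_def using sums_single[of 0 "\<lambda>_. F z"] by (simp add: sums_iff)
qed

lemma sgp_lin:
  assumes "bounded_fn Z F" "bounded_fn Z G" "z \<in> Z"
  shows "sgp L t (\<lambda>x. a * F x + G x) z = a * sgp L t F z + sgp L t G z"
proof -
  have "sgp L t (\<lambda>x. a * F x + G x) z =
      (\<Sum>k. a * (t ^ k / fact k * (L ^^ k) F z) + t ^ k / fact k * (L ^^ k) G z)"
    unfolding sgp_def pow_lin[OF assms(3)] by (simp only: distrib_left mult.left_commute)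
  also have "\<dots> = a * (\<Sum>k. t ^ k / fact k * (L ^^ k) F z) + (\<Sum>k. t ^ k / fact k * (L ^^ k) G z)"
    by (simp only: suminf_add[symmetric] suminf_mult summable_mult sgp_summable assms)
  finally show ?thesis by (simp add: sgp_def)
qed

lemma sgp_zero: "z \<in> Z \<Longrightarrow> sgp L t (\<lambda>_. 0) z = 0"
  using sgp_lin[of "\<lambda>_. 0" "\<lambda>_. 0" z t "-1"] by simp

lemma sgp_cmult: "bounded_fn Z F \<Longrightarrow> z \<in> Z \<Longrightarrow> sgp L t (\<lambda>x. a * F x) z = a * sgp L t F z"
  using sgp_lin[of F "\<lambda>_. 0" z t a] by (simp add: sgp_zero)

lemma sgp_add: "bounded_fn Z F \<Longrightarrow> bounded_fn Z G \<Longrightarrow> z \<in> Z \<Longrightarrow>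
    sgp L t (\<lambda>x. F x + G x) z = sgp L t F z + sgp L t G z"
  using sgp_lin[of F G z t 1] by simp

lemma sgp_diff: "bounded_fn Z F \<Longrightarrow> bounded_fn Z G \<Longrightarrow> z \<in> Z \<Longrightarrow>
    sgp L t (\<lambda>x. F x - G x) z = sgp L t F z - sgp L t G z"
  using sgp_lin[of G F z t "-1"] by simp

lemma sgp_sum:
  "(\<And>i. i \<in> I \<Longrightarrow> bounded_fn Z (F i)) \<Longrightarrow> z \<in> Z \<Longrightarrow>
    sgp L t (\<lambda>x. \<Sum>i\<in>I. F i x) z = (\<Sum>i\<in>I. sgp L t (F i) z)"
  by (induction I rule: infinite_finite_induct) (auto simp: sgp_zero sgp_add bounded_fn_sum)

lemma sgp_DERIV:
  assumes "bounded_fn Z F" "z \<in> Z"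
  shows "((\<lambda>t. sgp L t F z) has_real_derivative sgp L t (L F) z) (at t)"
proof -
  define C where "C = (\<lambda>k. (L ^^ k) F z / fact k)"
  have sm: "summable (\<lambda>k. C k * x ^ k)" for x
    using sgp_summable[OF assms, of x] by (simp add: C_def field_simps)
  have "((\<lambda>t. \<Sum>k. C k * t ^ k) has_real_derivative (\<Sum>k. diffs C k * t ^ k)) (at t)"
    by (rule termdiffs_strong_converges_everywhere[OF sm])
  moreover have "(\<lambda>t. \<Sum>k. C k * t ^ k) = (\<lambda>t. sgp L t F z)"
    by (simp add: C_def sgp_def field_simps)
  moreover have "(\<Sum>k. diffs C k * t ^ k) = sgp L t (L F) z"
    unfolding sgp_def diffs_def C_def
    by (intro suminf_cong) (simp add: funpow_swap1 field_simps del: of_nat_Suc)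
  ultimately show ?thesis by simp
qed

lemma sgp_cong:
  assumes "\<And>x. x \<in> Z \<Longrightarrow> F x = G x" "z \<in> Z"
  shows "sgp L t F z = sgp L t G z"
proof -
  have "(L ^^ k) F x = (L ^^ k) G x" if "x \<in> Z" for k x
    using that by (induction k arbitrary: x) (auto simp: assms intro: L_cong)
  then show ?thesis unfolding sgp_def using assms by simp
qed

lemma fact_tail_null: "(\<lambda>n. x ^ n / fact n * (K::real)) \<longlonglongrightarrow> 0"
proof -
  have "summable (\<lambda>n. x ^ n /\<^sub>R fact n)" by (rule summable_exp_generic)
  then have "(\<lambda>n. x ^ n /\<^sub>R fact n) \<longlonglongrightarrow> 0" by (rule summable_LIMSEQ_zero)
  then have "(\<lambda>n. (x ^ n /\<^sub>R fact n) * K) \<longlonglongrightarrow> 0 * K" by (intro tendsto_mult tendsto_const)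
  then show ?thesis by (simp add: field_simps)
qed

text \<open>Taylor expansion of \<open>exp (c t) sgp L t F\<close>, whose derivatives at \<open>0\<close> are \<open>(L + c)^k F\<close>.\<close>

lemma sgp_nonneg:
  assumes "bounded_fn Z F" "z \<in> Z" "0 \<le> t" "\<And>x. x \<in> Z \<Longrightarrow> 0 \<le> F x"
  shows "0 \<le> sgp L t F z"
proof -
  define A where "A = (\<lambda>F z. L F z + c * F z)"
  have A_app: "A G x = L G x + c * G x" for G x by (simp add: A_def)
  obtain K where K: "0 \<le> K" "\<And>z. z \<in> Z \<Longrightarrow> \<bar>F z\<bar> \<le> K" using bounded_fnD[OF assms(1)] by blast
  have nn: "0 \<le> (A ^^ k) F x" if "x \<in> Z" for k x
    using that by (induction k arbitrary: x) (auto simp: assms(4) A_app intro: L_pos)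
  have Ab: "\<bar>(A ^^ k) F x\<bar> \<le> c ^ k * K" if "x \<in> Z" for k x
    using that
  proof (induction k arbitrary: x)
    case (Suc k)
    have "\<bar>A ((A ^^ k) F) x\<bar> \<le> c * (c ^ k * K)"
      by (subst A_app, rule Lc_bound) (use Suc in auto)
    then show ?case by (simp add: mult_ac)
  qed (use K in auto)
  have bA: "bounded_fn Z ((A ^^ k) F)" for k by (rule bounded_fnI[OF Ab])
  define D where "D = (\<lambda>m t. exp (c * t) * sgp L t ((A ^^ m) F) z)"
  have Dd: "DERIV (D m) x :> D (Suc m) x" for m x
  proof -
    have e: "sgp L x ((A ^^ Suc m) F) z = c * sgp L x ((A ^^ m) F) z + sgp L x (L ((A ^^ m) F)) z"
      using sgp_lin[OF bA bounded_L[OF bA] assms(2), of x c] by (simp add: A_def add.commute)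
    have "DERIV (\<lambda>t. exp (c * t)) x :> exp (c * x) * c"
      by (auto intro!: derivative_eq_intros)
    from DERIV_mult[OF this sgp_DERIV[OF bA assms(2)]] show ?thesis
      unfolding D_def e by (simp add: algebra_simps)
  qed
  \<comment> \<open>The Taylor coefficients at 0 are the nonnegative \<open>(A ^^ m) F z\<close>.
    Only the remainder can be negative, and it tends to 0 as \<open>n\<close> grows.\<close>
  have lb: "- ((c * t) ^ n / fact n * (exp (c * t) * exp (2 * c * t) * K)) \<le> D 0 t" for n
  proof -
    obtain s where s: "\<bar>s\<bar> \<le> \<bar>t\<bar>" "D 0 t = (\<Sum>m<n. D m 0 / fact m * t ^ m) + D n s / fact n * t ^ n"
      using Maclaurin_all_le[of D "D 0" t n] Dd by auto
    have "0 \<le> (\<Sum>m<n. D m 0 / fact m * t ^ m)"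
      using nn[OF assms(2)] assms(3) by (intro sum_nonneg) (auto simp: D_def)
    moreover have "\<bar>D n s / fact n * t ^ n\<bar> \<le> (c * t) ^ n / fact n * (exp (c * t) * exp (2 * c * t) * K)"
    proof -
      have cs: "c * s \<le> c * t" "c * \<bar>s\<bar> \<le> c * t"
        using s(1) assms(3) c_nonneg by (auto intro!: mult_left_mono)
      have "\<bar>sgp L s ((A ^^ n) F) z\<bar> \<le> exp (2 * c * \<bar>s\<bar>) * (c ^ n * K)"
        by (rule sgp_abs_le[OF Ab assms(2)])
      also have "\<dots> \<le> exp (2 * c * t) * (c ^ n * K)"
        using cs K c_nonneg by (intro mult_right_mono) (auto simp: mult.assoc)
      finally have "\<bar>D n s\<bar> \<le> exp (c * t) * (exp (2 * c * t) * (c ^ n * K))"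
        unfolding D_def abs_mult using cs by (intro mult_mono) auto
      from mult_right_mono[OF this, of "t ^ n / fact n"] show ?thesis
        using assms(3) by (simp add: abs_mult power_mult_distrib mult_ac)
    qed
    ultimately show ?thesis unfolding s(2) by linarith
  qed
  have "0 \<le> D 0 t"
  proof (rule LIMSEQ_le_const2)
    show "(\<lambda>n. - ((c * t) ^ n / fact n * (exp (c * t) * exp (2 * c * t) * K))) \<longlonglongrightarrow> 0"
      using tendsto_minus[OF fact_tail_null] by simp
  qed (use lb in auto)
  then show ?thesis by (simp add: D_def zero_le_mult_iff)
qed

lemma sgp_mono:
  assumes "bounded_fn Z F" "bounded_fn Z G" "z \<in> Z" "0 \<le> t" "\<And>x. x \<in> Z \<Longrightarrow> F x \<le> G x"
  shows "sgp L t F z \<le> sgp L t G z"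
  using sgp_nonneg[of "\<lambda>x. G x - F x" z t] assms by (simp add: sgp_diff bounded_fn_diff)

lemma sgp_le_deriv:
  assumes F: "bounded_fn Z F" and z: "z \<in> Z" and st: "s \<le> t"
    and e: "\<And>r. s \<le> r \<Longrightarrow> r \<le> t \<Longrightarrow> sgp L r (L F) z \<le> e"
  shows "sgp L t F z \<le> sgp L s F z + e * (t - s)"
proof -
  have "sgp L t F z - e * t \<le> sgp L s F z - e * s"
  proof (rule DERIV_nonpos_imp_nonincreasing[OF st])
    fix r assume r: "s \<le> r" "r \<le> t"
    have "((\<lambda>t. sgp L t F z - e * t) has_real_derivative sgp L r (L F) z - e) (at r)"
      by (auto intro!: derivative_eq_intros sgp_DERIV[OF F z])
    then show "\<exists>y. ((\<lambda>t. sgp L t F z - e * t) has_real_derivative y) (at r) \<and> y \<le> 0"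
      using e[OF r] by auto
  qed
  then show ?thesis by (simp add: algebra_simps)
qed

lemma sgp_antimono:
  assumes F: "bounded_fn Z F" and z: "z \<in> Z" and st: "0 \<le> s" "s \<le> t"
    and LF: "\<And>x. x \<in> Z \<Longrightarrow> L F x \<le> 0"
  shows "sgp L t F z \<le> sgp L s F z"
proof -
  have "sgp L r (L F) z \<le> 0" if "s \<le> r" for r
    using sgp_mono[OF bounded_L[OF F] bounded_fn_const z, of r 0] that st LF by (simp add: sgp_zero z)
  then show ?thesis using sgp_le_deriv[OF F z st(2), of 0] by simp
qed

lemma sgp_one_le: "z \<in> Z \<Longrightarrow> 0 \<le> t \<Longrightarrow> sgp L t (\<lambda>_. 1) z \<le> 1"
  using sgp_antimono[of "\<lambda>_. 1" z 0 t] L_one by simp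

lemma sgp_le_const:
  assumes "bounded_fn Z F" "z \<in> Z" "0 \<le> t" "0 \<le> K" "\<And>x. x \<in> Z \<Longrightarrow> F x \<le> K"
  shows "sgp L t F z \<le> K"
proof -
  have "sgp L t F z \<le> sgp L t (\<lambda>_. K * 1) z" by (rule sgp_mono) (use assms in auto)
  also have "\<dots> = K * sgp L t (\<lambda>_. 1) z" by (rule sgp_cmult) (use assms in auto)
  also have "\<dots> \<le> K * 1" by (intro mult_left_mono sgp_one_le assms)
  finally show ?thesis by simp
qed

lemma sgp_abs:
  assumes "bounded_fn Z F" "z \<in> Z" "0 \<le> t" "bounded_fn Z G" "\<And>x. x \<in> Z \<Longrightarrow> \<bar>F x\<bar> \<le> G x"
  shows "\<bar>sgp L t F z\<bar> \<le> sgp L t G z"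
proof -
  have "sgp L t F z \<le> sgp L t G z" by (rule sgp_mono) (use assms abs_le_iff in auto)
  moreover have "sgp L t (\<lambda>x. -1 * F x) z \<le> sgp L t G z"
    by (rule sgp_mono[OF bounded_fn_cmult]) (use assms abs_le_iff in auto)
  ultimately show ?thesis using sgp_cmult[OF assms(1,2), of t "-1"] by (simp add: abs_le_iff)
qed

text \<open>Exchanging \<open>L\<close> with the infinite series is what \<open>L_cont\<close> is
  for; on partial sums linearity suffices.\<close>

lemma L_sgp:
  assumes "bounded_fn Z F" "z \<in> Z"
  shows "L (sgp L t F) z = sgp L t (L F) z"
proof -
  define S where "S = (\<lambda>n x. \<Sum>k<n. t ^ k / fact k * (L ^^ k) F x)"
  have "(\<lambda>n. L (S n) z) \<longlonglongrightarrow> L (sgp L t F) z"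
    by (rule L_cont[OF _ assms(2)])
       (use sgp_summable[OF assms(1)] in \<open>auto simp: S_def sgp_def summable_LIMSEQ\<close>)
  moreover have "L (S n) z = (\<Sum>k<n. t ^ k / fact k * (L ^^ k) (L F) z)" for n
    unfolding S_def using assms(2) by (simp add: L_sum L_cmult funpow_swap1 del: times_divide_eq_left)
  moreover have "(\<lambda>n. \<Sum>k<n. t ^ k / fact k * (L ^^ k) (L F) z) \<longlonglongrightarrow> sgp L t (L F) z"
    unfolding sgp_def using sgp_summable[OF bounded_L[OF assms(1)] assms(2)] by (rule summable_LIMSEQ)
  ultimately show ?thesis by (simp add: LIMSEQ_unique)
qed

lemma pow_sgp:
  assumes "bounded_fn Z F"
  shows "z \<in> Z \<Longrightarrow> (L ^^ k) (sgp L t F) z = sgp L t ((L ^^ k) F) z"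
proof (induction k arbitrary: z)
  case (Suc k)
  have "L ((L ^^ k) (sgp L t F)) z = L (sgp L t ((L ^^ k) F)) z" by (rule L_cong) (use Suc in auto)
  then show ?case by (simp add: L_sgp[OF bounded_pow[OF assms] Suc.prems])
qed auto

text \<open>Taylor expansion of \<open>\<lambda>r. sgp L (t + r) F z\<close> at
  \<open>r = 0\<close>: by \<open>pow_sgp\<close> its coefficients are those of the series that
  defines \<open>sgp L s (sgp L t F) z\<close>.\<close>

lemma sgp_semigroup:
  assumes "bounded_fn Z F" "z \<in> Z"
  shows "sgp L (s + t) F z = sgp L s (sgp L t F) z"
proof -
  obtain K where K: "0 \<le> K" "\<And>z. z \<in> Z \<Longrightarrow> \<bar>F z\<bar> \<le> K" using bounded_fnD[OF assms(1)] by blast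
  define D where "D = (\<lambda>m r. sgp L (t + r) ((L ^^ m) F) z)"
  have Dd: "DERIV (D m) x :> D (Suc m) x" for m x
    using DERIV_shift[of "\<lambda>r. sgp L r ((L ^^ m) F) z" "sgp L (t + x) (L ((L ^^ m) F)) z" x t]
      sgp_DERIV[OF bounded_pow[OF assms(1)] assms(2), of m "t + x"]
    by (simp add: D_def add.commute)
  define R where "R = exp (2 * c * (\<bar>t\<bar> + \<bar>s\<bar>)) * K"
  have "\<bar>D 0 s - (\<Sum>m<n. s ^ m / fact m * (L ^^ m) (sgp L t F) z)\<bar> \<le> (2 * c * \<bar>s\<bar>) ^ n / fact n * R" for n
  proof -
    obtain r where r: "\<bar>r\<bar> \<le> \<bar>s\<bar>" "D 0 s = (\<Sum>m<n. D m 0 / fact m * s ^ m) + D n r / fact n * s ^ n"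
      using Maclaurin_all_le[of D "D 0" s n] Dd by auto
    have "\<bar>D n r\<bar> \<le> exp (2 * c * \<bar>t + r\<bar>) * ((2 * c) ^ n * K)"
      unfolding D_def by (rule sgp_abs_le[OF pow_bound[OF K(2)] assms(2)])
    also have "\<dots> \<le> exp (2 * c * (\<bar>t\<bar> + \<bar>s\<bar>)) * ((2 * c) ^ n * K)"
      using r(1) K(1) c_nonneg by (intro mult_right_mono) (auto intro!: mult_left_mono)
    finally have "\<bar>D n r / fact n * s ^ n\<bar> \<le> (2 * c * \<bar>s\<bar>) ^ n / fact n * R"
      using mult_right_mono[of "\<bar>D n r\<bar>" _ "\<bar>s\<bar> ^ n / fact n"]
      by (fastforce simp: R_def abs_mult power_abs power_mult_distrib mult_ac)
    moreover have "(\<Sum>m<n. D m 0 / fact m * s ^ m) = (\<Sum>m<n. s ^ m / fact m * (L ^^ m) (sgp L t F) z)"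
      by (intro sum.cong) (auto simp: D_def pow_sgp[OF assms] field_simps)
    ultimately show ?thesis using r(2) by simp
  qed
  then have "(\<lambda>n. D 0 s - (\<Sum>m<n. s ^ m / fact m * (L ^^ m) (sgp L t F) z)) \<longlonglongrightarrow> 0"
    by (intro Lim_null_comparison[OF _ fact_tail_null[of "2 * c * \<bar>s\<bar>" R]]) auto
  then have "(\<lambda>n. D 0 s - (D 0 s - (\<Sum>m<n. s ^ m / fact m * (L ^^ m) (sgp L t F) z))) \<longlonglongrightarrow> D 0 s - 0"
    by (intro tendsto_diff tendsto_const)
  then have "(\<lambda>n. \<Sum>m<n. s ^ m / fact m * (L ^^ m) (sgp L t F) z) \<longlonglongrightarrow> D 0 s" by simp
  moreover have "(\<lambda>n. \<Sum>m<n. s ^ m / fact m * (L ^^ m) (sgp L t F) z) \<longlonglongrightarrow> sgp L s (sgp L t F) z"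
    unfolding sgp_def[of L s] using sgp_summable[OF bounded_sgp[OF assms(1)] assms(2)]
    by (rule summable_LIMSEQ)
  ultimately have "D 0 s = sgp L s (sgp L t F) z" by (rule LIMSEQ_unique)
  then show ?thesis by (simp add: D_def add.commute)
qed

text \<open>Jensen's inequality, from the nonnegative variance around \<open>?m\<close>. Total mass
  at most 1 suffices because the mass enters with the coefficient \<open>?m\<close> squared.\<close>

lemma sgp_square:
  assumes "bounded_fn Z F" "z \<in> Z" "0 \<le> t"
  shows "(sgp L t F z)\<^sup>2 \<le> sgp L t (\<lambda>x. (F x)\<^sup>2) z"
proof -
  let ?m = "sgp L t F z"
  have b2: "bounded_fn Z (\<lambda>x. (F x)\<^sup>2)" using assms by (simp add: power2_eq_square bounded_fn_mult)
  have "0 \<le> sgp L t (\<lambda>x. (F x - ?m * 1)\<^sup>2) z"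
    by (rule sgp_nonneg) (auto simp: power2_eq_square intro!: bounded_fn_intros assms)
  also have "(\<lambda>x. (F x - ?m * 1)\<^sup>2) = (\<lambda>x. (-2 * ?m) * F x + ((F x)\<^sup>2 + ?m\<^sup>2 * 1))"
    by (auto simp: power2_eq_square algebra_simps)
  also have "sgp L t \<dots> z = (-2 * ?m) * ?m + (sgp L t (\<lambda>x. (F x)\<^sup>2) z + ?m\<^sup>2 * sgp L t (\<lambda>_. 1) z)"
    by (simp only: sgp_lin[OF assms(1) bounded_fn_add[OF b2 bounded_fn_cmult[OF bounded_fn_const]] assms(2)]
        sgp_add[OF b2 bounded_fn_cmult[OF bounded_fn_const] assms(2)] sgp_cmult[OF bounded_fn_const assms(2)])
  also have "\<dots> \<le> (-2 * ?m) * ?m + (sgp L t (\<lambda>x. (F x)\<^sup>2) z + ?m\<^sup>2 * 1)"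
    by (intro add_left_mono mult_left_mono sgp_one_le assms) auto
  finally show ?thesis by (simp add: power2_eq_square)
qed

end

section \<open>Intertwining and time-dependent test functions\<close>

text \<open>Commutation of the generators passes to their powers and hence to the series. All
  duality statements below are instances: reflection, linear statistics, the revealed discrepancy,
  its mean, and the autonomous environment.\<close>

lemma sgp_intertwine:
  assumes "subgen Z L c" "subgen W M d"
    and lin: "\<And>a F G z. z \<in> Z \<Longrightarrow> \<Phi> (\<lambda>x. a * F x + G x) z = a * \<Phi> F z + \<Phi> G z"
    and cont: "\<And>Fn F z. (\<And>x. x \<in> W \<Longrightarrow> (\<lambda>n. Fn n x) \<longlonglongrightarrow> F x) \<Longrightarrow> z \<in> Z \<Longrightarrow>
      (\<lambda>n. \<Phi> (Fn n) z) \<longlonglongrightarrow> \<Phi> F z"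
    and comm: "\<And>F z. z \<in> Z \<Longrightarrow> L (\<Phi> F) z = \<Phi> (M F) z"
    and F: "bounded_fn W F" and z: "z \<in> Z"
  shows "sgp L t (\<Phi> F) z = \<Phi> (sgp M t F) z"
proof -
  interpret L: subgen Z L c by fact
  interpret M: subgen W M d by fact
  have pow: "(L ^^ k) (\<Phi> F) x = \<Phi> ((M ^^ k) F) x" if "x \<in> Z" for k x
    using that
  proof (induction k arbitrary: x)
    case (Suc k)
    have "L ((L ^^ k) (\<Phi> F)) x = L (\<Phi> ((M ^^ k) F)) x" by (rule L.L_cong) (use Suc in auto)
    then show ?case by (simp add: comm[OF Suc.prems])
  qed auto
  have zero: "\<Phi> (\<lambda>_. 0) z = 0" using lin[OF z, of "-1" "\<lambda>_. 0" "\<lambda>_. 0"] by simp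
  have "\<Phi> (\<lambda>x. \<Sum>k<n. t ^ k / fact k * (M ^^ k) F x) z = (\<Sum>k<n. t ^ k / fact k * (L ^^ k) (\<Phi> F) z)" for n
  proof (induction n)
    case (Suc n)
    have "\<Phi> (\<lambda>x. \<Sum>k<Suc n. t ^ k / fact k * (M ^^ k) F x) z =
        \<Phi> (\<lambda>x. t ^ n / fact n * (M ^^ n) F x + (\<Sum>k<n. t ^ k / fact k * (M ^^ k) F x)) z"
      by (simp add: add.commute)
    then show ?case using Suc by (simp only: lin[OF z]) (simp add: pow[OF z] add.commute)
  qed (simp add: zero)
  moreover have "(\<lambda>n. \<Phi> (\<lambda>x. \<Sum>k<n. t ^ k / fact k * (M ^^ k) F x) z) \<longlonglongrightarrow> \<Phi> (sgp M t F) z"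
    by (rule cont[OF _ z]) (use M.sgp_summable[OF F] in \<open>auto simp: sgp_def summable_LIMSEQ\<close>)
  ultimately have "(\<lambda>k. t ^ k / fact k * (L ^^ k) (\<Phi> F) z) sums \<Phi> (sgp M t F) z"
    by (simp add: sums_def)
  then show ?thesis by (simp add: sgp_def sums_iff)
qed

text \<open>On a finite state space the semigroup is a finite combination of its values on
  indicators, which reduces the claim to the product rule.\<close>

lemma (in subgen) sgp_DERIV_time:
  assumes fin: "finite Z" and z: "z \<in> Z"
    and \<Psi>: "\<And>x. x \<in> Z \<Longrightarrow> ((\<lambda>r. \<Psi> r x) has_real_derivative \<Psi>' x) (at r)"
  shows "((\<lambda>r. sgp L r (\<Psi> r) z) has_real_derivative sgp L r (\<lambda>x. L (\<Psi> r) x + \<Psi>' x) z) (at r)"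
proof -
  have exp: "sgp L t F z = (\<Sum>x\<in>Z. F x * sgp L t (indicator {x}) z)" for t F
  proof -
    have "sgp L t F z = sgp L t (\<lambda>y. \<Sum>x\<in>Z. F x * indicator {x} y) z"
    proof (rule sgp_cong[OF _ z])
      fix y assume y: "y \<in> Z"
      have "(\<Sum>x\<in>Z. F x * indicator {x} y) = (\<Sum>x\<in>Z. if x = y then F y else 0)"
        by (intro sum.cong) (auto simp: indicator_def)
      then show "F y = (\<Sum>x\<in>Z. F x * indicator {x} y)" using fin y by simp
    qed
    then show ?thesis by (simp add: sgp_sum sgp_cmult bounded_fn_finite[OF fin] z)
  qed
  have expL: "sgp L t (L F) z = (\<Sum>x\<in>Z. F x * sgp L t (L (indicator {x})) z)" for t F
  proof -
    have "((\<lambda>t. \<Sum>x\<in>Z. F x * sgp L t (indicator {x}) z) has_real_derivative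
        (\<Sum>x\<in>Z. F x * sgp L t (L (indicator {x})) z)) (at t)"
      by (intro DERIV_sum DERIV_cmult sgp_DERIV bounded_fn_finite[OF fin] z)
    then have "((\<lambda>t. sgp L t F z) has_real_derivative
        (\<Sum>x\<in>Z. F x * sgp L t (L (indicator {x})) z)) (at t)"
      by (simp only: exp[abs_def, of _ F, symmetric])
    with sgp_DERIV[OF bounded_fn_finite[OF fin] z] show ?thesis by (rule DERIV_unique)
  qed
  have "((\<lambda>r. \<Sum>x\<in>Z. \<Psi> r x * sgp L r (indicator {x}) z) has_real_derivative
      (\<Sum>x\<in>Z. \<Psi>' x * sgp L r (indicator {x}) z + sgp L r (L (indicator {x})) z * \<Psi> r x)) (at r)"
    by (intro DERIV_sum DERIV_mult sgp_DERIV bounded_fn_finite[OF fin] z \<Psi>)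
  also have "(\<Sum>x\<in>Z. \<Psi>' x * sgp L r (indicator {x}) z + sgp L r (L (indicator {x})) z * \<Psi> r x) =
      sgp L r (\<lambda>x. L (\<Psi> r) x + \<Psi>' x) z"
    using sgp_add[OF bounded_fn_finite[OF fin] bounded_fn_finite[OF fin] z, of r "L (\<Psi> r)" \<Psi>']
      expL[of r "\<Psi> r"] exp[of r \<Psi>'] by (simp add: sum.distrib mult.commute add.commute)
  finally show ?thesis by (subst exp)
qed

text \<open>The supermartingale criterion for functions that also depend on time; it drives the
  second moment bound and the negative dependence of the environment.\<close>

lemma (in subgen) sgp_time_antimono:
  assumes fin: "finite Z" and z: "z \<in> Z" and st: "0 \<le> s" "s \<le> t"
    and \<Psi>: "\<And>x r. x \<in> Z \<Longrightarrow> s \<le> r \<Longrightarrow> r \<le> t \<Longrightarrow> ((\<lambda>r. \<Psi> r x) has_real_derivative \<Psi>' r x) (at r)"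
    and le: "\<And>x r. x \<in> Z \<Longrightarrow> s \<le> r \<Longrightarrow> r \<le> t \<Longrightarrow> L (\<Psi> r) x + \<Psi>' r x \<le> 0"
  shows "sgp L t (\<Psi> t) z \<le> sgp L s (\<Psi> s) z"
proof (rule DERIV_nonpos_imp_nonincreasing[OF st(2)])
  fix r assume r: "s \<le> r" "r \<le> t"
  have "sgp L r (\<lambda>x. L (\<Psi> r) x + \<Psi>' r x) z \<le> sgp L r (\<lambda>_. 0) z"
    using le r st by (intro sgp_mono bounded_fn_finite[OF fin] z) auto
  moreover have "((\<lambda>r. sgp L r (\<Psi> r) z) has_real_derivative
      sgp L r (\<lambda>x. L (\<Psi> r) x + \<Psi>' r x) z) (at r)"
    by (rule sgp_DERIV_time[OF fin z]) (rule \<Psi>[OF _ r])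
  ultimately show "\<exists>y. ((\<lambda>r. sgp L r (\<Psi> r) z) has_real_derivative y) (at r) \<and> y \<le> 0"
    by (auto simp: sgp_zero z)
qed

subsection \<open>The walk killed at both ends\<close>

text \<open>Extension by zero encodes the killing. For \<open>k = 1\<close> the natural number
  \<open>k - 1\<close> is 0, which lies outside \<open>{1..N}\<close>, so that the left end needs no
  case distinction.\<close>

definition zext :: "nat \<Rightarrow> (nat \<Rightarrow> real) \<Rightarrow> nat \<Rightarrow> real" where
  "zext N c k = (if k \<in> {1..N} then c k else 0)"

definition klap :: "nat \<Rightarrow> (nat \<Rightarrow> real) \<Rightarrow> nat \<Rightarrow> real" where
  "klap N c k = (real N)\<^sup>2 * (zext N c (k + 1) + zext N c (k - 1) - 2 * c k)"

lemma klap_subgen: "subgen {1..N} (klap N) (2 * (real N)\<^sup>2)"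
proof
  fix F :: "nat \<Rightarrow> real" and z assume "\<And>x. x \<in> {1..N} \<Longrightarrow> 0 \<le> F x" "z \<in> {1..N}"
  then have "0 \<le> (real N)\<^sup>2 * (zext N F (z + 1) + zext N F (z - 1))"
    by (intro mult_nonneg_nonneg add_nonneg_nonneg) (auto simp: zext_def)
  then show "0 \<le> klap N F z + 2 * (real N)\<^sup>2 * F z" by (simp add: klap_def algebra_simps)
next
  fix z show "klap N (\<lambda>_. 1) z \<le> 0" unfolding klap_def
    by (intro mult_nonneg_nonpos) (auto simp: zext_def)
next
  fix Fn :: "nat \<Rightarrow> nat \<Rightarrow> real" and F z
  assume "\<And>x. x \<in> {1..N} \<Longrightarrow> (\<lambda>n. Fn n x) \<longlonglongrightarrow> F x" "z \<in> {1..N}"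
  then show "(\<lambda>n. klap N (Fn n) z) \<longlonglongrightarrow> klap N F z" unfolding klap_def
    by (intro tendsto_intros) (auto simp: zext_def)
qed (auto simp: klap_def zext_def algebra_simps)

interpretation K: subgen "{1..N}" "klap N" "2 * (real N)\<^sup>2" for N
  by (rule klap_subgen)

lemma sum_by_parts:
  fixes C X :: "nat \<Rightarrow> real"
  shows "(\<Sum>i\<le>N. (C (i + 1) - C i) * (X i - X (i + 1))) =
    (\<Sum>k\<in>{1..N}. (C (k + 1) + C (k - 1) - 2 * C k) * X k) + (C 1 - C 0) * X 0
      - (C (N + 1) - C N) * X (N + 1)"
  by (induction N) (auto simp: algebra_simps)

text \<open>Summation by parts on \<open>0..N + 1\<close> with zero boundary values: the two outer
  edges become the killing terms, and the inner edges match the swaps of the exclusion generators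
  one by one.\<close>

lemma klap_sum_edges:
  assumes "1 \<le> N"
  shows "(\<Sum>k\<in>{1..N}. w k * klap N c k) = (real N)\<^sup>2 *
    ((\<Sum>i\<in>{1..<N}. (c (i + 1) - c i) * (w i - w (i + 1))) - w 1 * c 1 - w N * c N)"
proof -
  let ?C = "zext N c" and ?W = "zext N w"
  have "(\<Sum>k\<in>{1..N}. w k * klap N c k) =
      (real N)\<^sup>2 * (\<Sum>k\<in>{1..N}. (?C (k + 1) + ?C (k - 1) - 2 * ?C k) * ?W k)"
    unfolding sum_distrib_left by (intro sum.cong) (auto simp: klap_def zext_def mult_ac)
  also have "(\<Sum>k\<in>{1..N}. (?C (k + 1) + ?C (k - 1) - 2 * ?C k) * ?W k) =
      (\<Sum>i\<le>N. (?C (i + 1) - ?C i) * (?W i - ?W (i + 1)))"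
    using sum_by_parts[of ?C ?W N] by (simp add: zext_def)
  also have "{..N} = insert 0 (insert N {1..<N})" using assms by auto
  also have "(\<Sum>i\<in>\<dots>. (?C (i + 1) - ?C i) * (?W i - ?W (i + 1))) =
      (\<Sum>i\<in>{1..<N}. (?C (i + 1) - ?C i) * (?W i - ?W (i + 1))) - w 1 * c 1 - w N * c N"
    using assms by (simp add: zext_def)
  also have "(\<Sum>i\<in>{1..<N}. (?C (i + 1) - ?C i) * (?W i - ?W (i + 1))) =
      (\<Sum>i\<in>{1..<N}. (c (i + 1) - c i) * (w i - w (i + 1)))"
    by (intro sum.cong) (auto simp: zext_def)
  finally show ?thesis .
qed

lemma klap_symmetric:
  "(\<Sum>k\<in>{1..N}. w k * klap N c k) = (\<Sum>k\<in>{1..N}. klap N w k * c k)"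
proof (cases "1 \<le> N")
  case True
  have "(\<Sum>k\<in>{1..N}. klap N w k * c k) = (\<Sum>k\<in>{1..N}. c k * klap N w k)"
    by (simp add: mult.commute)
  moreover have "(\<Sum>i\<in>{1..<N}. (c (i + 1) - c i) * (w i - w (i + 1))) =
      (\<Sum>i\<in>{1..<N}. (w (i + 1) - w i) * (c i - c (i + 1)))"
    by (intro sum.cong) (auto simp: algebra_simps)
  ultimately show ?thesis unfolding klap_sum_edges[OF True] by (simp add: mult.commute)
qed auto

text \<open>Green's function of the walk killed on the right and reflected on the left;
  \<open>N + 1 - k\<close> is the distance to the killing site, and \<open>s\<close> is indexed by
  this distance. Killing on the left as well only lowers the Laplacian, so this explicit function is
  a supersolution for \<open>klap\<close>.\<close>

definition green :: "nat \<Rightarrow> (nat \<Rightarrow> real) \<Rightarrow> nat \<Rightarrow> real" where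
  "green N s k = (\<Sum>j\<in>{1..N}. real (min (N + 1 - k) j) * s j) / (real N)\<^sup>2"

lemma klap_green_le:
  assumes "\<And>j. 0 \<le> s j" "k \<in> {1..N}"
  shows "klap N (green N s) k \<le> - s (N + 1 - k)"
proof -
  define g where "g = (\<lambda>m. \<Sum>j\<in>{1..N}. real (min m j) * s j)"
  define m where "m = N + 1 - k"
  have m: "1 \<le> m" "m \<le> N" using assms(2) by (auto simp: m_def)
  have N: "N > 0" using assms(2) by auto
  have g_nonneg: "0 \<le> g i" for i unfolding g_def by (intro sum_nonneg) (auto simp: assms)
  have "g (m + 1) + g (m - 1) - 2 * g m = (\<Sum>j\<in>{1..N}. if j = m then - s j else 0)"
    unfolding g_def sum_distrib_left sum.distrib[symmetric] sum_subtractf[symmetric]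
    using m by (intro sum.cong) (auto simp: min_def of_nat_diff algebra_simps)
  also have "\<dots> = - s m" using m by simp
  finally have lap: "g (m + 1) + g (m - 1) - 2 * g m = - s m" .
  have gr: "(real N)\<^sup>2 * green N s i = g (N + 1 - i)" for i
    using N by (simp add: green_def g_def)
  have "(real N)\<^sup>2 * zext N (green N s) (k + 1) = g (m - 1)"
    using m gr[of "k + 1"] by (auto simp: zext_def m_def g_def)
  moreover have "(real N)\<^sup>2 * zext N (green N s) (k - 1) \<le> g (m + 1)"
  proof (cases "k = 1")
    case False
    then have "N + 1 - (k - 1) = m + 1" using assms(2) by (auto simp: m_def)
    then show ?thesis using gr[of "k - 1"] False assms(2) by (auto simp: zext_def)
  qed (auto simp: zext_def g_nonneg)
  moreover have "(real N)\<^sup>2 * green N s k = g m" using gr[of k] by (simp add: m_def)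
  ultimately show ?thesis using lap unfolding klap_def m_def[symmetric] right_diff_distrib distrib_left
    by (simp add: algebra_simps)
qed

lemma green_nonneg: "(\<And>j. 0 \<le> s j) \<Longrightarrow> 0 \<le> green N s k"
  unfolding green_def by (intro divide_nonneg_nonneg sum_nonneg) auto

lemma green_le:
  assumes "\<And>j. 0 \<le> s j"
  shows "green N s k \<le> real (N + 1 - k) * (\<Sum>j\<in>{1..N}. s j) / (real N)\<^sup>2"
  unfolding green_def sum_distrib_left
  by (intro divide_right_mono sum_mono mult_right_mono) (auto simp: assms)

definition alive :: "nat \<Rightarrow> real \<Rightarrow> nat \<Rightarrow> real" where
  "alive N t = sgp (klap N) t (\<lambda>_. 1)"

definition survivors :: "nat \<Rightarrow> real \<Rightarrow> real" where
  "survivors N t = (\<Sum>k\<in>{1..N}. alive N t k)"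

lemma alive_bounds: "k \<in> {1..N} \<Longrightarrow> 0 \<le> t \<Longrightarrow> 0 \<le> alive N t k \<and> alive N t k \<le> 1"
  unfolding alive_def using K.sgp_one_le K.sgp_nonneg[of N "\<lambda>_. 1"] by simp

lemma alive_DERIV: "k \<in> {1..N} \<Longrightarrow> ((\<lambda>t. alive N t k) has_real_derivative klap N (alive N t) k) (at t)"
  unfolding alive_def using K.sgp_DERIV[of N "\<lambda>_. 1" k t] by (simp add: K.L_sgp)

lemma survivors_DERIV: "\<exists>D. (survivors N has_real_derivative D) (at t)"
proof -
  have "((\<lambda>t. \<Sum>k\<in>{1..N}. alive N t k) has_real_derivative (\<Sum>k\<in>{1..N}. klap N (alive N t) k)) (at t)"
    by (intro DERIV_sum alive_DERIV)
  then show ?thesis unfolding survivors_def[abs_def] by blast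
qed

text \<open>The weight \<open>v = 1 + u\<close> with \<open>u = green N 1\<close> in
  \<open>[0, 1]\<close> satisfies \<open>klap N v \<le> - 1 \<le> - v / 2\<close>. Hence the
  \<open>v\<close>-weighted survivors decay at rate 1/2, and \<open>1 \<le> v \<le> 2\<close> costs
  the factor 2.\<close>

lemma survivors_decay:
  assumes "1 \<le> N" "0 \<le> s" "0 \<le> r"
  shows "survivors N (s + r) \<le> 2 * exp (- r / 2) * survivors N s"
proof -
  define u where "u = green N (\<lambda>_. 1)"
  define v where "v = (\<lambda>k. 1 + u k)"
  have u: "0 \<le> u k" "u k \<le> 1" if "k \<in> {1..N}" for k
  proof -
    show "0 \<le> u k" by (simp add: u_def green_nonneg)
    have "u k \<le> real (N + 1 - k) * real N / (real N)\<^sup>2"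
      unfolding u_def using green_le[of "\<lambda>_. 1" N k] by simp
    also have "\<dots> \<le> real N * real N / (real N)\<^sup>2"
      using that by (intro divide_right_mono mult_right_mono) auto
    finally show "u k \<le> 1" using assms by (simp add: power2_eq_square)
  qed
  have lap: "klap N v k \<le> - v k / 2" if "k \<in> {1..N}" for k
  proof -
    have "klap N v k = klap N (\<lambda>_. 1) k + klap N u k" unfolding v_def by (rule K.L_add[OF that])
    moreover have "klap N (\<lambda>_. 1) k \<le> 0" by (rule K.L_one[OF that])
    moreover have "klap N u k \<le> -1" unfolding u_def using klap_green_le[of "\<lambda>_. 1" k N] that by simp
    ultimately show ?thesis using u[OF that] by (simp add: v_def)
  qed
  define Y where "Y = (\<lambda>t. \<Sum>k\<in>{1..N}. v k * alive N t k)"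
  have Y_DERIV: "(Y has_real_derivative (\<Sum>k\<in>{1..N}. klap N v k * alive N t k)) (at t)" for t
    unfolding Y_def klap_symmetric[symmetric] by (intro DERIV_sum DERIV_cmult alive_DERIV)
  have "exp ((s + r) / 2) * Y (s + r) \<le> exp (s / 2) * Y s"
  proof (rule DERIV_nonpos_imp_nonincreasing[where f = "\<lambda>t. exp (t / 2) * Y t"])
    fix t assume t: "s \<le> t" "t \<le> s + r"
    have "((\<lambda>t. exp (t / 2) * Y t) has_real_derivative
        exp (t / 2) * (1 / 2) * Y t + (\<Sum>k\<in>{1..N}. klap N v k * alive N t k) * exp (t / 2)) (at t)"
      by (rule DERIV_mult[OF _ Y_DERIV]) (auto intro!: derivative_eq_intros)
    moreover have "(\<Sum>k\<in>{1..N}. klap N v k * alive N t k) \<le> (\<Sum>k\<in>{1..N}. (- v k / 2) * alive N t k)"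
      using t assms by (intro sum_mono mult_right_mono lap) (auto simp: alive_bounds)
    then have "(\<Sum>k\<in>{1..N}. klap N v k * alive N t k) \<le> - Y t / 2"
      by (simp add: Y_def sum_negf sum_divide_distrib)
    then have "(\<Sum>k\<in>{1..N}. klap N v k * alive N t k) * exp (t / 2) \<le> (- Y t / 2) * exp (t / 2)"
      by (intro mult_right_mono) auto
    ultimately show "\<exists>y. ((\<lambda>t. exp (t / 2) * Y t) has_real_derivative y) (at t) \<and> y \<le> 0"
      by (intro exI conjI) (assumption, simp add: algebra_simps)
  qed (use assms in auto)
  moreover have "survivors N (s + r) \<le> Y (s + r)"
    unfolding survivors_def Y_def using u alive_bounds[of _ N "s + r"] assms
    by (intro sum_mono) (auto simp: v_def mult_right_mono algebra_simps)
  moreover have "Y s \<le> 2 * survivors N s"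
    unfolding survivors_def Y_def sum_distrib_left using u alive_bounds[of _ N s] assms
    by (intro sum_mono mult_right_mono) (auto simp: v_def)
  ultimately have "exp ((s + r) / 2) * survivors N (s + r) \<le> exp (s / 2) * (2 * survivors N s)"
    by (meson exp_ge_zero mult_left_mono order_trans)
  then have "exp (s / 2) * (exp (r / 2) * survivors N (s + r)) \<le> exp (s / 2) * (2 * survivors N s)"
    by (simp add: add_divide_distrib exp_add mult_ac)
  then have "exp (r / 2) * survivors N (s + r) \<le> 2 * survivors N s" by simp
  then show ?thesis by (simp add: exp_minus field_simps)
qed

lemma alive_reflect:
  assumes "k \<in> {1..N}"
  shows "alive N t (N + 1 - k) = alive N t k"
proof -
  have "sgp (klap N) t (\<lambda>k. 1) k = sgp (klap N) t (\<lambda>_. 1) (N + 1 - k)"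
  proof (rule sgp_intertwine[OF klap_subgen klap_subgen, where \<Phi> = "\<lambda>F k. F (N + 1 - k)"])
    fix Fn :: "nat \<Rightarrow> nat \<Rightarrow> real" and F z
    assume *: "\<And>x. x \<in> {1..N} \<Longrightarrow> (\<lambda>n. Fn n x) \<longlonglongrightarrow> F x" "z \<in> {1..N}"
    show "(\<lambda>n. Fn n (N + 1 - z)) \<longlonglongrightarrow> F (N + 1 - z)" by (rule *(1)) (use *(2) in auto)
  next
    fix F :: "nat \<Rightarrow> real" and z assume z: "z \<in> {1..N}"
    have e: "N + 1 - (z + 1) = N + 1 - z - 1" by simp
    have "zext N (\<lambda>k. F (N + 1 - k)) (z + 1) = zext N F (N + 1 - z - 1)"
      using z by (auto simp: zext_def)
    moreover have "zext N (\<lambda>k. F (N + 1 - k)) (z - 1) = zext N F (N + 1 - z + 1)"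
    proof (cases "z = 1")
      case False
      then have "N + 1 - (z - 1) = N + 1 - z + 1" using z by auto
      then show ?thesis using z False by (auto simp: zext_def)
    qed (auto simp: zext_def)
    ultimately show "klap N (\<lambda>k. F (N + 1 - k)) z = klap N F (N + 1 - z)" by (simp add: klap_def)
  qed (use assms in auto)
  then show ?thesis by (simp add: alive_def)
qed

text \<open>Reflection exchanges \<open>k / (N + 1)\<close> and \<open>1 - k / (N + 1)\<close>. The
  lower bound uses this to see a fixed fraction of the survivors although the density may be close
  to 1 near the left end.\<close>

lemma alive_sum_linear:
  "(\<Sum>k\<in>{1..N}. alive N t k * (real k / real (N + 1))) = survivors N t / 2"
proof -
  let ?x = "\<lambda>k. real k / real (N + 1)"
  have "(\<Sum>k\<in>{1..N}. alive N t k * ?x k) = (\<Sum>k\<in>{1..N}. alive N t (N + 1 - k) * ?x (N + 1 - k))"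
    by (rule sum.reindex_bij_witness[of _ "\<lambda>k. N + 1 - k" "\<lambda>k. N + 1 - k"]) auto
  also have "\<dots> = (\<Sum>k\<in>{1..N}. alive N t k - alive N t k * ?x k)"
  proof (intro sum.cong refl)
    fix k assume k: "k \<in> {1..N}"
    have "?x (N + 1 - k) = 1 - ?x k" using k by (simp add: of_nat_diff field_simps)
    then show "alive N t (N + 1 - k) * ?x (N + 1 - k) = alive N t k - alive N t k * ?x k"
      by (simp only: alive_reflect[OF k] right_diff_distrib mult_1_right)
  qed
  finally show ?thesis by (simp add: sum_subtractf survivors_def)
qed

subsection \<open>Linear statistics of the exclusion process\<close>

lemma ssep_subgen:
  assumes "p \<in> {0..1}" "q \<in> {0..1}"
  shows "subgen (configs N) (ssep_gen N p q) (ssep_rate N)"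
proof
  fix a F G z
  show "ssep_gen N p q (\<lambda>x. a * F x + G x) z = a * ssep_gen N p q F z + ssep_gen N p q G z"
    using ssep_gen_sum[of N p q "\<lambda>b. if b then a else 1" "\<lambda>b. if b then F else G" "UNIV :: bool set" z]
    by (simp add: UNIV_bool add.commute)
next
  fix F :: "(nat \<Rightarrow> nat) \<Rightarrow> real" and z
  assume "\<And>x. x \<in> configs N \<Longrightarrow> 0 \<le> F x" "z \<in> configs N"
  then have "ssep_pos N p q (\<lambda>_. 0) z \<le> ssep_pos N p q F z" by (intro ssep_pos_mono assms) auto
  then show "0 \<le> ssep_gen N p q F z + ssep_rate N * F z" by (simp add: ssep_gen_eq ssep_pos_const)
next
  fix z show "ssep_gen N p q (\<lambda>_. 1) z \<le> 0" by (simp add: ssep_gen_eq ssep_pos_const)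
next
  fix Fn :: "nat \<Rightarrow> (nat \<Rightarrow> nat) \<Rightarrow> real" and F z
  assume F: "\<And>x. x \<in> configs N \<Longrightarrow> (\<lambda>n. Fn n x) \<longlonglongrightarrow> F x" and z: "z \<in> configs N"
  show "(\<lambda>n. ssep_gen N p q (Fn n) z) \<longlonglongrightarrow> ssep_gen N p q F z"
  proof (cases "N = 0")
    case False
    then show ?thesis unfolding ssep_gen_def using configs_upd[OF z] configs_swap[OF z] z
      by (intro tendsto_intros F) auto
  qed (simp add: ssep_gen_def)
qed (rule ssep_rate_nonneg)

lemma ssep_semigroup_sgp: "ssep_semigroup N p q t = sgp (ssep_gen N p q) t"
  by (auto simp: fun_eq_iff ssep_semigroup_def sgp_def)

lemma configs_01: "\<eta> \<in> configs N \<Longrightarrow> k \<in> {1..N} \<Longrightarrow> \<eta> k = 0 \<or> \<eta> k = 1"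
  by (auto simp: configs_def PiE_iff)

lemma sum_fun_upd:
  fixes g :: "'a \<Rightarrow> 'b \<Rightarrow> real"
  assumes "finite A" "j \<in> A"
  shows "(\<Sum>k\<in>A. g k ((f(j := v)) k)) = (\<Sum>k\<in>A. g k (f k)) + g j v - g j (f j)"
  using assms by (subst (1 2) sum.remove[of A j]) (auto intro: sum.cong)

lemma sum_fun_swap:
  fixes g :: "nat \<Rightarrow> 'b \<Rightarrow> real"
  assumes "i \<in> {1..<N}"
  shows "(\<Sum>k\<in>{1..N}. g k ((f(i := f (i + 1), i + 1 := f i)) k)) =
    (\<Sum>k\<in>{1..N}. g k (f k)) + g i (f (i + 1)) - g i (f i) + g (i + 1) (f i) - g (i + 1) (f (i + 1))"
  using assms by (subst sum_fun_upd, simp, simp, subst sum_fun_upd) auto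

text \<open>Each jump changes \<open>A\<close> by an explicit increment, so the square changes by
  \<open>2 A\<close> times the increment plus its square; the last bracket is the carre du
  champ.\<close>

lemma ssep_gen_sum_squares:
  fixes d :: "nat \<Rightarrow> real" and a :: real
  assumes "1 \<le> N" "\<eta> \<in> configs N"
  defines "S \<equiv> \<lambda>d (\<xi> :: nat \<Rightarrow> nat). \<Sum>k\<in>{1..N}. d k * real (\<xi> k)"
  defines "A \<equiv> \<lambda>\<xi>. S d \<xi> + a"
  shows "ssep_gen N p q A \<eta> = (real N)\<^sup>2 *
      ((\<Sum>i\<in>{1..<N}. (d (i + 1) - d i) * (real (\<eta> i) - real (\<eta> (i + 1))))
        + d 1 * (p - real (\<eta> 1)) + d N * (q - real (\<eta> N)))"
    and "ssep_gen N p q (\<lambda>\<xi>. (A \<xi>)\<^sup>2) \<eta> = 2 * A \<eta> * ssep_gen N p q A \<eta> + (real N)\<^sup>2 *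
      ((\<Sum>i\<in>{1..<N}. ((d (i + 1) - d i) * (real (\<eta> i) - real (\<eta> (i + 1))))\<^sup>2)
        + (d 1)\<^sup>2 * (p * (1 - real (\<eta> 1))\<^sup>2 + (1 - p) * (real (\<eta> 1))\<^sup>2)
        + (d N)\<^sup>2 * (q * (1 - real (\<eta> N))\<^sup>2 + (1 - q) * (real (\<eta> N))\<^sup>2))"
proof -
  have upd: "A (\<eta>(j := v)) = A \<eta> + d j * (real v - real (\<eta> j))" if "j \<in> {1..N}" for j v
    unfolding A_def S_def using sum_fun_upd[of "{1..N}" j "\<lambda>k x. d k * real x" \<eta> v] that
    by (simp add: algebra_simps)
  have swap: "A (\<eta>(i := \<eta> (i + 1), i + 1 := \<eta> i)) =
      A \<eta> + (d (i + 1) - d i) * (real (\<eta> i) - real (\<eta> (i + 1)))" if "i \<in> {1..<N}" for i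
    unfolding A_def S_def using sum_fun_swap[OF that, of "\<lambda>k x. d k * real x" \<eta>]
    by (simp add: algebra_simps)
  have mem: "1 \<in> {1..N}" "N \<in> {1..N}" using assms(1) by auto
  show 1: "ssep_gen N p q A \<eta> = (real N)\<^sup>2 *
      ((\<Sum>i\<in>{1..<N}. (d (i + 1) - d i) * (real (\<eta> i) - real (\<eta> (i + 1))))
        + d 1 * (p - real (\<eta> 1)) + d N * (q - real (\<eta> N)))"
    unfolding ssep_gen_def upd[OF mem(1)] upd[OF mem(2)] sum_distrib_left distrib_left
    by (intro arg_cong2[of _ _ _ _ "(+)"] sum.cong) (auto simp: swap[simplified] algebra_simps)
  show "ssep_gen N p q (\<lambda>\<xi>. (A \<xi>)\<^sup>2) \<eta> = 2 * A \<eta> * ssep_gen N p q A \<eta> + (real N)\<^sup>2 *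
      ((\<Sum>i\<in>{1..<N}. ((d (i + 1) - d i) * (real (\<eta> i) - real (\<eta> (i + 1))))\<^sup>2)
        + (d 1)\<^sup>2 * (p * (1 - real (\<eta> 1))\<^sup>2 + (1 - p) * (real (\<eta> 1))\<^sup>2)
        + (d N)\<^sup>2 * (q * (1 - real (\<eta> N))\<^sup>2 + (1 - q) * (real (\<eta> N))\<^sup>2))"
  proof -
    have sw: "(\<Sum>i\<in>{1..<N}. (real N)\<^sup>2 * ((A (\<eta>(i := \<eta> (i + 1), i + 1 := \<eta> i)))\<^sup>2 - (A \<eta>)\<^sup>2)) =
      (real N)\<^sup>2 * (2 * A \<eta> * (\<Sum>i\<in>{1..<N}. (d (i + 1) - d i) * (real (\<eta> i) - real (\<eta> (i + 1))))
        + (\<Sum>i\<in>{1..<N}. ((d (i + 1) - d i) * (real (\<eta> i) - real (\<eta> (i + 1))))\<^sup>2))"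
      unfolding sum_distrib_left sum.distrib[symmetric]
      by (intro sum.cong) (auto simp: swap[simplified] power2_eq_square algebra_simps)
    show ?thesis unfolding 1 unfolding ssep_gen_def upd[OF mem(1)] upd[OF mem(2)] sw
      by (simp add: power2_eq_square algebra_simps)
  qed
qed

text \<open>The stationary density, harmonic with the values \<open>p\<close> and \<open>q\<close>
  at the virtual sites 0 and \<open>N + 1\<close>. Centring by it turns the reservoirs into pure
  killing.\<close>

definition profile :: "nat \<Rightarrow> real \<Rightarrow> real \<Rightarrow> nat \<Rightarrow> real" where
  "profile N p q k = p + (q - p) * real k / real (N + 1)"

text \<open>One-particle duality. Summation by parts on both sides leaves only the constant slope
  \<open>D\<close> of the profile, which telescopes over the edges and is absorbed by the boundary
  terms.\<close>

lemma ssep_gen_centered: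
  assumes N: "1 \<le> N" and \<eta>: "\<eta> \<in> configs N"
  shows "ssep_gen N p q (\<lambda>\<xi>. \<Sum>k\<in>{1..N}. c k * (real (\<xi> k) - profile N p q k)) \<eta> =
    (\<Sum>k\<in>{1..N}. klap N c k * (real (\<eta> k) - profile N p q k))"
proof -
  let ?\<rho> = "profile N p q"
  define D where "D = (q - p) / real (N + 1)"
  have D: "?\<rho> (i + 1) = ?\<rho> i + D" for i
    by (simp add: profile_def D_def add_divide_distrib distrib_left)
  let ?a = "- (\<Sum>k\<in>{1..N}. c k * ?\<rho> k)"
  define X where "X = (\<Sum>i\<in>{1..<N}. (c (i + 1) - c i) * ((real (\<eta> i) - ?\<rho> i) - (real (\<eta> (i + 1)) - ?\<rho> (i + 1))))"
  define Y where "Y = (\<Sum>i\<in>{1..<N}. (c (i + 1) - c i) * (real (\<eta> i) - real (\<eta> (i + 1))))"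
  have "(\<lambda>\<xi>. \<Sum>k\<in>{1..N}. c k * (real (\<xi> k) - ?\<rho> k)) = (\<lambda>\<xi>. (\<Sum>k\<in>{1..N}. c k * real (\<xi> k)) + ?a)"
    by (simp add: algebra_simps sum_subtractf)
  then have e1: "ssep_gen N p q (\<lambda>\<xi>. \<Sum>k\<in>{1..N}. c k * (real (\<xi> k) - ?\<rho> k)) \<eta> =
      (real N)\<^sup>2 * (Y + c 1 * (p - real (\<eta> 1)) + c N * (q - real (\<eta> N)))"
    using ssep_gen_sum_squares(1)[OF N \<eta>, of p q c ?a] by (simp add: Y_def)
  have "(\<Sum>k\<in>{1..N}. klap N c k * (real (\<eta> k) - ?\<rho> k)) =
      (\<Sum>k\<in>{1..N}. (real (\<eta> k) - ?\<rho> k) * klap N c k)" by (simp add: mult.commute)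
  also have "\<dots> = (real N)\<^sup>2 * (X - (real (\<eta> 1) - ?\<rho> 1) * c 1 - (real (\<eta> N) - ?\<rho> N) * c N)"
    unfolding X_def by (rule klap_sum_edges[OF N])
  finally have e2: "(\<Sum>k\<in>{1..N}. klap N c k * (real (\<eta> k) - ?\<rho> k)) =
      (real N)\<^sup>2 * (X - (real (\<eta> 1) - ?\<rho> 1) * c 1 - (real (\<eta> N) - ?\<rho> N) * c N)" .
  have "Y = X + (\<Sum>i\<in>{1..<N}. (c (i + 1) - c i) * (- D))"
    unfolding X_def Y_def sum.distrib[symmetric]
    by (intro sum.cong refl, subst D) (simp add: algebra_simps)
  also have "(\<Sum>i\<in>{1..<N}. (c (i + 1) - c i) * (- D)) = (c N - c 1) * (- D)"
    using sum_Suc_diff'[of 1 N c] N by (simp only: sum_distrib_right[symmetric]) simp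
  finally have e3: "Y = X + (c N - c 1) * (- D)" .
  have e4: "?\<rho> 1 = p + D" "?\<rho> N = q - D"
    by (simp_all add: profile_def D_def field_simps)
  show ?thesis unfolding e1 e2 e3 e4 by (simp add: algebra_simps)
qed

lemma ssep_semigroup_weight:
  assumes N: "1 \<le> N" and pq: "p \<in> {0..1}" "q \<in> {0..1}" and \<eta>: "\<eta> \<in> configs N"
  shows "ssep_semigroup N p q t (weight N) \<eta> =
    (\<Sum>k\<in>{1..N}. profile N p q k) + (\<Sum>k\<in>{1..N}. alive N t k * (real (\<eta> k) - profile N p q k))"
proof -
  interpret S: subgen "configs N" "ssep_gen N p q" "ssep_rate N" by (rule ssep_subgen[OF pq])
  let ?\<Phi> = "\<lambda>c \<xi>. \<Sum>k\<in>{1..N}. c k * (real (\<xi> k) - profile N p q k)"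
  have "sgp (ssep_gen N p q) t (?\<Phi> (\<lambda>_. 1)) \<eta> = ?\<Phi> (sgp (klap N) t (\<lambda>_. 1)) \<eta>"
  proof (rule sgp_intertwine[OF ssep_subgen[OF pq] klap_subgen, where \<Phi> = ?\<Phi>])
    fix a :: real and F G and z :: "nat \<Rightarrow> nat"
    show "?\<Phi> (\<lambda>x. a * F x + G x) z = a * ?\<Phi> F z + ?\<Phi> G z"
      unfolding sum_distrib_left sum.distrib[symmetric]
      by (intro sum.cong refl) (simp add: algebra_simps)
  next
    fix Fn :: "nat \<Rightarrow> nat \<Rightarrow> real" and F and z :: "nat \<Rightarrow> nat"
    assume "\<And>x. x \<in> {1..N} \<Longrightarrow> (\<lambda>n. Fn n x) \<longlonglongrightarrow> F x"
    then show "(\<lambda>n. ?\<Phi> (Fn n) z) \<longlonglongrightarrow> ?\<Phi> F z" by (intro tendsto_intros)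
  qed (use ssep_gen_centered[OF N] \<eta> in auto)
  moreover have "weight N = (\<lambda>\<xi>. ?\<Phi> (\<lambda>_. 1) \<xi> + (\<Sum>k\<in>{1..N}. profile N p q k) * 1)"
    by (simp add: weight_def sum_subtractf fun_eq_iff)
  ultimately show ?thesis
    by (simp only: ssep_semigroup_sgp S.sgp_add S.sgp_cmult bounded_fn_finite[OF finite_configs] \<eta>
        alive_def) (simp add: ssep_semigroup_sgp[symmetric] ssep_semigroup_one)
qed

text \<open>Negative correlations. The function \<open>\<Psi>\<close> interpolates between the two sides, and its drift is
  nonpositive because \<open>(x - y)\<^sup>2 \<le> x + y\<close> for occupation numbers.\<close>

lemma ssep_weight_second_moment:
  assumes N: "1 \<le> N" and pq: "p \<in> {0..1}" "q \<in> {0..1}" and \<eta>: "\<eta> \<in> configs N" and t: "0 \<le> t"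
  shows "ssep_semigroup N p q t (\<lambda>\<xi>. (weight N \<xi>)\<^sup>2) \<eta> \<le>
    (ssep_semigroup N p q t (weight N) \<eta>)\<^sup>2 + ssep_semigroup N p q t (weight N) \<eta>"
proof -
  interpret S: subgen "configs N" "ssep_gen N p q" "ssep_rate N" by (rule ssep_subgen[OF pq])
  note bd = bounded_fn_finite[OF finite_configs]
  let ?\<rho> = "profile N p q"
  \<comment> \<open>Backward solution: \<open>A r \<xi>\<close> is the mean of the weight at time
    \<open>t\<close> given the state \<open>\<xi>\<close> at time \<open>r\<close>. At
    \<open>r = t\<close> all \<open>c\<close> equal 1 and \<open>\<Psi>\<close> is the squared
    weight minus the weight; at \<open>r = 0\<close> it is at most the squared mean.\<close>
  define c where "c = (\<lambda>r k. alive N (t - r) k)"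
  define a where "a = (\<lambda>r. (\<Sum>k\<in>{1..N}. ?\<rho> k) - (\<Sum>k\<in>{1..N}. c r k * ?\<rho> k))"
  define A where "A = (\<lambda>r \<xi>. (\<Sum>k\<in>{1..N}. c r k * real (\<xi> k)) + a r)"
  define B where "B = (\<lambda>r \<xi>. \<Sum>k\<in>{1..N}. (c r k)\<^sup>2 * real (\<xi> k))"
  define \<Psi> where "\<Psi> = (\<lambda>r \<xi>. (A r \<xi>)\<^sup>2 - B r \<xi>)"
  have A_alt: "A r = (\<lambda>\<xi>. (\<Sum>k\<in>{1..N}. c r k * (real (\<xi> k) - ?\<rho> k)) + (\<Sum>k\<in>{1..N}. ?\<rho> k))" for r
    by (auto simp: A_def a_def fun_eq_iff algebra_simps sum_subtractf)
  have cD: "((\<lambda>r. c r k) has_real_derivative - klap N (c r) k) (at r)" if "k \<in> {1..N}" for k r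
  proof -
    have "((\<lambda>r. t - r) has_real_derivative -1) (at r)" by (auto intro!: derivative_eq_intros)
    from DERIV_chain2[where f = "\<lambda>s. alive N s k" and g = "\<lambda>r. t - r", OF alive_DERIV[OF that] this]
    show ?thesis by (simp add: c_def)
  qed
  have LA: "ssep_gen N p q (A r) \<xi> = (\<Sum>k\<in>{1..N}. klap N (c r) k * (real (\<xi> k) - ?\<rho> k))"
    if "\<xi> \<in> configs N" for r \<xi>
  proof -
    have "ssep_gen N p q (\<lambda>_. (\<Sum>k\<in>{1..N}. ?\<rho> k)) \<xi> = 0"
      by (simp add: ssep_gen_eq ssep_pos_const)
    then show ?thesis unfolding A_alt using S.L_add[OF that] ssep_gen_centered[OF N that] by simp
  qed
  have AD: "((\<lambda>r. A r \<xi>) has_real_derivative - ssep_gen N p q (A r) \<xi>) (at r)"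
    if "\<xi> \<in> configs N" for r \<xi>
  proof -
    have "((\<lambda>r. A r \<xi>) has_real_derivative
        (\<Sum>k\<in>{1..N}. - klap N (c r) k * (real (\<xi> k) - ?\<rho> k)) + 0) (at r)"
      unfolding A_alt by (intro DERIV_add DERIV_sum DERIV_cmult_right cD DERIV_const)
    then show ?thesis by (simp add: LA[OF that] sum_negf)
  qed
  have BD: "((\<lambda>r. B r \<xi>) has_real_derivative
      (\<Sum>k\<in>{1..N}. - 2 * c r k * klap N (c r) k * real (\<xi> k))) (at r)" for r \<xi>
    unfolding B_def
    by (intro DERIV_sum DERIV_cmult_right) (auto intro!: derivative_eq_intros cD)
  have "sgp (ssep_gen N p q) t (\<Psi> t) \<eta> \<le> sgp (ssep_gen N p q) 0 (\<Psi> 0) \<eta>"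
  proof (rule S.sgp_time_antimono[OF finite_configs \<eta> order_refl t,
        where \<Psi>' = "\<lambda>r \<xi>. 2 * A r \<xi> * (- ssep_gen N p q (A r) \<xi>)
          - (\<Sum>k\<in>{1..N}. - 2 * c r k * klap N (c r) k * real (\<xi> k))"])
    fix \<xi> r assume \<xi>: "\<xi> \<in> configs N" and r: "0 \<le> r" "r \<le> t"
    show "((\<lambda>r. \<Psi> r \<xi>) has_real_derivative 2 * A r \<xi> * (- ssep_gen N p q (A r) \<xi>)
          - (\<Sum>k\<in>{1..N}. - 2 * c r k * klap N (c r) k * real (\<xi> k))) (at r)"
      unfolding \<Psi>_def by (rule DERIV_diff[OF _ BD]) (auto intro!: derivative_eq_intros AD[OF \<xi>])
    let ?x = "\<lambda>k. real (\<xi> k)"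
    have x: "?x k = 0 \<or> ?x k = 1" if "k \<in> {1..N}" for k using configs_01[OF \<xi> that] by auto
    have LB: "ssep_gen N p q (B r) \<xi> = (real N)\<^sup>2 *
      ((\<Sum>i\<in>{1..<N}. ((c r (i + 1))\<^sup>2 - (c r i)\<^sup>2) * (?x i - ?x (i + 1)))
        + (c r 1)\<^sup>2 * (p - ?x 1) + (c r N)\<^sup>2 * (q - ?x N))"
      unfolding B_def using ssep_gen_sum_squares(1)[OF N \<xi>, of p q "\<lambda>k. (c r k)\<^sup>2" 0] by simp
    have W: "(\<Sum>k\<in>{1..N}. (c r k * ?x k) * klap N (c r) k) = (real N)\<^sup>2 *
        ((\<Sum>i\<in>{1..<N}. (c r (i + 1) - c r i) * (c r i * ?x i - c r (i + 1) * ?x (i + 1)))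
        - (c r 1 * ?x 1) * c r 1 - (c r N * ?x N) * c r N)"
      by (rule klap_sum_edges[OF N])
    have "ssep_gen N p q (\<Psi> r) \<xi> + (2 * A r \<xi> * (- ssep_gen N p q (A r) \<xi>)
          - (\<Sum>k\<in>{1..N}. - 2 * c r k * klap N (c r) k * ?x k)) =
        (ssep_gen N p q (\<lambda>\<xi>. (A r \<xi>)\<^sup>2) \<xi> - 2 * A r \<xi> * ssep_gen N p q (A r) \<xi>)
        - ssep_gen N p q (B r) \<xi> + 2 * (\<Sum>k\<in>{1..N}. (c r k * ?x k) * klap N (c r) k)"
      unfolding \<Psi>_def S.L_diff[OF \<xi>] by (simp add: sum_negf sum_distrib_left mult_ac)
    also have "\<dots> = (real N)\<^sup>2 * ((\<Sum>i\<in>{1..<N}. ((c r (i + 1) - c r i) * (?x i - ?x (i + 1)))\<^sup>2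
          - ((c r (i + 1))\<^sup>2 - (c r i)\<^sup>2) * (?x i - ?x (i + 1))
          + 2 * ((c r (i + 1) - c r i) * (c r i * ?x i - c r (i + 1) * ?x (i + 1))))
        + (c r 1)\<^sup>2 * (p * (1 - ?x 1)\<^sup>2 + (1 - p) * (?x 1)\<^sup>2 - (p - ?x 1) - 2 * ?x 1)
        + (c r N)\<^sup>2 * (q * (1 - ?x N)\<^sup>2 + (1 - q) * (?x N)\<^sup>2 - (q - ?x N) - 2 * ?x N))"
      unfolding A_def ssep_gen_sum_squares(2)[OF N \<xi>] LB W sum.distrib sum_subtractf
        sum_distrib_left[symmetric] by (simp add: algebra_simps power2_eq_square)
    also have "\<dots> \<le> (real N)\<^sup>2 * (0 + 0 + 0)"
    proof (intro mult_left_mono add_mono sum_nonpos mult_nonneg_nonpos)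
      fix i assume i: "i \<in> {1..<N}"
      have "((c r (i + 1) - c r i) * (?x i - ?x (i + 1)))\<^sup>2
          - ((c r (i + 1))\<^sup>2 - (c r i)\<^sup>2) * (?x i - ?x (i + 1))
          + 2 * ((c r (i + 1) - c r i) * (c r i * ?x i - c r (i + 1) * ?x (i + 1))) =
          (c r (i + 1) - c r i)\<^sup>2 * ((?x i - ?x (i + 1))\<^sup>2 - ?x i - ?x (i + 1))"
        by (simp add: power2_eq_square algebra_simps)
      also have "\<dots> \<le> 0" using x[of i] x[of "i + 1"] i by (intro mult_nonneg_nonpos) auto
      finally show "((c r (i + 1) - c r i) * (?x i - ?x (i + 1)))\<^sup>2
          - ((c r (i + 1))\<^sup>2 - (c r i)\<^sup>2) * (?x i - ?x (i + 1))
          + 2 * ((c r (i + 1) - c r i) * (c r i * ?x i - c r (i + 1) * ?x (i + 1))) \<le> 0" .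
    qed (use x[of 1] x[of N] N pq in auto)
    finally show "ssep_gen N p q (\<Psi> r) \<xi> + (2 * A r \<xi> * (- ssep_gen N p q (A r) \<xi>)
          - (\<Sum>k\<in>{1..N}. - 2 * c r k * klap N (c r) k * ?x k)) \<le> 0" by simp
  qed
  moreover have "sgp (ssep_gen N p q) 0 (\<Psi> 0) \<eta> \<le> (ssep_semigroup N p q t (weight N) \<eta>)\<^sup>2"
  proof -
    have "A 0 \<eta> = ssep_semigroup N p q t (weight N) \<eta>"
      by (simp add: ssep_semigroup_weight[OF N pq \<eta>] A_alt c_def)
    moreover have "0 \<le> B 0 \<eta>" unfolding B_def by (intro sum_nonneg) auto
    ultimately show ?thesis by (simp add: \<Psi>_def)
  qed
  moreover have "\<Psi> t = (\<lambda>\<xi>. (weight N \<xi>)\<^sup>2 - weight N \<xi>)"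
  proof -
    have [simp]: "alive N 0 k = 1" if "k \<in> {1..N}" for k using that by (simp add: alive_def)
    show ?thesis by (auto simp: \<Psi>_def A_alt B_def c_def weight_def fun_eq_iff sum_subtractf)
  qed
  ultimately show ?thesis
    by (simp add: ssep_semigroup_sgp S.sgp_diff[OF bd bd \<eta>])
qed

subsection \<open>Product measures\<close>

definition bern_wt :: "nat set \<Rightarrow> (nat \<Rightarrow> real) \<Rightarrow> (nat \<Rightarrow> nat) \<Rightarrow> real" where
  "bern_wt A \<rho> \<xi> = (\<Prod>k\<in>A. if \<xi> k = 1 then \<rho> k else 1 - \<rho> k)"

definition pext :: "nat \<Rightarrow> (nat \<Rightarrow> real) \<Rightarrow> ((nat \<Rightarrow> nat) \<Rightarrow> real) \<Rightarrow> real" where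
  "pext N \<rho> \<phi> = (\<Sum>\<xi>\<in>configs N. bern_wt {1..N} \<rho> \<xi> * \<phi> \<xi>)"

lemma pext_lin: "pext N \<rho> (\<lambda>\<xi>. a * \<phi> \<xi> + \<psi> \<xi>) = a * pext N \<rho> \<phi> + pext N \<rho> \<psi>"
  by (simp add: pext_def sum.distrib sum_distrib_left algebra_simps)

lemma pext_add: "pext N \<rho> (\<lambda>\<xi>. \<phi> \<xi> + \<psi> \<xi>) = pext N \<rho> \<phi> + pext N \<rho> \<psi>"
  using pext_lin[of N \<rho> 1 \<phi> \<psi>] by simp

lemma pext_cmult: "pext N \<rho> (\<lambda>\<xi>. a * \<phi> \<xi>) = a * pext N \<rho> \<phi>"
  by (simp add: pext_def sum_distrib_left mult_ac)

lemma pext_diff: "pext N \<rho> (\<lambda>\<xi>. \<phi> \<xi> - \<psi> \<xi>) = pext N \<rho> \<phi> - pext N \<rho> \<psi>"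
  using pext_lin[of N \<rho> "-1" \<psi> \<phi>] by simp

lemma pext_sum: "pext N \<rho> (\<lambda>\<xi>. \<Sum>i\<in>I. \<phi> i \<xi>) = (\<Sum>i\<in>I. pext N \<rho> (\<phi> i))"
  by (induction I rule: infinite_finite_induct) (simp_all add: pext_add, simp_all add: pext_def)

lemma pext_cong: "(\<And>\<xi>. \<xi> \<in> configs N \<Longrightarrow> \<phi> \<xi> = \<psi> \<xi>) \<Longrightarrow> pext N \<rho> \<phi> = pext N \<rho> \<psi>"
  by (simp add: pext_def)

lemma bern_wt_nonneg: "(\<And>k. k \<in> A \<Longrightarrow> \<rho> k \<in> {0..1}) \<Longrightarrow> 0 \<le> bern_wt A \<rho> \<xi>"
  unfolding bern_wt_def by (intro prod_nonneg) auto

lemma pext_mono: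
  assumes "\<And>k. k \<in> {1..N} \<Longrightarrow> \<rho> k \<in> {0..1}" "\<And>\<xi>. \<xi> \<in> configs N \<Longrightarrow> \<phi> \<xi> \<le> \<psi> \<xi>"
  shows "pext N \<rho> \<phi> \<le> pext N \<rho> \<psi>"
  unfolding pext_def by (intro sum_mono mult_left_mono bern_wt_nonneg assms)

lemma pext_one: "pext N \<rho> (\<lambda>_. 1) = 1"
proof -
  have "(\<Prod>k\<in>{1..N}. \<Sum>v\<in>{0, 1 :: nat}. if v = 1 then \<rho> k else 1 - \<rho> k) =
      (\<Sum>\<xi>\<in>configs N. \<Prod>k\<in>{1..N}. if \<xi> k = 1 then \<rho> k else 1 - \<rho> k)"
    unfolding configs_def by (rule prod_sum_PiE) auto
  then show ?thesis by (simp add: pext_def bern_wt_def)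
qed

text \<open>Pairing the configurations that differ at \<open>j\<close> only. All one-coordinate
  identities for \<open>pext\<close> are read off from this form, in which the outer weight does not
  involve \<open>\<rho> j\<close>.\<close>

lemma pext_split:
  assumes j: "j \<in> {1..N}"
  shows "pext N \<rho> \<phi> = (\<Sum>\<xi>\<in>{\<xi> \<in> configs N. \<xi> j = 0}. bern_wt ({1..N} - {j}) \<rho> \<xi> *
    ((1 - \<rho> j) * \<phi> \<xi> + \<rho> j * \<phi> (\<xi>(j := 1))))"
proof -
  let ?A = "\<lambda>v. {\<xi> \<in> configs N. \<xi> j = v}"
  have U: "configs N = ?A 0 \<union> ?A 1" using configs_01[OF _ j] by blast
  have wt: "bern_wt {1..N} \<rho> \<xi> = (if \<xi> j = 1 then \<rho> j else 1 - \<rho> j) * bern_wt ({1..N} - {j}) \<rho> \<xi>" for \<xi>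
    unfolding bern_wt_def by (subst prod.remove[of "{1..N}" j]) (use j in auto)
  have upd: "bern_wt ({1..N} - {j}) \<rho> (\<xi>(j := v)) = bern_wt ({1..N} - {j}) \<rho> \<xi>" for \<xi> v
    unfolding bern_wt_def by (intro prod.cong) auto
  have "(\<Sum>\<xi>\<in>?A 1. bern_wt {1..N} \<rho> \<xi> * \<phi> \<xi>) = (\<Sum>\<xi>\<in>?A 0. bern_wt {1..N} \<rho> (\<xi>(j := 1)) * \<phi> (\<xi>(j := 1)))"
  proof (rule sum.reindex_bij_witness[of _ "\<lambda>\<xi>. \<xi>(j := 1)" "\<lambda>\<xi>. \<xi>(j := 0)"])
    fix \<xi> assume "\<xi> \<in> ?A 1"
    then show "(\<xi>(j := 0))(j := 1) = \<xi>" "\<xi>(j := 0) \<in> ?A 0" using configs_upd[of \<xi> N j 0] j by auto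
  next
    fix \<xi> assume "\<xi> \<in> ?A 0"
    then show "(\<xi>(j := 1))(j := 0) = \<xi>" "\<xi>(j := 1) \<in> ?A 1" using configs_upd[of \<xi> N j 1] j by auto
  qed (auto simp: fun_upd_idem)
  moreover have "pext N \<rho> \<phi> = (\<Sum>\<xi>\<in>?A 0. bern_wt {1..N} \<rho> \<xi> * \<phi> \<xi>) + (\<Sum>\<xi>\<in>?A 1. bern_wt {1..N} \<rho> \<xi> * \<phi> \<xi>)"
    unfolding pext_def by (subst U, subst sum.union_disjoint) (use finite_configs in auto)
  ultimately have "pext N \<rho> \<phi> = (\<Sum>\<xi>\<in>?A 0. bern_wt {1..N} \<rho> \<xi> * \<phi> \<xi>
      + bern_wt {1..N} \<rho> (\<xi>(j := 1)) * \<phi> (\<xi>(j := 1)))" by (simp add: sum.distrib)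
  also have "\<dots> = (\<Sum>\<xi>\<in>?A 0. bern_wt ({1..N} - {j}) \<rho> \<xi> *
    ((1 - \<rho> j) * \<phi> \<xi> + \<rho> j * \<phi> (\<xi>(j := 1))))"
    unfolding wt upd by (intro sum.cong) (auto simp: algebra_simps)
  finally show ?thesis .
qed

lemma bern_wt_upd_remove: "bern_wt (A - {j}) (\<rho>(j := r)) \<xi> = bern_wt (A - {j}) \<rho> \<xi>"
  unfolding bern_wt_def by (intro prod.cong) auto

lemma pext_affine:
  assumes "j \<in> {1..N}"
  shows "pext N (\<rho>(j := r)) \<phi> = r * pext N (\<rho>(j := 1)) \<phi> + (1 - r) * pext N (\<rho>(j := 0)) \<phi>"
  unfolding pext_split[OF assms] bern_wt_upd_remove
  by (simp add: sum_distrib_left sum.distrib[symmetric] algebra_simps)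

lemma pext_set:
  assumes "j \<in> {1..N}" "v \<in> {0, 1}"
  shows "pext N \<rho> (\<lambda>\<xi>. \<phi> (\<xi>(j := v))) = pext N (\<rho>(j := real v)) \<phi>"
  unfolding pext_split[OF assms(1)] bern_wt_upd_remove
proof (rule sum.cong[OF refl])
  fix \<xi> assume "\<xi> \<in> {\<xi> \<in> configs N. \<xi> j = 0}"
  then have "\<xi>(j := 0) = \<xi>" by auto
  then show "bern_wt ({1..N} - {j}) \<rho> \<xi> *
          ((1 - \<rho> j) * \<phi> (\<xi>(j := v)) + \<rho> j * \<phi> (\<xi>(j := 1, j := v))) =
         bern_wt ({1..N} - {j}) \<rho> \<xi> *
          ((1 - (\<rho>(j := real v)) j) * \<phi> \<xi> + (\<rho>(j := real v)) j * \<phi> (\<xi>(j := 1)))"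
    using assms(2) by (auto simp: algebra_simps)
qed

definition swp :: "nat \<Rightarrow> (nat \<Rightarrow> 'a) \<Rightarrow> nat \<Rightarrow> 'a" where
  "swp i f = f(i := f (i + 1), i + 1 := f i)"

definition tr :: "nat \<Rightarrow> nat \<Rightarrow> nat" where
  "tr i = Transposition.transpose i (i + 1)"

lemma swp_eq: "swp i f = f \<circ> tr i"
  by (auto simp: swp_def tr_def fun_eq_iff Transposition.transpose_def)

lemma tr_tr [simp]: "tr i (tr i k) = k"
  by (simp add: tr_def)

lemma swp_tr [simp]: "swp i f (tr i k) = f k"
  by (simp add: swp_eq)

lemma swp_swp [simp]: "swp i (swp i f) = f"
  by (simp add: swp_eq fun_eq_iff)

lemma swp_configs: "\<xi> \<in> configs N \<Longrightarrow> i \<in> {1..<N} \<Longrightarrow> swp i \<xi> \<in> configs N"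
  unfolding swp_def by (rule configs_swap)

lemma bij_betw_tr: "i \<in> {1..<N} \<Longrightarrow> bij_betw (tr i) {1..N} {1..N}"
  by (rule bij_betw_byWitness[of _ "tr i"]) (auto simp: tr_def Transposition.transpose_def split: if_splits)

lemma sum_swp: "i \<in> {1..<N} \<Longrightarrow> (\<Sum>k\<in>{1..N}. g (tr i k)) = (\<Sum>k\<in>{1..N}. g k)"
  by (rule sum.reindex_bij_betw[OF bij_betw_tr])

lemma pext_swp:
  assumes i: "i \<in> {1..<N}"
  shows "pext N \<rho> (\<lambda>\<xi>. \<phi> (swp i \<xi>)) = pext N (swp i \<rho>) \<phi>"
  unfolding pext_def
proof (rule sum.reindex_bij_witness[of _ "swp i" "swp i"])
  fix \<xi> assume "\<xi> \<in> configs N"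
  have "(\<Prod>k\<in>{1..N}. (\<lambda>k. if swp i \<xi> k = 1 then swp i \<rho> k else 1 - swp i \<rho> k) (tr i k)) =
      (\<Prod>k\<in>{1..N}. if swp i \<xi> k = 1 then swp i \<rho> k else 1 - swp i \<rho> k)"
    by (rule prod.reindex_bij_betw[OF bij_betw_tr[OF i]])
  then have "bern_wt {1..N} (swp i \<rho>) (swp i \<xi>) = bern_wt {1..N} \<rho> \<xi>"
    by (simp add: bern_wt_def cong: if_cong)
  then show "bern_wt {1..N} (swp i \<rho>) (swp i \<xi>) * \<phi> (swp i \<xi>) = bern_wt {1..N} \<rho> \<xi> * \<phi> (swp i \<xi>)"
    by simp
qed (auto intro: swp_configs[OF _ i])

text \<open>The directional derivative of the multilinear extension \<open>\<rho> \<mapsto> pext N \<rho> \<phi>\<close>.\<close>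

definition pderiv_ext :: "nat \<Rightarrow> (nat \<Rightarrow> real) \<Rightarrow> (nat \<Rightarrow> real) \<Rightarrow> ((nat \<Rightarrow> nat) \<Rightarrow> real) \<Rightarrow> real" where
  "pderiv_ext N \<rho> \<nu> \<phi> = (\<Sum>y\<in>{1..N}. \<nu> y * (pext N (\<rho>(y := 1)) \<phi> - pext N (\<rho>(y := 0)) \<phi>))"

lemma pderiv_ext_lin: "pderiv_ext N \<rho> \<nu> (\<lambda>\<xi>. a * \<phi> \<xi> + \<psi> \<xi>) = a * pderiv_ext N \<rho> \<nu> \<phi> + pderiv_ext N \<rho> \<nu> \<psi>"
  unfolding pderiv_ext_def pext_lin sum_distrib_left sum.distrib[symmetric]
  by (intro sum.cong refl) (simp add: algebra_simps)

lemma pderiv_ext_add: "pderiv_ext N \<rho> \<nu> (\<lambda>\<xi>. \<phi> \<xi> + \<psi> \<xi>) = pderiv_ext N \<rho> \<nu> \<phi> + pderiv_ext N \<rho> \<nu> \<psi>"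
  using pderiv_ext_lin[of N \<rho> \<nu> 1 \<phi> \<psi>] by simp

lemma pderiv_ext_diff: "pderiv_ext N \<rho> \<nu> (\<lambda>\<xi>. \<phi> \<xi> - \<psi> \<xi>) = pderiv_ext N \<rho> \<nu> \<phi> - pderiv_ext N \<rho> \<nu> \<psi>"
  using pderiv_ext_lin[of N \<rho> \<nu> "-1" \<psi> \<phi>] by simp

lemma pderiv_ext_cmult: "pderiv_ext N \<rho> \<nu> (\<lambda>\<xi>. a * \<phi> \<xi>) = a * pderiv_ext N \<rho> \<nu> \<phi>"
  unfolding pderiv_ext_def pext_cmult sum_distrib_left
  by (intro sum.cong refl) (simp add: algebra_simps)

lemma pderiv_ext_sum: "pderiv_ext N \<rho> \<nu> (\<lambda>\<xi>. \<Sum>i\<in>I. \<phi> i \<xi>) = (\<Sum>i\<in>I. pderiv_ext N \<rho> \<nu> (\<phi> i))"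
proof (induction I rule: infinite_finite_induct)
  case (insert x F)
  then show ?case by (simp add: pderiv_ext_add)
qed (use pderiv_ext_cmult[of N \<rho> \<nu> 0] in simp_all)

lemma pderiv_ext_set:
  assumes "j \<in> {1..N}" "v \<in> {0, 1}"
  shows "pderiv_ext N \<rho> \<nu> (\<lambda>\<xi>. \<phi> (\<xi>(j := v))) = pderiv_ext N (\<rho>(j := real v)) (\<nu>(j := 0)) \<phi>"
  unfolding pderiv_ext_def pext_set[OF assms]
  by (intro sum.cong refl) (auto simp: fun_upd_twist)

lemma pderiv_ext_affine:
  assumes "j \<in> {1..N}" "\<nu> j = 0"
  shows "pderiv_ext N (\<rho>(j := r)) \<nu> \<phi> =
    r * pderiv_ext N (\<rho>(j := 1)) \<nu> \<phi> + (1 - r) * pderiv_ext N (\<rho>(j := 0)) \<nu> \<phi>"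
  unfolding pderiv_ext_def sum_distrib_left sum.distrib[symmetric]
proof (intro sum.cong refl)
  fix y assume "y \<in> {1..N}"
  show "\<nu> y * (pext N (\<rho>(j := r, y := 1)) \<phi> - pext N (\<rho>(j := r, y := 0)) \<phi>) =
      r * (\<nu> y * (pext N (\<rho>(j := 1, y := 1)) \<phi> - pext N (\<rho>(j := 1, y := 0)) \<phi>))
      + (1 - r) * (\<nu> y * (pext N (\<rho>(j := 0, y := 1)) \<phi> - pext N (\<rho>(j := 0, y := 0)) \<phi>))"
  proof (cases "y = j")
    case False
    have e: "pext N (\<rho>(j := r, y := v)) \<phi> =
        r * pext N (\<rho>(j := 1, y := v)) \<phi> + (1 - r) * pext N (\<rho>(j := 0, y := v)) \<phi>" for v
      using pext_affine[OF assms(1), of "\<rho>(y := v)" r \<phi>] False by (simp add: fun_upd_twist)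
    show ?thesis unfolding e by (simp add: algebra_simps)
  qed (use assms in auto)
qed

lemma pderiv_ext_swp:
  assumes "i \<in> {1..<N}"
  shows "pderiv_ext N \<rho> \<nu> (\<lambda>\<xi>. \<phi> (swp i \<xi>)) = pderiv_ext N (swp i \<rho>) (swp i \<nu>) \<phi>"
proof -
  let ?t = "tr i"
  have "pderiv_ext N (swp i \<rho>) (swp i \<nu>) \<phi> = (\<Sum>y\<in>{1..N}. swp i \<nu> (?t y) *
      (pext N ((swp i \<rho>)(?t y := 1)) \<phi> - pext N ((swp i \<rho>)(?t y := 0)) \<phi>))"
    unfolding pderiv_ext_def
    by (rule sum_swp[OF assms, where g = "\<lambda>y. swp i \<nu> y *
      (pext N ((swp i \<rho>)(y := 1)) \<phi> - pext N ((swp i \<rho>)(y := 0)) \<phi>)", symmetric])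
  moreover have "(swp i \<rho>)(?t y := v) = swp i (\<rho>(y := v))" for y v
    by (auto simp: swp_eq fun_eq_iff)
  ultimately show ?thesis unfolding pderiv_ext_def pext_swp[OF assms] by simp
qed

lemma pderiv_ext_lin_dir:
  "pderiv_ext N \<rho> (\<lambda>k. (\<nu> k + \<mu> k) / 2) \<phi> = (pderiv_ext N \<rho> \<nu> \<phi> + pderiv_ext N \<rho> \<mu> \<phi>) / 2"
  unfolding pderiv_ext_def sum_divide_distrib sum.distrib[symmetric]
  by (intro sum.cong refl) (simp add: algebra_simps add_divide_distrib)

text \<open>The score of a Bernoulli(\<open>p\<close>) variable is
  \<open>(\<xi> y - p) / (p * (1 - p))\<close>, so a derivative in a direction supported on sites of
  density \<open>p\<close> is a covariance with the linear statistic of that direction.\<close>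

lemma pderiv_ext_as_pext:
  assumes p: "0 < p" "p < 1" and \<nu>: "\<And>k. k \<in> {1..N} \<Longrightarrow> \<nu> k \<noteq> 0 \<Longrightarrow> \<rho> k = p"
  shows "pderiv_ext N \<rho> \<nu> \<phi> = pext N \<rho> (\<lambda>\<xi>. \<phi> \<xi> * (\<Sum>y\<in>{1..N}. \<nu> y * (real (\<xi> y) - p))) / (p * (1 - p))"
proof -
  have "\<nu> y * (pext N (\<rho>(y := 1)) \<phi> - pext N (\<rho>(y := 0)) \<phi>) =
      \<nu> y * pext N \<rho> (\<lambda>\<xi>. \<phi> \<xi> * (real (\<xi> y) - p)) / (p * (1 - p))" if y: "y \<in> {1..N}" for y
  proof (cases "\<nu> y = 0")
    case False
    have "pext N (\<rho>(y := 1)) \<phi> - pext N (\<rho>(y := 0)) \<phi> =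
        (\<Sum>\<xi>\<in>{\<xi> \<in> configs N. \<xi> y = 0}. bern_wt ({1..N} - {y}) \<rho> \<xi> * (\<phi> (\<xi>(y := 1)) - \<phi> \<xi>))"
      unfolding pext_split[OF y] bern_wt_upd_remove sum_subtractf[symmetric]
      by (intro sum.cong refl) (simp add: algebra_simps)
    moreover have "pext N \<rho> (\<lambda>\<xi>. \<phi> \<xi> * (real (\<xi> y) - p)) = (p * (1 - p)) *
        (\<Sum>\<xi>\<in>{\<xi> \<in> configs N. \<xi> y = 0}. bern_wt ({1..N} - {y}) \<rho> \<xi> * (\<phi> (\<xi>(y := 1)) - \<phi> \<xi>))"
      unfolding pext_split[OF y] sum_distrib_left \<nu>[OF y False]
      by (intro sum.cong refl) (auto simp: algebra_simps)
    ultimately show ?thesis using p by simp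
  qed simp
  then have "pderiv_ext N \<rho> \<nu> \<phi> = (\<Sum>y\<in>{1..N}. \<nu> y * pext N \<rho> (\<lambda>\<xi>. \<phi> \<xi> * (real (\<xi> y) - p)) / (p * (1 - p)))"
    unfolding pderiv_ext_def by (rule sum.cong[OF refl])
  then show ?thesis
    by (simp only: sum_divide_distrib[symmetric] pext_cmult[symmetric] pext_sum[symmetric]
        sum_distrib_left mult.left_commute)
qed

lemma pext_centered_square:
  assumes \<nu>: "\<And>k. k \<in> {1..N} \<Longrightarrow> \<nu> k \<noteq> 0 \<Longrightarrow> \<rho> k = p"
  shows "pext N \<rho> (\<lambda>\<xi>. (\<Sum>y\<in>{1..N}. \<nu> y * (real (\<xi> y) - p))\<^sup>2) = p * (1 - p) * (\<Sum>y\<in>{1..N}. (\<nu> y)\<^sup>2)"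
proof -
  have cov: "\<nu> y * \<nu> z * pext N \<rho> (\<lambda>\<xi>. (real (\<xi> y) - p) * (real (\<xi> z) - p)) =
      (if z = y then p * (1 - p) * (\<nu> y)\<^sup>2 else 0)" if y: "y \<in> {1..N}" for y z
  proof (cases "\<nu> y = 0")
    case False
    note r = \<nu>[OF y False]
    show ?thesis
    proof (cases "z = y")
      case True
      have "pext N \<rho> (\<lambda>\<xi>. (real (\<xi> y) - p) * (real (\<xi> y) - p)) = pext N \<rho> (\<lambda>\<xi>. (p * (1 - p)) * 1)"
        unfolding pext_split[OF y] r by (intro sum.cong refl) (auto simp: algebra_simps)
      then show ?thesis using True unfolding pext_cmult pext_one by (simp add: power2_eq_square)
    next
      case False
      have "pext N \<rho> (\<lambda>\<xi>. (real (\<xi> y) - p) * (real (\<xi> z) - p)) = 0"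
        unfolding pext_split[OF y] r using False
        by (intro sum.neutral ballI) (auto simp: algebra_simps)
      then show ?thesis using False by simp
    qed
  qed simp
  have "pext N \<rho> (\<lambda>\<xi>. (\<Sum>y\<in>{1..N}. \<nu> y * (real (\<xi> y) - p))\<^sup>2) =
      (\<Sum>y\<in>{1..N}. \<Sum>z\<in>{1..N}. \<nu> y * \<nu> z * pext N \<rho> (\<lambda>\<xi>. (real (\<xi> y) - p) * (real (\<xi> z) - p)))"
    unfolding power2_eq_square sum_product pext_sum pext_cmult[symmetric]
    by (intro sum.cong refl pext_cong) (simp add: mult_ac)
  also have "\<dots> = (\<Sum>y\<in>{1..N}. p * (1 - p) * (\<nu> y)\<^sup>2)"
    by (intro sum.cong refl) (simp add: cov)
  finally show ?thesis by (simp add: sum_distrib_left)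
qed

text \<open>Bessel's inequality for the orthonormal functions \<open>(\<xi> y - p) / sqrt (p (1 - p))\<close>.\<close>

lemma pderiv_ext_bessel:
  assumes p: "0 < p" "p < 1" and \<nu>: "\<And>k. k \<in> {1..N} \<Longrightarrow> \<nu> k \<noteq> 0 \<Longrightarrow> \<rho> k = p"
    and \<rho>: "\<And>k. k \<in> {1..N} \<Longrightarrow> \<rho> k \<in> {0..1}" and \<phi>: "\<And>\<xi>. \<xi> \<in> configs N \<Longrightarrow> \<bar>\<phi> \<xi>\<bar> \<le> 1"
  shows "(pderiv_ext N \<rho> \<nu> \<phi>)\<^sup>2 \<le> (\<Sum>y\<in>{1..N}. (\<nu> y)\<^sup>2) / (p * (1 - p))"
proof -
  define X where "X = (\<lambda>\<xi> :: nat \<Rightarrow> nat. \<Sum>y\<in>{1..N}. \<nu> y * (real (\<xi> y) - p))"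
  define m where "m = pext N \<rho> (\<lambda>\<xi>. \<phi> \<xi> * X \<xi>)"
  have "0 = pext N \<rho> (\<lambda>\<xi>. 0 * 1)" unfolding pext_cmult by simp
  also have "\<dots> \<le> pext N \<rho> (\<lambda>\<xi>. (\<phi> \<xi> * X \<xi> - m)\<^sup>2)" by (rule pext_mono[OF \<rho>]) auto
  also have "\<dots> = pext N \<rho> (\<lambda>\<xi>. (-2 * m) * (\<phi> \<xi> * X \<xi>) + ((\<phi> \<xi> * X \<xi>)\<^sup>2 + m\<^sup>2 * 1))"
    by (intro pext_cong) (simp add: power2_eq_square algebra_simps)
  also have "\<dots> = - m\<^sup>2 + pext N \<rho> (\<lambda>\<xi>. (\<phi> \<xi> * X \<xi>)\<^sup>2)"
    unfolding pext_lin pext_add pext_cmult pext_one m_def[symmetric] by (simp add: power2_eq_square)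
  finally have "m\<^sup>2 \<le> pext N \<rho> (\<lambda>\<xi>. (\<phi> \<xi> * X \<xi>)\<^sup>2)" by simp
  also have "\<dots> \<le> pext N \<rho> (\<lambda>\<xi>. (X \<xi>)\<^sup>2)"
  proof (rule pext_mono[OF \<rho>])
    fix \<xi> assume "\<xi> \<in> configs N"
    then have "(\<phi> \<xi>)\<^sup>2 \<le> 1" using \<phi> abs_le_square_iff[of "\<phi> \<xi>" 1] by simp
    then show "(\<phi> \<xi> * X \<xi>)\<^sup>2 \<le> (X \<xi>)\<^sup>2"
      unfolding power_mult_distrib using mult_right_mono[of "(\<phi> \<xi>)\<^sup>2" 1 "(X \<xi>)\<^sup>2"] by simp
  qed
  also have "\<dots> = p * (1 - p) * (\<Sum>y\<in>{1..N}. (\<nu> y)\<^sup>2)"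
    unfolding X_def by (rule pext_centered_square[OF \<nu>])
  finally have "m\<^sup>2 / (p * (1 - p))\<^sup>2 \<le> p * (1 - p) * (\<Sum>y\<in>{1..N}. (\<nu> y)\<^sup>2) / (p * (1 - p))\<^sup>2"
    by (rule divide_right_mono) simp
  moreover have "pderiv_ext N \<rho> \<nu> \<phi> = m / (p * (1 - p))"
    unfolding m_def X_def by (rule pderiv_ext_as_pext[OF p \<nu>])
  ultimately show ?thesis using p by (simp add: power_divide power2_eq_square)
qed

lemma pderiv_ext_le:
  assumes \<rho>: "\<And>k. k \<in> {1..N} \<Longrightarrow> \<rho> k \<in> {0..1}" and \<nu>: "\<And>k. k \<in> {1..N} \<Longrightarrow> 0 \<le> \<nu> k"
    and \<phi>: "\<And>\<xi> y. \<xi> \<in> configs N \<Longrightarrow> y \<in> {1..N} \<Longrightarrow> \<bar>\<phi> (\<xi>(y := 1)) - \<phi> (\<xi>(y := 0))\<bar> \<le> G"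
  shows "\<bar>pderiv_ext N \<rho> \<nu> \<phi>\<bar> \<le> G * (\<Sum>y\<in>{1..N}. \<nu> y)"
proof -
  have "\<bar>pext N (\<rho>(y := 1)) \<phi> - pext N (\<rho>(y := 0)) \<phi>\<bar> \<le> G" if y: "y \<in> {1..N}" for y
  proof -
    have e: "pext N (\<rho>(y := 1)) \<phi> - pext N (\<rho>(y := 0)) \<phi> = pext N \<rho> (\<lambda>\<xi>. \<phi> (\<xi>(y := 1)) - \<phi> (\<xi>(y := 0)))"
      using pext_set[OF y, of 1 \<rho> \<phi>] pext_set[OF y, of 0 \<rho> \<phi>] by (simp add: pext_diff)
    have "pext N \<rho> (\<lambda>\<xi>. \<phi> (\<xi>(y := 1)) - \<phi> (\<xi>(y := 0))) \<le> pext N \<rho> (\<lambda>\<xi>. G * 1)"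
      by (rule pext_mono[OF \<rho>]) (use \<phi>[OF _ y] abs_le_iff in auto)
    moreover have "pext N \<rho> (\<lambda>\<xi>. - G * 1) \<le> pext N \<rho> (\<lambda>\<xi>. \<phi> (\<xi>(y := 1)) - \<phi> (\<xi>(y := 0)))"
    proof (rule pext_mono[OF \<rho>])
      fix \<xi> assume "\<xi> \<in> configs N"
      from \<phi>[OF this y] show "- G * 1 \<le> \<phi> (\<xi>(y := 1)) - \<phi> (\<xi>(y := 0))" by linarith
    qed
    ultimately show ?thesis unfolding e pext_cmult pext_one by (simp add: abs_le_iff)
  qed
  then have "\<bar>pderiv_ext N \<rho> \<nu> \<phi>\<bar> \<le> (\<Sum>y\<in>{1..N}. \<nu> y * G)"
    unfolding pderiv_ext_def using \<nu>
    by (intro order_trans[OF sum_abs] sum_mono) (auto simp: abs_mult intro!: mult_left_mono)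
  then show ?thesis by (simp add: sum_distrib_left mult.commute)
qed

subsection \<open>A discrepancy in a dynamic environment\<close>

text \<open>A state \<open>(\<beta>, \<zeta>, \<nu>)\<close> records the set \<open>{\<beta> = 1}\<close> of sites whose content is an independent
  Bernoulli(\<open>p\<close>) variable, the configuration \<open>\<zeta>\<close> off this set, and the conditional law \<open>\<nu>\<close> of the
  position of a discrepancy. When both ends of an edge lie in \<open>{\<beta> = 1}\<close>, stirring the edge is
  invisible and averages \<open>\<nu>\<close>. This is why conditioning on the environment spreads \<open>\<nu>\<close>.\<close>

type_synonym dstate = "(nat \<Rightarrow> nat) \<times> (nat \<Rightarrow> nat) \<times> (nat \<Rightarrow> real)"

definition avg :: "nat \<Rightarrow> (nat \<Rightarrow> real) \<Rightarrow> nat \<Rightarrow> real" where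
  "avg i \<nu> = (\<lambda>k. (\<nu> k + swp i \<nu> k) / 2)"

text \<open>The rate 2 makes the lifting exact: a functional linear in \<open>\<nu>\<close> changes
  under \<open>avg\<close> by half of what it changes under the swap. When both ends lie in the
  environment \<open>\<zeta>\<close> stays in place, since \<open>dens\<close> does not read it
  there.\<close>

definition edge_gen :: "nat \<Rightarrow> (dstate \<Rightarrow> real) \<Rightarrow> dstate \<Rightarrow> real" where
  "edge_gen i F = (\<lambda>(\<beta>, \<zeta>, \<nu>). if \<beta> i = 1 \<and> \<beta> (i + 1) = 1
     then 2 * (F (\<beta>, \<zeta>, avg i \<nu>) - F (\<beta>, \<zeta>, \<nu>))
     else F (swp i \<beta>, swp i \<zeta>, swp i \<nu>) - F (\<beta>, \<zeta>, \<nu>))"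

text \<open>A reset on the left puts a fresh Bernoulli(\<open>p\<close>) variable at site 1, which
  stays unrevealed; a reset on the right reveals the new value. Only the randomness of the left
  reservoir is kept for smoothing. Either reset destroys the discrepancy at that site.\<close>

definition bdry_gen :: "nat \<Rightarrow> real \<Rightarrow> (dstate \<Rightarrow> real) \<Rightarrow> dstate \<Rightarrow> real" where
  "bdry_gen N q F = (\<lambda>(\<beta>, \<zeta>, \<nu>). (F (\<beta>(1 := 1), \<zeta>, \<nu>(1 := 0)) - F (\<beta>, \<zeta>, \<nu>))
     + q * (F (\<beta>(N := 0), \<zeta>(N := 1), \<nu>(N := 0)) - F (\<beta>, \<zeta>, \<nu>))
     + (1 - q) * (F (\<beta>(N := 0), \<zeta>(N := 0), \<nu>(N := 0)) - F (\<beta>, \<zeta>, \<nu>)))"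

definition dgen :: "nat \<Rightarrow> real \<Rightarrow> (dstate \<Rightarrow> real) \<Rightarrow> dstate \<Rightarrow> real" where
  "dgen N q F z = (real N)\<^sup>2 * ((\<Sum>i\<in>{1..<N}. edge_gen i F z) + bdry_gen N q F z)"

text \<open>\<open>\<nu>\<close> is only a sub-probability because the discrepancy can be killed at
  the ends, and it lives on the environment because the smoothing needs density \<open>p\<close> at
  its sites.\<close>

definition dstates :: "nat \<Rightarrow> dstate set" where
  "dstates N = {(\<beta>, \<zeta>, \<nu>). \<beta> \<in> configs N \<and> \<zeta> \<in> configs N \<and> (\<forall>k. 0 \<le> \<nu> k) \<and>
     (\<forall>k\<in>{1..N}. \<beta> k = 0 \<longrightarrow> \<nu> k = 0) \<and> (\<Sum>k\<in>{1..N}. \<nu> k) \<le> 1}"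

lemma sum_swp_apply: "i \<in> {1..<N} \<Longrightarrow> (\<Sum>k\<in>{1..N}. swp i \<nu> k) = (\<Sum>k\<in>{1..N}. \<nu> k :: real)"
  using sum_swp[of i N \<nu>] by (simp add: swp_eq)

lemma swp_outside: "k \<noteq> i \<Longrightarrow> k \<noteq> i + 1 \<Longrightarrow> swp i f k = f k"
  by (simp add: swp_def)

lemma swp_at [simp]: "swp i f i = f (i + 1)" "swp i f (Suc i) = f i"
  by (simp_all add: swp_def)

lemma tr_mem: "i \<in> {1..<N} \<Longrightarrow> k \<in> {1..N} \<Longrightarrow> tr i k \<in> {1..N}"
  using bij_betw_tr[of i N] by (auto simp: bij_betw_def)

lemma dstates_avg:
  assumes "(\<beta>, \<zeta>, \<nu>) \<in> dstates N" "i \<in> {1..<N}" "\<beta> i = 1" "\<beta> (i + 1) = 1"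
  shows "(\<beta>, \<zeta>, avg i \<nu>) \<in> dstates N"
proof -
  have "avg i \<nu> k = 0" if "k \<in> {1..N}" "\<beta> k = 0" for k
  proof -
    have "k \<noteq> i" "k \<noteq> i + 1" using that assms by auto
    then show ?thesis using that assms by (auto simp: avg_def swp_outside dstates_def)
  qed
  moreover have "(\<Sum>k\<in>{1..N}. avg i \<nu> k) = (\<Sum>k\<in>{1..N}. \<nu> k)"
    unfolding avg_def sum_divide_distrib[symmetric] sum.distrib sum_swp_apply[OF assms(2)] by simp
  moreover have "0 \<le> avg i \<nu> k" for k
    using assms(1) by (auto simp: avg_def dstates_def swp_eq)
  ultimately show ?thesis using assms(1) by (auto simp: dstates_def)
qed

lemma dstates_swp:
  assumes "(\<beta>, \<zeta>, \<nu>) \<in> dstates N" "i \<in> {1..<N}"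
  shows "(swp i \<beta>, swp i \<zeta>, swp i \<nu>) \<in> dstates N"
proof -
  have "swp i \<nu> k = 0" if "k \<in> {1..N}" "swp i \<beta> k = 0" for k
    using assms(1) tr_mem[OF assms(2) that(1)] that(2) by (auto simp: swp_eq dstates_def)
  then show ?thesis using assms swp_configs[of _ N i] sum_swp_apply[OF assms(2), of \<nu>]
    by (auto simp: dstates_def) (simp add: swp_eq)
qed

lemma sum_upd_zero_le:
  fixes \<nu> :: "nat \<Rightarrow> real"
  assumes "\<And>k. 0 \<le> \<nu> k"
  shows "(\<Sum>k\<in>{1..N}. (\<nu>(j := 0)) k) \<le> (\<Sum>k\<in>{1..N}. \<nu> k)"
  using assms by (intro sum_mono) auto

lemma dstates_left: "(\<beta>, \<zeta>, \<nu>) \<in> dstates N \<Longrightarrow> 1 \<le> N \<Longrightarrow> (\<beta>(1 := 1), \<zeta>, \<nu>(1 := 0)) \<in> dstates N"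
  using configs_upd[of \<beta> N 1 1] sum_upd_zero_le[of \<nu> 1 N] unfolding dstates_def
  by (auto simp: fun_upd_def intro: order_trans)

lemma dstates_right: "(\<beta>, \<zeta>, \<nu>) \<in> dstates N \<Longrightarrow> 1 \<le> N \<Longrightarrow> v \<in> {0, 1} \<Longrightarrow>
    (\<beta>(N := 0), \<zeta>(N := v), \<nu>(N := 0)) \<in> dstates N"
  using configs_upd[of \<beta> N N 0] configs_upd[of \<zeta> N N v] sum_upd_zero_le[of \<nu> N N]
  unfolding dstates_def by (auto simp: fun_upd_def intro: order_trans)

definition drate :: "nat \<Rightarrow> real" where
  "drate N = (real N)\<^sup>2 * (2 * real (card {1..<N}) + 2)"

lemma dgen_subgen:
  assumes N: "1 \<le> N" and q: "q \<in> {0..1}"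
  shows "subgen (dstates N) (dgen N q) (drate N)"
proof
  show "0 \<le> drate N" by (simp add: drate_def)
next
  fix a F G z
  have e: "edge_gen i (\<lambda>x. a * F x + G x) z = a * edge_gen i F z + edge_gen i G z" for i
    by (cases z) (simp add: edge_gen_def algebra_simps)
  have b: "bdry_gen N q (\<lambda>x. a * F x + G x) z = a * bdry_gen N q F z + bdry_gen N q G z"
    by (cases z) (simp add: bdry_gen_def algebra_simps)
  show "dgen N q (\<lambda>x. a * F x + G x) z = a * dgen N q F z + dgen N q G z"
    unfolding dgen_def e b sum.distrib sum_distrib_left[symmetric] by (simp add: algebra_simps)
next
  fix F :: "dstate \<Rightarrow> real" and z assume F: "\<And>x. x \<in> dstates N \<Longrightarrow> 0 \<le> F x" and z: "z \<in> dstates N"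
  obtain \<beta> \<zeta> \<nu> where zz: "z = (\<beta>, \<zeta>, \<nu>)" by (cases z)
  note z' = z[unfolded zz]
  have e: "- (2 * F z) \<le> edge_gen i F z" if i: "i \<in> {1..<N}" for i
    using F[OF dstates_avg[OF z' i]] F[OF dstates_swp[OF z' i]] F[OF z]
    by (auto simp: edge_gen_def zz)
  have "0 \<le> q * F (\<beta>(N := 0), \<zeta>(N := 1), \<nu>(N := 0))"
    "0 \<le> (1 - q) * F (\<beta>(N := 0), \<zeta>(N := 0), \<nu>(N := 0))"
    using F[OF dstates_right[OF z' N]] q by auto
  then have b: "- (2 * F z) \<le> bdry_gen N q F z"
    using F[OF dstates_left[OF z' N]] by (simp add: bdry_gen_def zz algebra_simps)
  have "(\<Sum>i\<in>{1..<N}. - (2 * F z)) + - (2 * F z) \<le> (\<Sum>i\<in>{1..<N}. edge_gen i F z) + bdry_gen N q F z"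
    by (intro add_mono sum_mono e b)
  then have "(real N)\<^sup>2 * ((\<Sum>i\<in>{1..<N}. - (2 * F z)) + - (2 * F z)) \<le> dgen N q F z"
    unfolding dgen_def by (intro mult_left_mono) auto
  then show "0 \<le> dgen N q F z + drate N * F z"
    by (simp add: drate_def algebra_simps)
next
  fix z show "dgen N q (\<lambda>_. 1) z \<le> 0"
    by (cases z) (simp add: dgen_def edge_gen_def bdry_gen_def cong: if_cong)
next
  fix Fn :: "nat \<Rightarrow> dstate \<Rightarrow> real" and F z
  assume F: "\<And>x. x \<in> dstates N \<Longrightarrow> (\<lambda>n. Fn n x) \<longlonglongrightarrow> F x" and z: "z \<in> dstates N"
  obtain \<beta> \<zeta> \<nu> where zz: "z = (\<beta>, \<zeta>, \<nu>)" by (cases z)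
  note z' = z[unfolded zz]
  have e: "(\<lambda>n. edge_gen i (Fn n) z) \<longlonglongrightarrow> edge_gen i F z" if i: "i \<in> {1..<N}" for i
    using F[OF dstates_avg[OF z' i]] F[OF dstates_swp[OF z' i]] F[OF z']
    by (cases "\<beta> i = 1 \<and> \<beta> (i + 1) = 1") (auto simp: edge_gen_def zz intro!: tendsto_intros)
  have b: "(\<lambda>n. bdry_gen N q (Fn n) z) \<longlonglongrightarrow> bdry_gen N q F z"
    using F[OF dstates_left[OF z' N]] F[OF dstates_right[OF z' N]] F[OF z']
    by (auto simp: bdry_gen_def zz intro!: tendsto_intros)
  show "(\<lambda>n. dgen N q (Fn n) z) \<longlonglongrightarrow> dgen N q F z"
    unfolding dgen_def by (intro tendsto_intros e b)
qed

definition dens :: "real \<Rightarrow> (nat \<Rightarrow> nat) \<Rightarrow> (nat \<Rightarrow> nat) \<Rightarrow> nat \<Rightarrow> real" where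
  "dens p \<beta> \<zeta> k = (if \<beta> k = 1 then p else real (\<zeta> k))"

definition lift :: "nat \<Rightarrow> real \<Rightarrow> ((nat \<Rightarrow> nat) \<Rightarrow> real) \<Rightarrow> dstate \<Rightarrow> real" where
  "lift N p \<phi> = (\<lambda>(\<beta>, \<zeta>, \<nu>). pderiv_ext N (dens p \<beta> \<zeta>) \<nu> \<phi>)"

lemma pderiv_ext_ssep_gen:
  "pderiv_ext N \<rho> \<nu> (ssep_gen N p q \<phi>) = (real N)\<^sup>2 *
    ((\<Sum>i\<in>{1..<N}. pderiv_ext N \<rho> \<nu> (\<lambda>\<xi>. \<phi> (swp i \<xi>)) - pderiv_ext N \<rho> \<nu> \<phi>)
      + (p * pderiv_ext N \<rho> \<nu> (\<lambda>\<xi>. \<phi> (\<xi>(1 := 1))) + (1 - p) * pderiv_ext N \<rho> \<nu> (\<lambda>\<xi>. \<phi> (\<xi>(1 := 0)))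
        - pderiv_ext N \<rho> \<nu> \<phi>)
      + (q * pderiv_ext N \<rho> \<nu> (\<lambda>\<xi>. \<phi> (\<xi>(N := 1))) + (1 - q) * pderiv_ext N \<rho> \<nu> (\<lambda>\<xi>. \<phi> (\<xi>(N := 0)))
        - pderiv_ext N \<rho> \<nu> \<phi>))"
proof -
  have "ssep_gen N p q \<phi> = (\<lambda>\<xi>. (\<Sum>i\<in>{1..<N}. (real N)\<^sup>2 * (\<phi> (swp i \<xi>) - \<phi> \<xi>))
      + (real N)\<^sup>2 * (p * \<phi> (\<xi>(1 := 1)) + (1 - p) * \<phi> (\<xi>(1 := 0)) - \<phi> \<xi>)
      + (real N)\<^sup>2 * (q * \<phi> (\<xi>(N := 1)) + (1 - q) * \<phi> (\<xi>(N := 0)) - \<phi> \<xi>))"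
    by (simp add: fun_eq_iff ssep_gen_def swp_def)
  then show ?thesis
    by (simp only: pderiv_ext_add pderiv_ext_diff pderiv_ext_cmult pderiv_ext_sum
        sum_distrib_left distrib_left)
qed

text \<open>The reason for the form of \<open>dgen\<close>. On an edge inside the environment
  \<open>dens\<close> is symmetric and only \<open>\<nu>\<close> is swapped; other edges permute the
  whole state; on the left the mixture of the values 1 and 0 is density \<open>p\<close>, as the
  extension is affine in each coordinate; on the right the value becomes part of
  \<open>\<zeta>\<close>.\<close>

lemma dgen_lift:
  assumes N: "1 \<le> N" and z: "z \<in> dstates N"
  shows "dgen N q (lift N p \<phi>) z = lift N p (ssep_gen N p q \<phi>) z"
proof -
  obtain \<beta> \<zeta> \<nu> where zz: "z = (\<beta>, \<zeta>, \<nu>)" by (cases z)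
  let ?\<rho> = "dens p \<beta> \<zeta>"
  let ?D = "\<lambda>\<rho> \<nu>. pderiv_ext N \<rho> \<nu> \<phi>"
  have mem: "1 \<in> {1..N}" "N \<in> {1..N}" using N by auto
  have edge: "edge_gen i (lift N p \<phi>) z = pderiv_ext N ?\<rho> \<nu> (\<lambda>\<xi>. \<phi> (swp i \<xi>)) - ?D ?\<rho> \<nu>"
    if i: "i \<in> {1..<N}" for i
  proof (cases "\<beta> i = 1 \<and> \<beta> (i + 1) = 1")
    case True
    then have "swp i ?\<rho> = ?\<rho>" by (auto simp: swp_def dens_def fun_eq_iff)
    then have "pderiv_ext N ?\<rho> \<nu> (\<lambda>\<xi>. \<phi> (swp i \<xi>)) = ?D ?\<rho> (swp i \<nu>)"
      using pderiv_ext_swp[OF i, of ?\<rho> \<nu> \<phi>] by simp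
    moreover have "?D ?\<rho> (avg i \<nu>) = (?D ?\<rho> \<nu> + ?D ?\<rho> (swp i \<nu>)) / 2"
      unfolding avg_def by (rule pderiv_ext_lin_dir)
    ultimately show ?thesis using True by (simp add: edge_gen_def lift_def zz)
  next
    case False
    have "dens p (swp i \<beta>) (swp i \<zeta>) = swp i ?\<rho>" by (auto simp: swp_eq dens_def fun_eq_iff)
    then show ?thesis using False pderiv_ext_swp[OF i, of ?\<rho> \<nu> \<phi>]
      by (auto simp: edge_gen_def lift_def zz)
  qed
  have left: "p * pderiv_ext N ?\<rho> \<nu> (\<lambda>\<xi>. \<phi> (\<xi>(1 := 1))) + (1 - p) * pderiv_ext N ?\<rho> \<nu> (\<lambda>\<xi>. \<phi> (\<xi>(1 := 0)))
      = lift N p \<phi> (\<beta>(1 := 1), \<zeta>, \<nu>(1 := 0))"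
  proof -
    have "dens p (\<beta>(1 := 1)) \<zeta> = ?\<rho>(1 := p)" by (auto simp: dens_def fun_eq_iff)
    then show ?thesis
      using pderiv_ext_set[OF mem(1), of 1 ?\<rho> \<nu> \<phi>] pderiv_ext_set[OF mem(1), of 0 ?\<rho> \<nu> \<phi>]
        pderiv_ext_affine[OF mem(1), of "\<nu>(1 := 0)" ?\<rho> p \<phi>]
      by (simp add: lift_def)
  qed
  have right: "pderiv_ext N ?\<rho> \<nu> (\<lambda>\<xi>. \<phi> (\<xi>(N := v))) = lift N p \<phi> (\<beta>(N := 0), \<zeta>(N := v), \<nu>(N := 0))"
    if "v \<in> {0, 1}" for v
  proof -
    have "dens p (\<beta>(N := 0)) (\<zeta>(N := v)) = ?\<rho>(N := real v)" by (auto simp: dens_def fun_eq_iff)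
    then show ?thesis using pderiv_ext_set[OF mem(2) that, of ?\<rho> \<nu> \<phi>] by (simp add: lift_def)
  qed
  have right1: "pderiv_ext N ?\<rho> \<nu> (\<lambda>\<xi>. \<phi> (\<xi>(N := 1))) = lift N p \<phi> (\<beta>(N := 0), \<zeta>(N := 1), \<nu>(N := 0))"
    and right0: "pderiv_ext N ?\<rho> \<nu> (\<lambda>\<xi>. \<phi> (\<xi>(N := 0))) = lift N p \<phi> (\<beta>(N := 0), \<zeta>(N := 0), \<nu>(N := 0))"
    by (rule right; simp)+
  have l0: "lift N p \<psi> z = pderiv_ext N ?\<rho> \<nu> \<psi>" for \<psi> by (simp add: lift_def zz)
  have "bdry_gen N q (lift N p \<phi>) z =
      (p * pderiv_ext N ?\<rho> \<nu> (\<lambda>\<xi>. \<phi> (\<xi>(1 := 1))) + (1 - p) * pderiv_ext N ?\<rho> \<nu> (\<lambda>\<xi>. \<phi> (\<xi>(1 := 0)))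
        - ?D ?\<rho> \<nu>)
      + (q * pderiv_ext N ?\<rho> \<nu> (\<lambda>\<xi>. \<phi> (\<xi>(N := 1))) + (1 - q) * pderiv_ext N ?\<rho> \<nu> (\<lambda>\<xi>. \<phi> (\<xi>(N := 0)))
        - ?D ?\<rho> \<nu>)"
    unfolding left right1 right0
    by (simp add: bdry_gen_def zz lift_def algebra_simps)
  then show ?thesis
    unfolding dgen_def l0 pderiv_ext_ssep_gen by (simp add: edge)
qed

lemma lift_ssep_semigroup:
  assumes N: "1 \<le> N" and pq: "p \<in> {0..1}" "q \<in> {0..1}" and z: "z \<in> dstates N"
  shows "sgp (dgen N q) t (lift N p \<phi>) z = lift N p (ssep_semigroup N p q t \<phi>) z"
  unfolding ssep_semigroup_sgp
proof (rule sgp_intertwine[where \<Phi> = "lift N p", OF dgen_subgen[OF N pq(2)] ssep_subgen[OF pq] _ _ dgen_lift[OF N]])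
  fix a :: real and F G and z :: dstate
  show "lift N p (\<lambda>x. a * F x + G x) z = a * lift N p F z + lift N p G z"
    by (cases z) (simp add: lift_def pderiv_ext_lin)
next
  fix Fn :: "nat \<Rightarrow> (nat \<Rightarrow> nat) \<Rightarrow> real" and F and z :: dstate
  assume "\<And>x. x \<in> configs N \<Longrightarrow> (\<lambda>n. Fn n x) \<longlonglongrightarrow> F x"
  then show "(\<lambda>n. lift N p (Fn n) z) \<longlonglongrightarrow> lift N p F z"
    unfolding lift_def pderiv_ext_def pext_def by (cases z) (auto intro!: tendsto_intros)
qed (use bounded_fn_finite[OF finite_configs] z in auto)

text \<open>The start of a pair of configurations that differ at \<open>x\<close>. The environment
  is the single site \<open>x\<close>, as \<open>dstates\<close> demands of the support of
  \<open>\<nu>\<close>; the density \<open>p\<close> put there is overwritten by the derivative in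
  direction \<open>x\<close>.\<close>

definition dpoint :: "nat \<Rightarrow> nat \<Rightarrow> (nat \<Rightarrow> nat) \<Rightarrow> dstate" where
  "dpoint N x \<eta> = ((\<lambda>k\<in>{1..N}. if k = x then 1 else 0), \<eta>, (\<lambda>k. if k = x then 1 else 0))"

lemma dpoint_dstates: "x \<in> {1..N} \<Longrightarrow> \<eta> \<in> configs N \<Longrightarrow> dpoint N x \<eta> \<in> dstates N"
  by (auto simp: dpoint_def dstates_def configs_def PiE_iff extensional_def)

lemma pext_dirac:
  assumes "\<eta> \<in> configs N" "\<And>k. k \<in> {1..N} \<Longrightarrow> \<rho> k = real (\<eta> k)"
  shows "pext N \<rho> \<phi> = \<phi> \<eta>"
proof -
  have "bern_wt {1..N} \<rho> \<xi> = (if \<xi> = \<eta> then 1 else 0)" if \<xi>: "\<xi> \<in> configs N" for \<xi>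
  proof (cases "\<xi> = \<eta>")
    case True
    have "(if \<xi> k = 1 then \<rho> k else 1 - \<rho> k) = 1" if "k \<in> {1..N}" for k
      using True assms(2)[OF that] configs_01[OF assms(1) that] by auto
    then show ?thesis unfolding bern_wt_def using True by (simp add: prod.neutral)
  next
    case False
    then obtain k where k: "k \<in> {1..N}" "\<xi> k \<noteq> \<eta> k"
      using \<xi> assms(1) unfolding configs_def by (metis PiE_ext)
    then have "(if \<xi> k = 1 then \<rho> k else 1 - \<rho> k) = 0"
      using assms(2)[OF k(1)] configs_01[OF assms(1) k(1)] configs_01[OF \<xi> k(1)] by auto
    then show ?thesis unfolding bern_wt_def using False k(1)
      by (subst prod_zero[OF _ bexI[of _ k]]) auto
  qed
  then have "pext N \<rho> \<phi> = (\<Sum>\<xi>\<in>configs N. if \<xi> = \<eta> then \<phi> \<eta> else 0)"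
    unfolding pext_def by (intro sum.cong) auto
  then show ?thesis using assms(1) finite_configs by simp
qed

lemma lift_dpoint:
  assumes "x \<in> {1..N}" "\<eta> \<in> configs N"
  shows "lift N p \<phi> (dpoint N x \<eta>) = \<phi> (\<eta>(x := 1)) - \<phi> (\<eta>(x := 0))"
proof -
  let ?\<beta> = "\<lambda>k\<in>{1..N}. if k = x then 1 else 0 :: nat"
  have "pext N ((dens p ?\<beta> \<eta>)(x := real v)) \<phi> = \<phi> (\<eta>(x := v))" if "v \<in> {0, 1}" for v
    by (rule pext_dirac) (use configs_upd[OF assms(2,1) that] in \<open>auto simp: dens_def\<close>)
  from this[of 1] this[of 0] have "(if y = x then 1 else 0) *
      (pext N ((dens p ?\<beta> \<eta>)(y := 1)) \<phi> - pext N ((dens p ?\<beta> \<eta>)(y := 0)) \<phi>) =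
      (if y = x then \<phi> (\<eta>(x := 1)) - \<phi> (\<eta>(x := 0)) else 0)" for y by simp
  then have "lift N p \<phi> (dpoint N x \<eta>) =
      (\<Sum>y\<in>{1..N}. if y = x then \<phi> (\<eta>(x := 1)) - \<phi> (\<eta>(x := 0)) else 0)"
    unfolding lift_def dpoint_def pderiv_ext_def prod.case by (intro sum.cong refl)
  then show ?thesis using assms(1) by simp
qed

definition sqmass :: "nat \<Rightarrow> (nat \<Rightarrow> real) \<Rightarrow> dstate \<Rightarrow> real" where
  "sqmass N u = (\<lambda>(\<beta>, \<zeta>, \<nu>). \<Sum>k\<in>{1..N}. u k * (\<nu> k)\<^sup>2)"

lemma dstates_nu_le_1:
  assumes "(\<beta>, \<zeta>, \<nu>) \<in> dstates N" "k \<in> {1..N}"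
  shows "\<nu> k \<le> 1"
proof -
  have "\<nu> k \<le> (\<Sum>k\<in>{1..N}. \<nu> k)" by (rule member_le_sum) (use assms in \<open>auto simp: dstates_def\<close>)
  then show ?thesis using assms by (simp add: dstates_def)
qed

lemma bounded_sqmass: "bounded_fn (dstates N) (sqmass N u)"
proof (rule bounded_fnI)
  fix z assume "z \<in> dstates N"
  then obtain \<beta> \<zeta> \<nu> where z: "z = (\<beta>, \<zeta>, \<nu>)" "(\<beta>, \<zeta>, \<nu>) \<in> dstates N" by (cases z) auto
  have "\<bar>u k * (\<nu> k)\<^sup>2\<bar> \<le> \<bar>u k\<bar> * 1" if "k \<in> {1..N}" for k
    using dstates_nu_le_1[OF z(2) that] z(2)
    by (auto simp: abs_mult dstates_def intro!: mult_left_le power_le_one)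
  then have "\<bar>\<Sum>k\<in>{1..N}. u k * (\<nu> k)\<^sup>2\<bar> \<le> (\<Sum>k\<in>{1..N}. \<bar>u k\<bar> * 1)"
    by (intro order_trans[OF sum_abs] sum_mono)
  then show "\<bar>sqmass N u z\<bar> \<le> (\<Sum>k\<in>{1..N}. \<bar>u k\<bar> * 1)" by (simp add: sqmass_def z)
qed

lemma dens_range:
  "p \<in> {0..1} \<Longrightarrow> \<zeta> \<in> configs N \<Longrightarrow> k \<in> {1..N} \<Longrightarrow> dens p \<beta> \<zeta> k \<in> {0..1}"
  using configs_01[of \<zeta> N k] by (auto simp: dens_def)

lemma bounded_lift: "p \<in> {0..1} \<Longrightarrow> bounded_fn (dstates N) (lift N p \<phi>)"
proof (rule bounded_fnI)
  fix z assume p: "p \<in> {0..1}" and "z \<in> dstates N"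
  then obtain \<beta> \<zeta> \<nu> where z: "z = (\<beta>, \<zeta>, \<nu>)" "(\<beta>, \<zeta>, \<nu>) \<in> dstates N" by (cases z) auto
  define G where "G = 2 * (\<Sum>\<xi>\<in>configs N. \<bar>\<phi> \<xi>\<bar>)"
  have mem: "\<bar>\<phi> \<xi>\<bar> \<le> G / 2" if "\<xi> \<in> configs N" for \<xi>
    unfolding G_def using member_le_sum[of \<xi> "configs N" "\<lambda>\<xi>. \<bar>\<phi> \<xi>\<bar>"] that finite_configs by simp
  have "\<bar>pderiv_ext N (dens p \<beta> \<zeta>) \<nu> \<phi>\<bar> \<le> G * (\<Sum>y\<in>{1..N}. \<nu> y)"
  proof (rule pderiv_ext_le)
    fix \<xi> y assume "\<xi> \<in> configs N" "y \<in> {1..N}"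
    then have "\<bar>\<phi> (\<xi>(y := 1))\<bar> \<le> G / 2" "\<bar>\<phi> (\<xi>(y := 0))\<bar> \<le> G / 2" by (intro mem configs_upd; simp)+
    then show "\<bar>\<phi> (\<xi>(y := 1)) - \<phi> (\<xi>(y := 0))\<bar> \<le> G" by linarith
  qed (use z(2) p dens_range[of p] in \<open>auto simp: dstates_def\<close>)
  also have "\<dots> \<le> G * 1"
    using z(2) unfolding G_def by (intro mult_left_mono) (auto simp: dstates_def intro!: sum_nonneg)
  finally show "\<bar>lift N p \<phi> z\<bar> \<le> G" by (simp add: lift_def z)
qed

definition mass :: "nat \<Rightarrow> (nat \<Rightarrow> real) \<Rightarrow> dstate \<Rightarrow> real" where
  "mass N c = (\<lambda>(\<beta>, \<zeta>, \<nu>). \<Sum>k\<in>{1..N}. c k * \<nu> k)"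

text \<open>Linear functionals of \<open>\<nu>\<close> cannot distinguish averaging at rate 2 from
  swapping at rate 1, so the mean of \<open>\<nu>\<close> is a walk killed at both ends, whatever
  the environment.\<close>

lemma dgen_mass:
  assumes N: "1 \<le> N"
  shows "dgen N q (mass N c) z = mass N (klap N c) z"
proof -
  obtain \<beta> \<zeta> \<nu> where zz: "z = (\<beta>, \<zeta>, \<nu>)" by (cases z)
  let ?m = "\<lambda>\<nu>. \<Sum>k\<in>{1..N}. c k * \<nu> k"
  have sw: "?m (swp i \<nu>) - ?m \<nu> = (c (i + 1) - c i) * (\<nu> i - \<nu> (i + 1))" if "i \<in> {1..<N}" for i
    unfolding swp_def using sum_fun_swap[OF that, of "\<lambda>k x. c k * x" \<nu>] by (simp add: algebra_simps)
  have av: "?m (avg i \<nu>) = (?m \<nu> + ?m (swp i \<nu>)) / 2" for i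
    unfolding avg_def sum.distrib[symmetric] sum_divide_distrib
    by (intro sum.cong refl) (simp add: algebra_simps)
  have edge: "edge_gen i (mass N c) z = (c (i + 1) - c i) * (\<nu> i - \<nu> (i + 1))" if "i \<in> {1..<N}" for i
    using sw[OF that] av[of i] by (simp add: edge_gen_def mass_def zz field_simps)
  have up: "?m (\<nu>(j := 0)) = ?m \<nu> - c j * \<nu> j" if "j \<in> {1..N}" for j
    using sum_fun_upd[of "{1..N}" j "\<lambda>k x. c k * x" \<nu> 0] that by simp
  have "bdry_gen N q (mass N c) z = - \<nu> 1 * c 1 - \<nu> N * c N"
    using up[of 1] up[of N] N by (simp add: bdry_gen_def mass_def zz algebra_simps)
  moreover have "mass N (klap N c) z = (\<Sum>k\<in>{1..N}. \<nu> k * klap N c k)"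
    by (simp add: mass_def zz mult.commute)
  ultimately show ?thesis unfolding dgen_def klap_sum_edges[OF N] by (simp add: edge)
qed

lemma mass_semigroup:
  assumes N: "1 \<le> N" and q: "q \<in> {0..1}" and z: "z \<in> dstates N"
  shows "sgp (dgen N q) t (mass N c) z = mass N (sgp (klap N) t c) z"
proof (rule sgp_intertwine[where \<Phi> = "mass N", OF dgen_subgen[OF N q] klap_subgen _ _ dgen_mass[OF N]])
  fix a :: real and F G and z :: dstate
  show "mass N (\<lambda>x. a * F x + G x) z = a * mass N F z + mass N G z"
    by (cases z) (simp add: mass_def sum.distrib sum_distrib_left algebra_simps)
next
  fix Fn :: "nat \<Rightarrow> nat \<Rightarrow> real" and F and z :: dstate
  assume "\<And>x. x \<in> {1..N} \<Longrightarrow> (\<lambda>n. Fn n x) \<longlonglongrightarrow> F x"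
  then show "(\<lambda>n. mass N (Fn n) z) \<longlonglongrightarrow> mass N F z"
    unfolding mass_def by (cases z) (auto intro!: tendsto_intros)
qed (use z bounded_fn_finite[of "{1..N}"] in auto)

text \<open>The substitute for the monotone coupling: the gradient at time \<open>t\<close> is the
  expected lift, at most \<open>G\<close> times the remaining mass of \<open>\<nu>\<close>.\<close>

lemma ssep_gradient_alive:
  assumes N: "1 \<le> N" and pq: "p \<in> {0..1}" "q \<in> {0..1}" and t: "0 \<le> t"
    and x: "x \<in> {1..N}" and \<eta>: "\<eta> \<in> configs N"
    and \<phi>: "\<And>\<xi> y. \<xi> \<in> configs N \<Longrightarrow> y \<in> {1..N} \<Longrightarrow> \<bar>\<phi> (\<xi>(y := 1)) - \<phi> (\<xi>(y := 0))\<bar> \<le> G"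
  shows "\<bar>ssep_semigroup N p q t \<phi> (\<eta>(x := 1)) - ssep_semigroup N p q t \<phi> (\<eta>(x := 0))\<bar> \<le> G * alive N t x"
proof -
  interpret D: subgen "dstates N" "dgen N q" "drate N" by (rule dgen_subgen[OF N pq(2)])
  let ?z = "dpoint N x \<eta>"
  have z: "?z \<in> dstates N" by (rule dpoint_dstates[OF x \<eta>])
  have bm: "bounded_fn (dstates N) (mass N c)" for c
  proof (rule bounded_fnI)
    fix z assume "z \<in> dstates N"
    then obtain \<beta> \<zeta> \<nu> where zz: "z = (\<beta>, \<zeta>, \<nu>)" "(\<beta>, \<zeta>, \<nu>) \<in> dstates N" by (cases z) auto
    have "\<bar>\<Sum>k\<in>{1..N}. c k * \<nu> k\<bar> \<le> (\<Sum>k\<in>{1..N}. \<bar>c k\<bar> * 1)"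
      using dstates_nu_le_1[OF zz(2)] zz(2)
      by (intro order_trans[OF sum_abs] sum_mono) (auto simp: abs_mult dstates_def intro!: mult_left_le)
    then show "\<bar>mass N c z\<bar> \<le> (\<Sum>k\<in>{1..N}. \<bar>c k\<bar> * 1)" by (simp add: mass_def zz)
  qed
  have "\<bar>lift N p \<phi> w\<bar> \<le> G * mass N (\<lambda>_. 1) w" if "w \<in> dstates N" for w
    using that pderiv_ext_le[OF _ _ \<phi>] dens_range[OF pq(1)]
    by (cases w) (auto simp: lift_def mass_def dstates_def)
  then have "\<bar>sgp (dgen N q) t (lift N p \<phi>) ?z\<bar> \<le> sgp (dgen N q) t (\<lambda>w. G * mass N (\<lambda>_. 1) w) ?z"
    by (intro D.sgp_abs bounded_lift z t bounded_fn_cmult bm pq)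
  also have "\<dots> = G * mass N (alive N t) ?z"
    unfolding D.sgp_cmult[OF bm z] mass_semigroup[OF N pq(2) z] by (simp add: alive_def)
  also have "mass N (alive N t) ?z = (\<Sum>k\<in>{1..N}. if k = x then alive N t x else 0)"
    unfolding mass_def dpoint_def prod.case by (intro sum.cong refl) simp
  also have "\<dots> = alive N t x" using x by simp
  finally show ?thesis
    unfolding lift_ssep_semigroup[OF N pq z] lift_dpoint[OF x \<eta>] .
qed

lemma ssep_gradient_sqmass:
  assumes N: "1 \<le> N" and p: "0 < p" "p < 1" and q: "q \<in> {0..1}" and t: "0 \<le> t"
    and x: "x \<in> {1..N}" and \<eta>: "\<eta> \<in> configs N"
    and \<phi>: "\<And>\<xi>. \<xi> \<in> configs N \<Longrightarrow> \<bar>\<phi> \<xi>\<bar> \<le> 1"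
  shows "(ssep_semigroup N p q t \<phi> (\<eta>(x := 1)) - ssep_semigroup N p q t \<phi> (\<eta>(x := 0)))\<^sup>2 \<le>
    sgp (dgen N q) t (sqmass N (\<lambda>_. 1)) (dpoint N x \<eta>) / (p * (1 - p))"
proof -
  interpret D: subgen "dstates N" "dgen N q" "drate N" by (rule dgen_subgen[OF N q])
  let ?z = "dpoint N x \<eta>"
  have z: "?z \<in> dstates N" by (rule dpoint_dstates[OF x \<eta>])
  have p': "p \<in> {0..1}" using p by auto
  have le: "(lift N p \<phi> w)\<^sup>2 \<le> 1 / (p * (1 - p)) * sqmass N (\<lambda>_. 1) w" if "w \<in> dstates N" for w
  proof -
    obtain \<beta> \<zeta> \<nu> where w: "w = (\<beta>, \<zeta>, \<nu>)" "(\<beta>, \<zeta>, \<nu>) \<in> dstates N" using \<open>w \<in> _\<close> by (cases w) auto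
    have "dens p \<beta> \<zeta> k = p" if "k \<in> {1..N}" "\<nu> k \<noteq> 0" for k
      using that w(2) configs_01[of \<beta> N k] by (auto simp: dens_def dstates_def)
    then show ?thesis
      using pderiv_ext_bessel[OF p, of N \<nu> "dens p \<beta> \<zeta>" \<phi>] dens_range[OF p', of \<zeta> N] w(2) \<phi>
      by (auto simp: lift_def sqmass_def w dstates_def)
  qed
  have "(sgp (dgen N q) t (lift N p \<phi>) ?z)\<^sup>2 \<le> sgp (dgen N q) t (\<lambda>w. (lift N p \<phi> w)\<^sup>2) ?z"
    by (intro D.sgp_square bounded_lift p' z t)
  also have "\<dots> \<le> sgp (dgen N q) t (\<lambda>w. 1 / (p * (1 - p)) * sqmass N (\<lambda>_. 1) w) ?z"
    by (intro D.sgp_mono le z t bounded_fn_cmult bounded_sqmass)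
       (auto simp: power2_eq_square intro!: bounded_fn_mult bounded_lift p')
  also have "\<dots> = 1 / (p * (1 - p)) * sgp (dgen N q) t (sqmass N (\<lambda>_. 1)) ?z"
    by (rule D.sgp_cmult[OF bounded_sqmass z])
  finally show ?thesis
    unfolding lift_ssep_semigroup[OF N p' q z] lift_dpoint[OF x \<eta>] by simp
qed

subsection \<open>Lyapunov functions\<close>

definition ugen :: "nat \<Rightarrow> real \<Rightarrow> (dstate \<Rightarrow> real) \<Rightarrow> dstate \<Rightarrow> real" where
  "ugen N q F z = (\<Sum>i\<in>{1..<N}. edge_gen i F z) + bdry_gen N q F z"

lemma dgen_ugen: "dgen N q F z = (real N)\<^sup>2 * ugen N q F z"
  by (simp add: dgen_def ugen_def)

text \<open>Quadratic functionals are convex in \<open>\<nu>\<close>, hence averaging at rate 2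
  yields at most what swapping at rate 1 would. The bound treats the two copies as glued to each
  other.\<close>

lemma edge_gen_convex:
  assumes i: "i \<in> {1..<N}" and U: "\<And>k. 0 \<le> U \<beta> k"
  shows "edge_gen i (\<lambda>(\<beta>, \<zeta>, \<nu>). \<Sum>k\<in>{1..N}. (\<nu> k)\<^sup>2 * U \<beta> k) (\<beta>, \<zeta>, \<nu>) \<le>
    (\<Sum>k\<in>{1..N}. (\<nu> k)\<^sup>2 * (U (swp i \<beta>) (tr i k) - U \<beta> k))"
proof -
  have re: "(\<Sum>k\<in>{1..N}. (\<nu> k)\<^sup>2 * U (swp i \<beta>) (tr i k)) = (\<Sum>k\<in>{1..N}. (swp i \<nu> k)\<^sup>2 * U (swp i \<beta>) k)"
    using sum_swp[OF i, of "\<lambda>k. (swp i \<nu> k)\<^sup>2 * U (swp i \<beta>) k"] by simp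
  show ?thesis
  proof (cases "\<beta> i = 1 \<and> \<beta> (i + 1) = 1")
    case True
    then have sb: "swp i \<beta> = \<beta>" by (auto simp: swp_def)
    have "(avg i \<nu> k)\<^sup>2 \<le> ((\<nu> k)\<^sup>2 + (swp i \<nu> k)\<^sup>2) / 2" for k
    proof -
      have "0 \<le> (\<nu> k - swp i \<nu> k)\<^sup>2" by simp
      then show ?thesis by (simp add: avg_def power2_eq_square field_simps)
    qed
    then have "(\<Sum>k\<in>{1..N}. (avg i \<nu> k)\<^sup>2 * U \<beta> k) \<le> (\<Sum>k\<in>{1..N}. ((\<nu> k)\<^sup>2 + (swp i \<nu> k)\<^sup>2) / 2 * U \<beta> k)"
      by (intro sum_mono mult_right_mono U)
    also have "\<dots> = ((\<Sum>k\<in>{1..N}. (\<nu> k)\<^sup>2 * U \<beta> k) + (\<Sum>k\<in>{1..N}. (swp i \<nu> k)\<^sup>2 * U \<beta> k)) / 2"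
      by (simp add: sum.distrib[symmetric] sum_divide_distrib field_simps)
    finally show ?thesis using True re unfolding right_diff_distrib sum_subtractf
      by (simp add: edge_gen_def sb)
  next
    case False
    then show ?thesis using re unfolding right_diff_distrib sum_subtractf
      by (auto simp: edge_gen_def)
  qed
qed

lemma tr_sum:
  fixes g :: "nat \<Rightarrow> real"
  assumes k: "k \<in> {1..N}"
  shows "(\<Sum>i\<in>{1..<N}. g (tr i k) - g k) =
    (if k < N then g (k + 1) - g k else 0) + (if 1 < k then g (k - 1) - g k else 0)"
proof -
  have "(\<Sum>i\<in>{1..<N}. g (tr i k) - g k) =
      (\<Sum>i\<in>{1..<N}. (if i = k then g (k + 1) - g k else 0) + (if i = k - 1 then g (k - 1) - g k else 0))"
    using k by (intro sum.cong refl) (auto simp: tr_def Transposition.transpose_def)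
  then show ?thesis using k by (auto simp: sum.distrib)
qed

text \<open>Two glued copies move as one killed walk, and averaging can only help. Separation is not
  exploited here but in \<open>ugen_meetF_le\<close>.\<close>

lemma dgen_sqmass_le:
  assumes N: "1 \<le> N" and u: "\<And>k. 0 \<le> u k"
  shows "dgen N q (sqmass N u) z \<le> sqmass N (klap N u) z"
proof -
  obtain \<beta> \<zeta> \<nu> where zz: "z = (\<beta>, \<zeta>, \<nu>)" by (cases z)
  have sq: "sqmass N u = (\<lambda>(\<beta>, \<zeta>, \<nu>). \<Sum>k\<in>{1..N}. (\<nu> k)\<^sup>2 * u k)"
    by (simp add: sqmass_def mult.commute)
  have "edge_gen i (sqmass N u) z \<le> (\<Sum>k\<in>{1..N}. (\<nu> k)\<^sup>2 * (u (tr i k) - u k))" if "i \<in> {1..<N}" for i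
    unfolding sq zz using edge_gen_convex[OF that, of "\<lambda>_. u"] u by simp
  then have "(\<Sum>i\<in>{1..<N}. edge_gen i (sqmass N u) z) \<le> (\<Sum>i\<in>{1..<N}. \<Sum>k\<in>{1..N}. (\<nu> k)\<^sup>2 * (u (tr i k) - u k))"
    by (rule sum_mono)
  also have "\<dots> = (\<Sum>k\<in>{1..N}. (\<nu> k)\<^sup>2 *
      ((if k < N then u (k + 1) - u k else 0) + (if 1 < k then u (k - 1) - u k else 0)))"
    by (subst sum.swap) (simp only: sum_distrib_left[symmetric] tr_sum cong: sum.cong)
  finally have e: "(\<Sum>i\<in>{1..<N}. edge_gen i (sqmass N u) z) \<le> (\<Sum>k\<in>{1..N}. (\<nu> k)\<^sup>2 *
      ((if k < N then u (k + 1) - u k else 0) + (if 1 < k then u (k - 1) - u k else 0)))" .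
  have up: "(\<Sum>k\<in>{1..N}. u k * ((\<nu>(j := 0)) k)\<^sup>2) = (\<Sum>k\<in>{1..N}. u k * (\<nu> k)\<^sup>2) - u j * (\<nu> j)\<^sup>2"
    if "j \<in> {1..N}" for j
    using sum_fun_upd[of "{1..N}" j "\<lambda>k x. u k * x\<^sup>2" \<nu> 0] that by simp
  have b: "bdry_gen N q (sqmass N u) z = - u 1 * (\<nu> 1)\<^sup>2 - u N * (\<nu> N)\<^sup>2"
    using up[of 1] up[of N] N by (simp add: bdry_gen_def sqmass_def zz algebra_simps)
  have b1: "u 1 * (\<nu> 1)\<^sup>2 = (\<Sum>k\<in>{1..N}. if k = 1 then u k * (\<nu> k)\<^sup>2 else 0)"
    "u N * (\<nu> N)\<^sup>2 = (\<Sum>k\<in>{1..N}. if k = N then u k * (\<nu> k)\<^sup>2 else 0)"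
    using N by auto
  have "ugen N q (sqmass N u) z \<le> (\<Sum>k\<in>{1..N}. (\<nu> k)\<^sup>2 *
      ((if k < N then u (k + 1) - u k else 0) + (if 1 < k then u (k - 1) - u k else 0))
      - (if k = 1 then u k * (\<nu> k)\<^sup>2 else 0) - (if k = N then u k * (\<nu> k)\<^sup>2 else 0))"
    using e b unfolding ugen_def sum_subtractf b1[symmetric] by simp
  also have "\<dots> = (\<Sum>k\<in>{1..N}. (zext N u (k + 1) + zext N u (k - 1) - 2 * u k) * (\<nu> k)\<^sup>2)"
    using N by (intro sum.cong refl) (auto simp: zext_def algebra_simps)
  finally have "(real N)\<^sup>2 * ugen N q (sqmass N u) z \<le> (real N)\<^sup>2 *
      (\<Sum>k\<in>{1..N}. (zext N u (k + 1) + zext N u (k - 1) - 2 * u k) * (\<nu> k)\<^sup>2)"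
    by (rule mult_left_mono) simp
  then show ?thesis
    by (simp add: dgen_ugen sqmass_def zz klap_def sum_distrib_left mult_ac)
qed

text \<open>With the partial sums \<open>S m\<close> of \<open>\<nu>\<close> and \<open>M = S N\<close>, the function below is
  \<open>N \<Sum> \<nu> k\<^sup>2\<close> plus the sum of \<open>\<nu> j * \<nu> k * (N - (k - j))\<close> over \<open>j < k\<close>, written so that an edge
  \<open>m\<close> affects one summand only.
  It measures how long two conditionally independent copies of the discrepancy stay together.\<close>

definition psum :: "(nat \<Rightarrow> real) \<Rightarrow> nat \<Rightarrow> real" where
  "psum \<nu> m = (\<Sum>k\<in>{1..m}. \<nu> k)"

definition meet :: "nat \<Rightarrow> (nat \<Rightarrow> real) \<Rightarrow> real" where
  "meet N \<nu> = real N / 2 * (\<Sum>k\<in>{1..N}. (\<nu> k)\<^sup>2) + real N / 2 * (psum \<nu> N)\<^sup>2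
     - (\<Sum>m\<in>{1..<N}. psum \<nu> m * (psum \<nu> N - psum \<nu> m))"

definition meetF :: "nat \<Rightarrow> dstate \<Rightarrow> real" where
  "meetF N = (\<lambda>(\<beta>, \<zeta>, \<nu>). meet N \<nu>)"

lemma psum_swp:
  assumes "i \<in> {1..<N}" "m \<le> N"
  shows "psum (swp i \<nu>) m = psum \<nu> m + (if m = i then \<nu> (i + 1) - \<nu> i else 0)"
proof (cases "i < m")
  case True
  have "(\<Sum>k\<in>{1..m}. (swp i \<nu>) k) = (\<Sum>k\<in>{1..m}. \<nu> k)"
    using sum_swp_apply[of i m \<nu>] assms True by simp
  then show ?thesis using True by (simp add: psum_def)
next
  case False
  show ?thesis
  proof (cases "m = i")
    case True
    have "(\<Sum>k\<in>{1..<i}. swp i \<nu> k) = (\<Sum>k\<in>{1..<i}. \<nu> k)" by (intro sum.cong) (auto simp: swp_def)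
    moreover have "{1..i} = insert i {1..<i}" using assms by auto
    ultimately show ?thesis using True by (simp add: psum_def)
  next
    case False
    then have "(\<Sum>k\<in>{1..m}. swp i \<nu> k) = (\<Sum>k\<in>{1..m}. \<nu> k)"
      using \<open>\<not> i < m\<close> by (intro sum.cong) (auto simp: swp_def)
    then show ?thesis using False by (simp add: psum_def)
  qed
qed

lemma psum_avg:
  assumes "i \<in> {1..<N}" "m \<le> N"
  shows "psum (avg i \<nu>) m = psum \<nu> m + (if m = i then (\<nu> (i + 1) - \<nu> i) / 2 else 0)"
proof -
  have "psum (avg i \<nu>) m = (psum \<nu> m + psum (swp i \<nu>) m) / 2"
    by (simp add: psum_def avg_def sum_divide_distrib[symmetric] sum.distrib)
  then show ?thesis unfolding psum_swp[OF assms] by (auto simp: field_simps)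
qed

lemma sum_change_one:
  fixes f g :: "nat \<Rightarrow> real"
  assumes "i \<in> A" "finite A" "\<And>m. m \<in> A \<Longrightarrow> m \<noteq> i \<Longrightarrow> f m = g m"
  shows "(\<Sum>m\<in>A. f m) = (\<Sum>m\<in>A. g m) + f i - g i"
  using assms by (simp add: sum.remove[of A i])

lemma meet_shift:
  assumes i: "i \<in> {1..<N}" and ps: "\<And>m. m \<le> N \<Longrightarrow> psum \<mu> m = psum \<nu> m + (if m = i then \<delta> else 0)"
  shows "meet N \<mu> - meet N \<nu> = real N / 2 * ((\<Sum>k\<in>{1..N}. (\<mu> k)\<^sup>2) - (\<Sum>k\<in>{1..N}. (\<nu> k)\<^sup>2))
    + \<delta> * (2 * psum \<nu> i - psum \<nu> N) + \<delta>\<^sup>2"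
proof -
  have N: "psum \<mu> N = psum \<nu> N" using ps[of N] i by auto
  have "(\<Sum>m\<in>{1..<N}. psum \<mu> m * (psum \<mu> N - psum \<mu> m)) =
      (\<Sum>m\<in>{1..<N}. psum \<nu> m * (psum \<nu> N - psum \<nu> m)) + (psum \<nu> i + \<delta>) * (psum \<nu> N - (psum \<nu> i + \<delta>))
      - psum \<nu> i * (psum \<nu> N - psum \<nu> i)"
    using i ps N by (subst sum_change_one[OF i, where g = "\<lambda>m. psum \<nu> m * (psum \<nu> N - psum \<nu> m)"]) auto
  then show ?thesis by (simp add: meet_def N power2_eq_square algebra_simps)
qed

lemma sum_sq_swp: "i \<in> {1..<N} \<Longrightarrow> (\<Sum>k\<in>{1..N}. (swp i \<nu> k)\<^sup>2) = (\<Sum>k\<in>{1..N}. (\<nu> k :: real)\<^sup>2)"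
  using sum_swp[of i N "\<lambda>k. (\<nu> k)\<^sup>2"] by (simp add: swp_eq)

lemma sum_sq_avg:
  assumes i: "i \<in> {1..<N}"
  shows "(\<Sum>k\<in>{1..N}. (avg i \<nu> k)\<^sup>2) = (\<Sum>k\<in>{1..N}. (\<nu> k)\<^sup>2) - (\<nu> (i + 1) - \<nu> i)\<^sup>2 / 2"
proof -
  have "(\<Sum>k\<in>{1..N}. (\<nu> k - swp i \<nu> k)\<^sup>2) =
      (\<Sum>k\<in>{1..N}. (if k = i then (\<nu> (i + 1) - \<nu> i)\<^sup>2 else 0) + (if k = i + 1 then (\<nu> (i + 1) - \<nu> i)\<^sup>2 else 0))"
    by (intro sum.cong refl) (auto simp: swp_def power2_eq_square algebra_simps)
  also have "\<dots> = 2 * (\<nu> (i + 1) - \<nu> i)\<^sup>2" using i by (simp add: sum.distrib)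
  finally have d: "(\<Sum>k\<in>{1..N}. (\<nu> k - swp i \<nu> k)\<^sup>2) = 2 * (\<nu> (i + 1) - \<nu> i)\<^sup>2" .
  have "(\<Sum>k\<in>{1..N}. (avg i \<nu> k)\<^sup>2) =
      (\<Sum>k\<in>{1..N}. (\<nu> k)\<^sup>2 / 2 + (swp i \<nu> k)\<^sup>2 / 2 - (\<nu> k - swp i \<nu> k)\<^sup>2 / 4)"
    by (intro sum.cong refl) (simp add: avg_def power2_eq_square field_simps)
  also have "\<dots> = (\<Sum>k\<in>{1..N}. (\<nu> k)\<^sup>2) / 2 + (\<Sum>k\<in>{1..N}. (swp i \<nu> k)\<^sup>2) / 2
      - (\<Sum>k\<in>{1..N}. (\<nu> k - swp i \<nu> k)\<^sup>2) / 4"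
    by (simp add: sum.distrib sum_subtractf sum_divide_distrib)
  finally show ?thesis unfolding d sum_sq_swp[OF i] by simp
qed

text \<open>Summation by parts, with \<open>\<nu> (m + 1)\<close> as increment of the partial sums.
  For \<open>M = psum \<nu> n\<close> the two boundary terms are \<open>M\<close> times the end
  values of \<open>\<nu>\<close>, which the killing in \<open>meet_left\<close> and
  \<open>meet_right\<close> pays for.\<close>

lemma sum_drift:
  fixes \<nu> :: "nat \<Rightarrow> real"
  shows "1 \<le> n \<Longrightarrow> (\<Sum>m\<in>{1..<n}. (\<nu> (m + 1) - \<nu> m) * (2 * psum \<nu> m - M)) =
    \<nu> n * (2 * psum \<nu> n - M) - 2 * (\<Sum>k\<in>{1..n}. (\<nu> k)\<^sup>2) + M * \<nu> 1"
proof (induction n rule: nat_induct_at_least)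
  case base
  show ?case by (simp add: psum_def power2_eq_square algebra_simps)
next
  case (Suc n)
  have "psum \<nu> (Suc n) = psum \<nu> n + \<nu> (Suc n)" by (simp add: psum_def)
  with Suc show ?case by (simp add: power2_eq_square algebra_simps)
qed

lemma psum_mono: "(\<And>k. 0 \<le> \<nu> k) \<Longrightarrow> m \<le> n \<Longrightarrow> psum \<nu> m \<le> psum \<nu> n"
  unfolding psum_def by (intro sum_mono2) auto

lemma psum_nonneg: "(\<And>k. 0 \<le> \<nu> k) \<Longrightarrow> 0 \<le> psum \<nu> m"
  unfolding psum_def by (intro sum_nonneg) auto

text \<open>Removing the mass at site 1 shifts every partial sum by \<open>\<nu> 1\<close>. The
  partial sums are at least \<open>\<nu> 1\<close>, which leaves the multiple \<open>N - 1\<close>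
  of its square as an additional gain.\<close>

lemma meet_left:
  assumes N: "1 \<le> N" and \<nu>: "\<And>k. 0 \<le> \<nu> k"
  shows "meet N (\<nu>(1 := 0)) - meet N \<nu> \<le> - psum \<nu> N * \<nu> 1 - (real N - 1) * (\<nu> 1)\<^sup>2"
proof -
  have ps: "psum (\<nu>(1 := 0)) m = psum \<nu> m - \<nu> 1" if "1 \<le> m" for m
    using that sum_fun_upd[of "{1..m}" 1 "\<lambda>k x. x" \<nu> 0] by (simp add: psum_def)
  have V: "(\<Sum>k\<in>{1..N}. ((\<nu>(1 := 0)) k)\<^sup>2) = (\<Sum>k\<in>{1..N}. (\<nu> k)\<^sup>2) - (\<nu> 1)\<^sup>2"
    using N sum_fun_upd[of "{1..N}" 1 "\<lambda>k x. x\<^sup>2" \<nu> 0] by simp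
  have "(\<Sum>m\<in>{1..<N}. psum (\<nu>(1 := 0)) m * (psum (\<nu>(1 := 0)) N - psum (\<nu>(1 := 0)) m)) =
      (\<Sum>m\<in>{1..<N}. psum \<nu> m * (psum \<nu> N - psum \<nu> m) - \<nu> 1 * (psum \<nu> N - psum \<nu> m))"
  proof (intro sum.cong refl)
    fix m assume "m \<in> {1..<N}"
    then have m: "psum (\<nu>(1 := 0)) m = psum \<nu> m - \<nu> 1" using ps by simp
    show "psum (\<nu>(1 := 0)) m * (psum (\<nu>(1 := 0)) N - psum (\<nu>(1 := 0)) m) =
        psum \<nu> m * (psum \<nu> N - psum \<nu> m) - \<nu> 1 * (psum \<nu> N - psum \<nu> m)"
      unfolding m ps[OF N] by (simp add: algebra_simps)
  qed
  then have d: "(\<Sum>m\<in>{1..<N}. psum \<nu> m * (psum \<nu> N - psum \<nu> m)) -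
      (\<Sum>m\<in>{1..<N}. psum (\<nu>(1 := 0)) m * (psum (\<nu>(1 := 0)) N - psum (\<nu>(1 := 0)) m)) =
      (\<Sum>m\<in>{1..<N}. \<nu> 1 * (psum \<nu> N - psum \<nu> m))"
    by (simp add: sum_subtractf)
  also have "\<dots> \<le> (\<Sum>m\<in>{1..<N}. \<nu> 1 * (psum \<nu> N - \<nu> 1))"
  proof (intro sum_mono mult_left_mono diff_left_mono \<nu>)
    fix m assume "m \<in> {1..<N}"
    then show "\<nu> 1 \<le> psum \<nu> m" using psum_mono[OF \<nu>, of 1 m] by (simp add: psum_def)
  qed
  also have "\<dots> = (real N - 1) * (\<nu> 1 * (psum \<nu> N - \<nu> 1))" using N by (simp add: of_nat_diff)
  finally show ?thesis unfolding meet_def V ps[OF N]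
    by (simp add: power2_eq_square algebra_simps)
qed

lemma meet_right:
  assumes N: "1 \<le> N" and \<nu>: "\<And>k. 0 \<le> \<nu> k"
  shows "meet N (\<nu>(N := 0)) - meet N \<nu> \<le> - psum \<nu> N * \<nu> N - (real N - 1) * (\<nu> N)\<^sup>2"
proof -
  have ps: "psum (\<nu>(N := 0)) m = psum \<nu> m" if "m < N" for m
    unfolding psum_def using that by (intro sum.cong) auto
  have psN: "psum (\<nu>(N := 0)) N = psum \<nu> N - \<nu> N"
    using N sum_fun_upd[of "{1..N}" N "\<lambda>k x. x" \<nu> 0] by (simp add: psum_def)
  have V: "(\<Sum>k\<in>{1..N}. ((\<nu>(N := 0)) k)\<^sup>2) = (\<Sum>k\<in>{1..N}. (\<nu> k)\<^sup>2) - (\<nu> N)\<^sup>2"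
    using N sum_fun_upd[of "{1..N}" N "\<lambda>k x. x\<^sup>2" \<nu> 0] by simp
  have "(\<Sum>m\<in>{1..<N}. psum (\<nu>(N := 0)) m * (psum (\<nu>(N := 0)) N - psum (\<nu>(N := 0)) m)) =
      (\<Sum>m\<in>{1..<N}. psum \<nu> m * (psum \<nu> N - psum \<nu> m) - \<nu> N * psum \<nu> m)"
  proof (intro sum.cong refl)
    fix m assume "m \<in> {1..<N}"
    then have m: "psum (\<nu>(N := 0)) m = psum \<nu> m" using ps by simp
    show "psum (\<nu>(N := 0)) m * (psum (\<nu>(N := 0)) N - psum (\<nu>(N := 0)) m) =
        psum \<nu> m * (psum \<nu> N - psum \<nu> m) - \<nu> N * psum \<nu> m"
      unfolding m psN by (simp add: algebra_simps)
  qed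
  then have d: "(\<Sum>m\<in>{1..<N}. psum \<nu> m * (psum \<nu> N - psum \<nu> m)) -
      (\<Sum>m\<in>{1..<N}. psum (\<nu>(N := 0)) m * (psum (\<nu>(N := 0)) N - psum (\<nu>(N := 0)) m)) =
      (\<Sum>m\<in>{1..<N}. \<nu> N * psum \<nu> m)"
    by (simp add: sum_subtractf)
  also have "\<dots> \<le> (\<Sum>m\<in>{1..<N}. \<nu> N * (psum \<nu> N - \<nu> N))"
  proof (intro sum_mono mult_left_mono \<nu>)
    fix m assume m: "m \<in> {1..<N}"
    have "{1..N} = insert N {1..N - 1}" using N by auto
    then have "psum \<nu> N = \<nu> N + psum \<nu> (N - 1)" unfolding psum_def using N by (subst \<open>{1..N} = _\<close>) auto
    then show "psum \<nu> m \<le> psum \<nu> N - \<nu> N" using psum_mono[of \<nu> m "N - 1"] \<nu> m by force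
  qed
  also have "\<dots> = (real N - 1) * (\<nu> N * (psum \<nu> N - \<nu> N))" using N by (simp add: of_nat_diff)
  finally show ?thesis unfolding meet_def V psN
    by (simp add: power2_eq_square algebra_simps)
qed

text \<open>The square of \<open>\<nu> m\<close> weighs two copies that sit together at
  \<open>m\<close>; each neighbour in the environment is an opportunity for them to
  separate.\<close>

definition contact :: "nat \<Rightarrow> dstate \<Rightarrow> real" where
  "contact N = (\<lambda>(\<beta>, \<zeta>, \<nu>). \<Sum>m\<in>{1..<N}. (\<nu> m)\<^sup>2 * real (\<beta> (m + 1)) + (\<nu> (m + 1))\<^sup>2 * real (\<beta> m))"

text \<open>A swap across the border of the environment adds \<open>?d\<close> squared, which equals
  the sum of the two squares since one of them vanishes. If every edge did so, these terms would
  cancel the negative squares of \<open>sum_drift\<close>. Edges inside the environment do not, and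
  the deficit is exactly \<open>contact\<close>.\<close>

lemma ugen_meetF_le:
  assumes N: "1 \<le> N" and z: "z \<in> dstates N"
  shows "ugen N q (meetF N) z \<le> - contact N z"
proof -
  obtain \<beta> \<zeta> \<nu> where zz: "z = (\<beta>, \<zeta>, \<nu>)" by (cases z)
  have \<nu>: "0 \<le> \<nu> k" for k using z by (auto simp: zz dstates_def)
  have \<beta>: "\<beta> \<in> configs N" using z by (auto simp: zz dstates_def)
  have \<nu>0: "\<nu> k = 0" if "k \<in> {1..N}" "\<beta> k \<noteq> 1" for k
    using z that configs_01[OF \<beta> that(1)] by (auto simp: zz dstates_def)
  define M where "M = psum \<nu> N"
  have edge: "edge_gen m (meetF N) z \<le> (\<nu> (m + 1) - \<nu> m) * (2 * psum \<nu> m - M)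
      + ((\<nu> m)\<^sup>2 + (\<nu> (m + 1))\<^sup>2) - ((\<nu> m)\<^sup>2 * real (\<beta> (m + 1)) + (\<nu> (m + 1))\<^sup>2 * real (\<beta> m))"
    if m: "m \<in> {1..<N}" for m
  proof (cases "\<beta> m = 1 \<and> \<beta> (m + 1) = 1")
    case True
    let ?d = "\<nu> (m + 1) - \<nu> m"
    have "meet N (avg m \<nu>) - meet N \<nu> = real N / 2 * (- (?d\<^sup>2 / 2)) + ?d / 2 * (2 * psum \<nu> m - psum \<nu> N) + (?d / 2)\<^sup>2"
      using meet_shift[OF m psum_avg[OF m]] sum_sq_avg[OF m, of \<nu>] by simp
    then have "2 * (meet N (avg m \<nu>) - meet N \<nu>) = ?d * (2 * psum \<nu> m - M) - (real N - 1) / 2 * ?d\<^sup>2"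
      by (simp add: M_def power2_eq_square field_simps)
    moreover have "0 \<le> (real N - 1) / 2 * ?d\<^sup>2" using N by simp
    ultimately show ?thesis using True by (simp add: edge_gen_def meetF_def zz)
  next
    case False
    let ?d = "\<nu> (m + 1) - \<nu> m"
    have mm: "m \<in> {1..N}" "m + 1 \<in> {1..N}" using m by auto
    have "\<nu> m * \<nu> (m + 1) = 0" using False \<nu>0[OF mm(1)] \<nu>0[OF mm(2)] by auto
    then have d2: "?d\<^sup>2 = (\<nu> m)\<^sup>2 + (\<nu> (m + 1))\<^sup>2" by (simp add: power2_eq_square algebra_simps)
    have c0: "(\<nu> m)\<^sup>2 * real (\<beta> (m + 1)) + (\<nu> (m + 1))\<^sup>2 * real (\<beta> m) = 0"
      using False \<nu>0[OF mm(1)] \<nu>0[OF mm(2)] configs_01[OF \<beta> mm(1)] configs_01[OF \<beta> mm(2)] by auto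
    have "meet N (swp m \<nu>) - meet N \<nu> = ?d * (2 * psum \<nu> m - psum \<nu> N) + ?d\<^sup>2"
      using meet_shift[OF m psum_swp[OF m]] sum_sq_swp[OF m, of \<nu>] by simp
    then show ?thesis using False unfolding c0 d2
      by (auto simp: edge_gen_def meetF_def zz M_def)
  qed
  have "(\<Sum>m\<in>{1..<N}. edge_gen m (meetF N) z) \<le> (\<Sum>m\<in>{1..<N}. (\<nu> (m + 1) - \<nu> m) * (2 * psum \<nu> m - M)
      + ((\<nu> m)\<^sup>2 + (\<nu> (m + 1))\<^sup>2) - ((\<nu> m)\<^sup>2 * real (\<beta> (m + 1)) + (\<nu> (m + 1))\<^sup>2 * real (\<beta> m)))"
    by (rule sum_mono[OF edge])
  also have "\<dots> = (\<nu> N * M - 2 * (\<Sum>k\<in>{1..N}. (\<nu> k)\<^sup>2) + M * \<nu> 1)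
      + (\<Sum>m\<in>{1..<N}. (\<nu> m)\<^sup>2 + (\<nu> (m + 1))\<^sup>2) - contact N z"
    using sum_drift[OF N, of \<nu> M] unfolding sum.distrib sum_subtractf
    by (simp add: contact_def zz M_def sum.distrib)
  also have "(\<Sum>m\<in>{1..<N}. (\<nu> m)\<^sup>2 + (\<nu> (m + 1))\<^sup>2) = 2 * (\<Sum>k\<in>{1..N}. (\<nu> k)\<^sup>2) - (\<nu> 1)\<^sup>2 - (\<nu> N)\<^sup>2"
    using N by (induction N rule: nat_induct_at_least) (auto simp: algebra_simps)
  finally have e0: "(\<Sum>m\<in>{1..<N}. edge_gen m (meetF N) z) \<le> (\<nu> N * M - 2 * (\<Sum>k\<in>{1..N}. (\<nu> k)\<^sup>2) + M * \<nu> 1)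
      + (2 * (\<Sum>k\<in>{1..N}. (\<nu> k)\<^sup>2) - (\<nu> 1)\<^sup>2 - (\<nu> N)\<^sup>2) - contact N z" .
  have "0 \<le> (\<nu> 1)\<^sup>2" "0 \<le> (\<nu> N)\<^sup>2" by (rule zero_le_power2)+
  with e0 have e: "(\<Sum>m\<in>{1..<N}. edge_gen m (meetF N) z) \<le> M * \<nu> 1 + M * \<nu> N - contact N z"
    unfolding mult.commute[of "\<nu> N" M] by linarith
  have "bdry_gen N q (meetF N) z = (meet N (\<nu>(1 := 0)) - meet N \<nu>) + (meet N (\<nu>(N := 0)) - meet N \<nu>)"
    by (simp add: bdry_gen_def meetF_def zz algebra_simps)
  also have "\<dots> \<le> - M * \<nu> 1 - M * \<nu> N"
  proof -
    have "0 \<le> (real N - 1) * (\<nu> 1)\<^sup>2" "0 \<le> (real N - 1) * (\<nu> N)\<^sup>2" using N by simp_all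
    then show ?thesis
      using meet_left[OF N, of \<nu>, OF \<nu>] meet_right[OF N, of \<nu>, OF \<nu>] unfolding M_def by linarith
  qed
  finally show ?thesis unfolding ugen_def using e by simp
qed

lemma meet_bounds:
  assumes \<nu>: "\<And>k. 0 \<le> \<nu> k" and le: "(\<Sum>k\<in>{1..N}. \<nu> k) \<le> 1"
  shows "0 \<le> meet N \<nu>" "meet N \<nu> \<le> real N"
proof -
  define M where "M = psum \<nu> N"
  have M: "0 \<le> M" "M \<le> 1" using psum_nonneg[OF \<nu>] le by (auto simp: M_def psum_def)
  have S: "0 \<le> psum \<nu> m" "psum \<nu> m \<le> M" if "m \<in> {1..<N}" for m
    using that psum_nonneg[OF \<nu>] psum_mono[OF \<nu>, of m N] by (auto simp: M_def)
  have "(\<Sum>m\<in>{1..<N}. psum \<nu> m * (M - psum \<nu> m)) \<le> (\<Sum>m\<in>{1..<N}. M\<^sup>2 / 2)"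
  proof (rule sum_mono)
    fix m show "psum \<nu> m * (M - psum \<nu> m) \<le> M\<^sup>2 / 2"
    proof -
      have "M\<^sup>2 / 2 - psum \<nu> m * (M - psum \<nu> m) = (M\<^sup>2 + (M - 2 * psum \<nu> m)\<^sup>2) / 4"
        by (simp add: power2_eq_square field_simps)
      also have "0 \<le> \<dots>" by simp
      finally show ?thesis by simp
    qed
  qed
  also have "\<dots> \<le> real N / 2 * M\<^sup>2" by (cases N) (auto intro!: mult_right_mono simp: field_simps)
  finally have "(\<Sum>m\<in>{1..<N}. psum \<nu> m * (M - psum \<nu> m)) \<le> real N / 2 * M\<^sup>2" .
  moreover have "0 \<le> real N / 2 * (\<Sum>k\<in>{1..N}. (\<nu> k)\<^sup>2)" by (intro mult_nonneg_nonneg sum_nonneg) auto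
  ultimately show "0 \<le> meet N \<nu>" by (simp add: meet_def M_def)
  have "(\<Sum>k\<in>{1..N}. (\<nu> k)\<^sup>2) \<le> (\<Sum>k\<in>{1..N}. \<nu> k)"
  proof (rule sum_mono)
    fix k assume "k \<in> {1..N}"
    then have "\<nu> k \<le> 1" using member_le_sum[of k "{1..N}" \<nu>] \<nu> le by auto
    then show "(\<nu> k)\<^sup>2 \<le> \<nu> k" using \<nu>[of k] by (simp add: power2_eq_square mult_left_le)
  qed
  then have "real N / 2 * (\<Sum>k\<in>{1..N}. (\<nu> k)\<^sup>2) \<le> real N / 2 * 1" using le by (intro mult_left_mono) auto
  moreover have "real N / 2 * M\<^sup>2 \<le> real N / 2 * 1" using M by (intro mult_left_mono power_le_one) auto
  moreover have "0 \<le> (\<Sum>m\<in>{1..<N}. psum \<nu> m * (M - psum \<nu> m))"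
    using S by (intro sum_nonneg mult_nonneg_nonneg) auto
  ultimately show "meet N \<nu> \<le> real N" by (simp add: meet_def M_def)
qed

section \<open>Potential of the holes near the discrepancy\<close>

definition gap :: "nat \<Rightarrow> nat \<Rightarrow> real" where
  "gap l d = (if d \<le> l then real l - real d else 0)"

text \<open>A discrete version of \<open>(l - d)\<^sup>2 / 2\<close>. The value at \<open>d = 0\<close> makes exclusion and independent
  motion of a pair agree.\<close>

definition ker :: "nat \<Rightarrow> nat \<Rightarrow> real" where
  "ker l d = gap l (max d 1) * (gap l (max d 1) + 1) / 2"

definition gp :: "nat \<Rightarrow> nat \<Rightarrow> nat" where
  "gp i k = (if i \<le> k then k - i else i - k)"

text \<open>Half the drift of \<open>ker\<close> for a moving pair at distance \<open>d\<close>, see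
  \<open>gap_diff\<close>. The weight at distance 1 balances the \<open>l - 1\<close> distances from
  2 to \<open>l\<close>; this trades adjacent environment sites for sites anywhere in the
  window.\<close>

definition wt_hole :: "nat \<Rightarrow> nat \<Rightarrow> real" where
  "wt_hole l d = (if d = 1 then - (real l - 1) else if d \<le> l then 1 else 0)"

lemma gp_sym: "gp i k = gp k i"
  by (auto simp: gp_def)

lemma gap_nonneg: "0 \<le> gap l d"
  by (auto simp: gap_def)

lemma ker_nonneg: "0 \<le> ker l d"
  by (auto simp: ker_def gap_nonneg)

lemma ker_0: "ker l 0 = ker l 1"
  by (simp add: ker_def)

lemma ker_step: "1 \<le> d \<Longrightarrow> ker l d - ker l (d + 1) = gap l d"
proof -
  assume d: "1 \<le> d"
  consider "d < l" | "d = l" | "l < d" by linarith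
  then show ?thesis
    by cases (use d in \<open>auto simp: ker_def gap_def max_def field_simps\<close>)
qed

lemma gap_le_ker: "1 \<le> d \<Longrightarrow> gap l d \<le> ker l d"
proof -
  assume d: "1 \<le> d"
  show ?thesis
  proof (cases "d < l")
    case True
    then have g: "1 \<le> gap l d" by (auto simp: gap_def)
    have "gap l d * 1 \<le> gap l d * ((gap l d + 1) / 2)"
      using g by (intro mult_left_mono) auto
    then show ?thesis using d by (simp add: ker_def max_def)
  qed (use ker_nonneg[of l d] in \<open>auto simp: gap_def\<close>)
qed

lemma gap_diff:
  assumes "1 \<le> l" "1 \<le> d"
  shows "(if 2 \<le> d then gap l (d - 1) else 0) - gap l d = wt_hole l d"
  using assms by (auto simp: gap_def wt_hole_def of_nat_diff)

lemma ker_le: "ker l d \<le> (if d < l then (real l)\<^sup>2 else 0)"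
proof (cases "d < l")
  case True
  have "gap l (max d 1) \<le> real l - 1" using True by (auto simp: gap_def max_def)
  then have "gap l (max d 1) * (gap l (max d 1) + 1) \<le> real l * real l"
    using gap_nonneg[of l "max d 1"] by (intro mult_mono) auto
  moreover have "0 \<le> real l * real l" by simp
  ultimately have "ker l d \<le> real l * real l" unfolding ker_def by linarith
  then show ?thesis using True by (simp add: power2_eq_square)
next
  case False
  then have "gap l (max d 1) = 0" by (auto simp: gap_def max_def)
  then show ?thesis using False by (simp add: ker_def)
qed

text \<open>If the edge joins \<open>i\<close> and \<open>k\<close>, the joint move keeps distance 1
  while each single move would produce distance 0. Both sides are then 0 because
  \<open>ker l 0 = ker l 1\<close>.\<close>

lemma ker_pair_split:
  assumes "i \<noteq> k"
  shows "ker l (gp (tr e i) (tr e k)) - ker l (gp i k) =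
    (ker l (gp (tr e i) k) - ker l (gp i k)) + (ker l (gp i (tr e k)) - ker l (gp i k))"
proof -
  consider "tr e i = i" | "tr e k = k" | "tr e i = k" "tr e k = i" "gp i k = 1"
    using assms by (cases "i = e"; cases "i = e + 1"; cases "k = e"; cases "k = e + 1")
      (auto simp: tr_def Transposition.transpose_def gp_def)
  then show ?thesis
  proof cases
    case 3
    have "gp k i = gp i k" "gp k k = 0" "gp i i = 0" by (auto simp: gp_def)
    then show ?thesis using 3 ker_0[of l] by simp
  qed auto
qed

definition pair_gen :: "nat \<Rightarrow> nat \<Rightarrow> nat \<Rightarrow> nat \<Rightarrow> real" where
  "pair_gen N l i k = (\<Sum>e\<in>{1..<N}. ker l (gp (tr e i) (tr e k)) - ker l (gp i k))"

lemma pair_gen_sym: "pair_gen N l i k = pair_gen N l k i"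
  unfolding pair_gen_def by (intro sum.cong refl) (simp add: gp_sym)

text \<open>The two sites move like independent walks. A site at the end lacks its outward move,
  which would have contributed \<open>- gap\<close>; the reset there contributes
  \<open>- ker\<close>, which is at least as good by \<open>gap_le_ker\<close>.\<close>

lemma pair_gen_le:
  assumes l: "1 \<le> l" and ik: "i \<in> {1..N}" "k \<in> {1..N}" "i < k"
  shows "pair_gen N l i k - ker l (gp i k) * (if i = 1 \<or> k = 1 then 1 else 0)
    - ker l (gp i k) * (if i = N \<or> k = N then 1 else 0) \<le> 2 * wt_hole l (gp i k)"
proof -
  define d where "d = k - i"
  have d: "1 \<le> d" "gp i k = d" using ik by (auto simp: d_def gp_def)
  have "pair_gen N l i k = (\<Sum>e\<in>{1..<N}. ker l (gp (tr e i) k) - ker l (gp i k))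
      + (\<Sum>e\<in>{1..<N}. ker l (gp i (tr e k)) - ker l (gp i k))"
    unfolding pair_gen_def sum.distrib[symmetric] using ik
    by (intro sum.cong refl ker_pair_split) auto
  also have "\<dots> = ((if i < N then ker l (gp (i + 1) k) - ker l (gp i k) else 0)
      + (if 1 < i then ker l (gp (i - 1) k) - ker l (gp i k) else 0))
      + ((if k < N then ker l (gp i (k + 1)) - ker l (gp i k) else 0)
      + (if 1 < k then ker l (gp i (k - 1)) - ker l (gp i k) else 0))"
    using tr_sum[OF ik(1), of "\<lambda>x. ker l (gp x k)"] tr_sum[OF ik(2), of "\<lambda>x. ker l (gp i x)"] by simp
  finally have Q: "pair_gen N l i k = ((if i < N then ker l (gp (i + 1) k) - ker l (gp i k) else 0)
      + (if 1 < i then ker l (gp (i - 1) k) - ker l (gp i k) else 0))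
      + ((if k < N then ker l (gp i (k + 1)) - ker l (gp i k) else 0)
      + (if 1 < k then ker l (gp i (k - 1)) - ker l (gp i k) else 0))" .
  have g: "gp (i + 1) k = d - 1" "gp i (k - 1) = d - 1" "gp i (k + 1) = d + 1"
    "1 < i \<Longrightarrow> gp (i - 1) k = d + 1" using ik by (auto simp: gp_def d_def)
  have inn: "ker l (d - 1) - ker l d = (if 2 \<le> d then gap l (d - 1) else 0)"
  proof (cases "2 \<le> d")
    case True
    then show ?thesis using ker_step[of "d - 1" l] by simp
  next
    case False
    then have "d = 1" using d by simp
    then show ?thesis using ker_0[of l] by simp
  qed
  have out: "ker l (d + 1) - ker l d = - gap l d" using ker_step[OF d(1), of l] by simp
  have "pair_gen N l i k = 2 * (if 2 \<le> d then gap l (d - 1) else 0)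
      - (if 1 < i then gap l d else 0) - (if k < N then gap l d else 0)"
    unfolding Q d(2) g(1-3) using g(4) ik inn out by (auto simp: d(2))
  moreover have "2 * wt_hole l d = 2 * (if 2 \<le> d then gap l (d - 1) else 0) - 2 * gap l d"
    using gap_diff[OF l d(1)] by simp
  ultimately show ?thesis using gap_le_ker[OF d(1), of l] ker_nonneg[of l d] ik unfolding d(2)
    by auto
qed

lemma sum_wt_hole: "1 \<le> l \<Longrightarrow> (\<Sum>d\<in>{1..n}. wt_hole l d) \<le> 0"
proof -
  assume l: "1 \<le> l"
  have "(\<Sum>d\<in>{1..n}. wt_hole l d) = (if n = 0 then 0 else real (min n l) - real l)"
    by (induction n) (use l in \<open>auto simp: wt_hole_def min_def\<close>)
  then show ?thesis by (auto simp: min_def)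
qed

lemma sum_wt_hole_gp:
  assumes l: "1 \<le> l" and i: "i \<in> {1..N}"
  shows "(\<Sum>k\<in>{1..N} - {i}. wt_hole l (gp i k)) \<le> 0"
proof -
  have eq: "{1..N} - {i} = {i + 1..N} \<union> {1..<i}" using i by auto
  have "(\<Sum>k\<in>{1..N} - {i}. wt_hole l (gp i k)) =
      (\<Sum>k\<in>{i + 1..N}. wt_hole l (gp i k)) + (\<Sum>k\<in>{1..<i}. wt_hole l (gp i k))"
    unfolding eq by (rule sum.union_disjoint) auto
  moreover have "(\<Sum>k\<in>{i + 1..N}. wt_hole l (gp i k)) = (\<Sum>d\<in>{1..N - i}. wt_hole l d)"
    by (rule sum.reindex_bij_witness[of _ "\<lambda>d. i + d" "\<lambda>k. k - i"]) (auto simp: gp_def)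
  moreover have "(\<Sum>k\<in>{1..<i}. wt_hole l (gp i k)) = (\<Sum>d\<in>{1..i - 1}. wt_hole l d)"
    by (rule sum.reindex_bij_witness[of _ "\<lambda>d. i - d" "\<lambda>k. i - k"]) (auto simp: gp_def)
  ultimately show ?thesis using sum_wt_hole[OF l] by (simp add: add_nonpos_nonpos)
qed

text \<open>The window starts at \<open>i + 2\<close> because adjacent sites are accounted for by
  \<open>contact\<close>. Sites to the right of \<open>i\<close> suffice for a lower bound.\<close>

definition win :: "nat \<Rightarrow> nat \<Rightarrow> (nat \<Rightarrow> nat) \<Rightarrow> nat \<Rightarrow> real" where
  "win N l \<beta> i = (\<Sum>k\<in>{1..N}. if i + 2 \<le> k \<and> k \<le> i + l then real (\<beta> k) else 0)"

definition holes :: "nat \<Rightarrow> nat \<Rightarrow> (nat \<Rightarrow> nat) \<Rightarrow> nat \<Rightarrow> real" where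
  "holes N l \<beta> i = (\<Sum>k\<in>{1..N}. (1 - real (\<beta> k)) * ker l (gp i k))"

text \<open>A corrector. \<open>contact\<close> sees nearest neighbours only, whereas the density of
  the environment is controlled on windows. Added to \<open>2 * (l - 1)\<close> times
  \<open>meetF\<close>, it cancels \<open>contact\<close> and leaves the occupation of the
  window.\<close>

definition holeF :: "nat \<Rightarrow> nat \<Rightarrow> dstate \<Rightarrow> real" where
  "holeF N l = (\<lambda>(\<beta>, \<zeta>, \<nu>). \<Sum>i\<in>{1..N}. (\<nu> i)\<^sup>2 * holes N l \<beta> i)"

lemma holes_nonneg: "\<beta> \<in> configs N \<Longrightarrow> 0 \<le> holes N l \<beta> i"
  unfolding holes_def using configs_01[of \<beta> N]
  by (intro sum_nonneg mult_nonneg_nonneg ker_nonneg) fastforce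

lemma holes_swp:
  assumes "e \<in> {1..<N}"
  shows "holes N l (swp e \<beta>) (tr e i) - holes N l \<beta> i =
    (\<Sum>k\<in>{1..N}. (1 - real (\<beta> k)) * (ker l (gp (tr e i) (tr e k)) - ker l (gp i k)))"
proof -
  have "holes N l (swp e \<beta>) (tr e i) = (\<Sum>k\<in>{1..N}. (1 - real (\<beta> k)) * ker l (gp (tr e i) (tr e k)))"
    unfolding holes_def
    using sum_swp[OF assms, of "\<lambda>k. (1 - real (swp e \<beta> k)) * ker l (gp (tr e i) k)"] by simp
  then show ?thesis by (simp add: holes_def right_diff_distrib sum_subtractf)
qed

text \<open>\<open>wt_hole\<close> has sum at most 0, so holes may be replaced by environment sites
  with the opposite sign: neighbours count \<open>l - 1\<close>, the others at most 0, and those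
  left of \<open>i\<close> at distance 2 or more are dropped.\<close>

lemma holes_balance:
  assumes l: "1 \<le> l" and i: "i \<in> {1..N}" and \<beta>: "\<beta> \<in> configs N"
  shows "(\<Sum>k\<in>{1..N} - {i}. (1 - real (\<beta> k)) * wt_hole l (gp i k)) \<le>
    (real l - 1) * ((if i < N then real (\<beta> (i + 1)) else 0) + (if 1 < i then real (\<beta> (i - 1)) else 0))
      - win N l \<beta> i"
proof -
  have "(\<Sum>k\<in>{1..N} - {i}. (1 - real (\<beta> k)) * wt_hole l (gp i k)) =
      (\<Sum>k\<in>{1..N} - {i}. wt_hole l (gp i k)) - (\<Sum>k\<in>{1..N} - {i}. real (\<beta> k) * wt_hole l (gp i k))"
    by (simp add: left_diff_distrib sum_subtractf)
  also have "\<dots> \<le> - (\<Sum>k\<in>{1..N} - {i}. real (\<beta> k) * wt_hole l (gp i k))"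
    using sum_wt_hole_gp[OF l i] by simp
  also have "\<dots> = (\<Sum>k\<in>{1..N}. if k = i then 0 else - (real (\<beta> k) * wt_hole l (gp i k)))"
    using i by (simp add: sum_negf sum.If_cases Int_def set_diff_eq)
  also have "\<dots> \<le> (\<Sum>k\<in>{1..N}. (if k = i + 1 then (real l - 1) * real (\<beta> (i + 1)) else 0)
      + (if k = i - 1 then (real l - 1) * real (\<beta> (i - 1)) else 0)
      - (if i + 2 \<le> k \<and> k \<le> i + l then real (\<beta> k) else 0))"
  proof (rule sum_mono)
    fix k assume k: "k \<in> {1..N}"
    show "(if k = i then 0 else - (real (\<beta> k) * wt_hole l (gp i k))) \<le>
        (if k = i + 1 then (real l - 1) * real (\<beta> (i + 1)) else 0)
      + (if k = i - 1 then (real l - 1) * real (\<beta> (i - 1)) else 0)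
      - (if i + 2 \<le> k \<and> k \<le> i + l then real (\<beta> k) else 0)"
    proof -
      consider "k = i" | "k = i + 1" | "i = k + 1" | "k \<noteq> i" "k \<noteq> i + 1" "i \<noteq> k + 1" by blast
      then show ?thesis
      proof cases
        case 4
        then have "gp i k \<noteq> 1" "k \<noteq> i - 1" using k by (auto simp: gp_def)
        moreover have "0 \<le> real (\<beta> k)" by simp
        moreover have "i + 2 \<le> k \<and> k \<le> i + l \<Longrightarrow> gp i k \<le> l" by (auto simp: gp_def)
        ultimately show ?thesis using 4 by (auto simp: wt_hole_def)
      qed (use k i in \<open>auto simp: wt_hole_def gp_def algebra_simps\<close>)
    qed
  qed
  also have "\<dots> = (real l - 1) * ((if i < N then real (\<beta> (i + 1)) else 0) + (if 1 < i then real (\<beta> (i - 1)) else 0))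
      - win N l \<beta> i"
  proof -
    have "(\<Sum>k\<in>{1..N}. if k = i - 1 then (real l - 1) * real (\<beta> (i - 1)) else 0) =
        (real l - 1) * (if 1 < i then real (\<beta> (i - 1)) else 0)" using i by auto
    moreover have "(\<Sum>k\<in>{1..N}. if k = i + 1 then (real l - 1) * real (\<beta> (i + 1)) else 0) =
        (real l - 1) * (if i < N then real (\<beta> (i + 1)) else 0)" by auto
    ultimately show ?thesis
      unfolding sum.distrib sum_subtractf win_def by (simp add: distrib_left)
  qed
  finally show ?thesis .
qed

lemma contact_eq:
  "contact N (\<beta>, \<zeta>, \<nu>) = (\<Sum>i\<in>{1..N}. (\<nu> i)\<^sup>2 *
    ((if i < N then real (\<beta> (i + 1)) else 0) + (if 1 < i then real (\<beta> (i - 1)) else 0)))"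
proof -
  have "(\<Sum>i\<in>{1..N}. (\<nu> i)\<^sup>2 * (if i < N then real (\<beta> (i + 1)) else 0)) =
      (\<Sum>i\<in>{1..<N}. (\<nu> i)\<^sup>2 * real (\<beta> (i + 1)))"
    by (rule sum.mono_neutral_cong_right) auto
  moreover have "(\<Sum>i\<in>{1..N}. (\<nu> i)\<^sup>2 * (if 1 < i then real (\<beta> (i - 1)) else 0)) =
      (\<Sum>i\<in>{2..N}. (\<nu> i)\<^sup>2 * real (\<beta> (i - 1)))"
    by (rule sum.mono_neutral_cong_right) auto
  moreover have "(\<Sum>i\<in>{2..N}. (\<nu> i)\<^sup>2 * real (\<beta> (i - 1))) = (\<Sum>m\<in>{1..<N}. (\<nu> (m + 1))\<^sup>2 * real (\<beta> m))"
    by (rule sum.reindex_bij_witness[of _ "\<lambda>m. m + 1" "\<lambda>i. i - 1"]) auto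
  ultimately show ?thesis by (simp add: contact_def distrib_left sum.distrib)
qed

text \<open>By convexity the mass at \<open>i\<close> and a hole at \<open>k\<close> move as a pair
  in the exclusion process. The left reservoir fills holes and the right one creates them at
  \<open>N\<close>, hence the last sum.\<close>

lemma ugen_holeF_le:
  assumes l: "1 \<le> l" and N: "1 \<le> N" and z: "(\<beta>, \<zeta>, \<nu>) \<in> dstates N"
  shows "ugen N q (holeF N l) (\<beta>, \<zeta>, \<nu>) \<le> 2 * ((real l - 1) * contact N (\<beta>, \<zeta>, \<nu>)
    - (\<Sum>i\<in>{1..N}. (\<nu> i)\<^sup>2 * win N l \<beta> i)) + (\<Sum>i\<in>{1..<N}. (\<nu> i)\<^sup>2 * ker l (N - i))"
proof -
  let ?z = "(\<beta>, \<zeta>, \<nu>)"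
  have \<beta>: "\<beta> \<in> configs N" using z by (auto simp: dstates_def)
  define w where "w = (\<lambda>i k. (\<nu> i)\<^sup>2 * (1 - real (\<beta> k)))"
  have w: "0 \<le> w i k" if "k \<in> {1..N}" for i k
    using configs_01[OF \<beta> that] by (auto simp: w_def)
  \<comment> \<open>A site that carries mass belongs to the environment and is not a hole, so the
    diagonal \<open>k = i\<close> drops out.\<close>
  have w0: "w i i = 0" if "i \<in> {1..N}" for i
    using configs_01[OF \<beta> that] z that by (auto simp: w_def dstates_def)
  have "edge_gen e (holeF N l) ?z \<le> (\<Sum>i\<in>{1..N}. (\<nu> i)\<^sup>2 * (holes N l (swp e \<beta>) (tr e i) - holes N l \<beta> i))"
    if "e \<in> {1..<N}" for e
    unfolding holeF_def by (rule edge_gen_convex[where U = "holes N l", OF that holes_nonneg[OF \<beta>]])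
  then have "(\<Sum>e\<in>{1..<N}. edge_gen e (holeF N l) ?z) \<le>
      (\<Sum>e\<in>{1..<N}. \<Sum>i\<in>{1..N}. (\<nu> i)\<^sup>2 * (holes N l (swp e \<beta>) (tr e i) - holes N l \<beta> i))"
    by (rule sum_mono)
  also have "\<dots> = (\<Sum>e\<in>{1..<N}. \<Sum>i\<in>{1..N}. \<Sum>k\<in>{1..N}. w i k * (ker l (gp (tr e i) (tr e k)) - ker l (gp i k)))"
    by (intro sum.cong refl) (simp add: holes_swp sum_distrib_left w_def mult_ac)
  also have "\<dots> = (\<Sum>i\<in>{1..N}. \<Sum>k\<in>{1..N}. w i k * pair_gen N l i k)"
    unfolding pair_gen_def sum_distrib_left
    by (subst sum.swap, rule sum.cong[OF refl], subst sum.swap, rule refl)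
  finally have edges: "(\<Sum>e\<in>{1..<N}. edge_gen e (holeF N l) ?z) \<le> (\<Sum>i\<in>{1..N}. \<Sum>k\<in>{1..N}. w i k * pair_gen N l i k)" .
  have hF: "holeF N l (b, z', v) = (\<Sum>i\<in>{1..N}. \<Sum>k\<in>{1..N}. (v i)\<^sup>2 * (1 - real (b k)) * ker l (gp i k))" for b z' v
    by (simp add: holeF_def holes_def sum_distrib_left mult.assoc)
  have left: "holeF N l (\<beta>(1 := 1), \<zeta>, \<nu>(1 := 0)) - holeF N l ?z =
      (\<Sum>i\<in>{1..N}. \<Sum>k\<in>{1..N}. - (w i k * (ker l (gp i k) * (if i = 1 \<or> k = 1 then 1 else 0))))"
    unfolding hF sum_subtractf[symmetric] by (intro sum.cong refl) (auto simp: w_def)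
  \<comment> \<open>The reset at \<open>N\<close> kills the pairs that involve \<open>N\<close>, but
    it also turns \<open>N\<close> into a hole for all other sites.\<close>
  have right: "holeF N l (\<beta>(N := 0), \<zeta>', \<nu>(N := 0)) - holeF N l ?z =
      (\<Sum>i\<in>{1..N}. \<Sum>k\<in>{1..N}. - (w i k * (ker l (gp i k) * (if i = N \<or> k = N then 1 else 0)))
        + (if i \<noteq> N \<and> k = N then (\<nu> i)\<^sup>2 * ker l (gp i N) else 0))" for \<zeta>'
    unfolding hF sum_subtractf[symmetric] by (intro sum.cong refl) (auto simp: w_def)
  have src: "(\<Sum>i\<in>{1..N}. \<Sum>k\<in>{1..N}. if i \<noteq> N \<and> k = N then (\<nu> i)\<^sup>2 * ker l (gp i N) else 0) =
      (\<Sum>i\<in>{1..<N}. (\<nu> i)\<^sup>2 * ker l (N - i))"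
  proof -
    have "(\<Sum>i\<in>{1..N}. \<Sum>k\<in>{1..N}. if i \<noteq> N \<and> k = N then (\<nu> i)\<^sup>2 * ker l (gp i N) else 0) =
        (\<Sum>i\<in>{1..N}. if i \<noteq> N then (\<nu> i)\<^sup>2 * ker l (gp i N) else 0)"
      using N by (intro sum.cong refl) auto
    also have "\<dots> = (\<Sum>i\<in>{1..<N}. (\<nu> i)\<^sup>2 * ker l (N - i))"
      by (rule sum.mono_neutral_cong_right) (auto simp: gp_def)
    finally show ?thesis .
  qed
  have bd: "bdry_gen N q (holeF N l) ?z = (holeF N l (\<beta>(1 := 1), \<zeta>, \<nu>(1 := 0)) - holeF N l ?z)
      + (holeF N l (\<beta>(N := 0), \<zeta>, \<nu>(N := 0)) - holeF N l ?z)"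
  proof -
    have e: "holeF N l (\<beta>(N := 0), \<zeta>(N := v), \<nu>(N := 0)) = holeF N l (\<beta>(N := 0), \<zeta>, \<nu>(N := 0))" for v
      by (simp add: holeF_def)
    show ?thesis unfolding bdry_gen_def prod.case e by (simp add: algebra_simps)
  qed
  have "ugen N q (holeF N l) ?z \<le> (\<Sum>i\<in>{1..N}. \<Sum>k\<in>{1..N}. w i k * (pair_gen N l i k
      - ker l (gp i k) * (if i = 1 \<or> k = 1 then 1 else 0) - ker l (gp i k) * (if i = N \<or> k = N then 1 else 0)))
      + (\<Sum>i\<in>{1..<N}. (\<nu> i)\<^sup>2 * ker l (N - i))"
    unfolding ugen_def bd left right using edges src
    by (simp add: sum.distrib right_diff_distrib sum_subtractf sum_negf)
  also have "(\<Sum>i\<in>{1..N}. \<Sum>k\<in>{1..N}. w i k * (pair_gen N l i k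
      - ker l (gp i k) * (if i = 1 \<or> k = 1 then 1 else 0) - ker l (gp i k) * (if i = N \<or> k = N then 1 else 0)))
      \<le> (\<Sum>i\<in>{1..N}. \<Sum>k\<in>{1..N}. if k = i then 0 else w i k * (2 * wt_hole l (gp i k)))"
  proof (intro sum_mono)
    fix i k assume ik: "i \<in> {1..N}" "k \<in> {1..N}"
    have "pair_gen N l i k
      - ker l (gp i k) * (if i = 1 \<or> k = 1 then 1 else 0) - ker l (gp i k) * (if i = N \<or> k = N then 1 else 0)
      \<le> 2 * wt_hole l (gp i k)" if "i \<noteq> k"
      using pair_gen_le[OF l ik] pair_gen_le[OF l ik(2,1)] that
      by (cases "i < k") (auto simp: gp_sym[of k i] pair_gen_sym[of N l k i])
    then show "w i k * (pair_gen N l i k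
      - ker l (gp i k) * (if i = 1 \<or> k = 1 then 1 else 0) - ker l (gp i k) * (if i = N \<or> k = N then 1 else 0))
      \<le> (if k = i then 0 else w i k * (2 * wt_hole l (gp i k)))"
      using w[OF ik(2), of i] w0[OF ik(1)] by (auto intro!: mult_left_mono)
  qed
  also have "\<dots> = (\<Sum>i\<in>{1..N}. 2 * (\<nu> i)\<^sup>2 * (\<Sum>k\<in>{1..N} - {i}. (1 - real (\<beta> k)) * wt_hole l (gp i k)))"
  proof (intro sum.cong refl)
    fix i assume "i \<in> {1..N}"
    have "(\<Sum>k\<in>{1..N}. if k = i then 0 else w i k * (2 * wt_hole l (gp i k))) =
        (\<Sum>k\<in>{1..N} - {i}. w i k * (2 * wt_hole l (gp i k)))"
      by (rule sum.mono_neutral_cong_right) auto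
    then show "(\<Sum>k\<in>{1..N}. if k = i then 0 else w i k * (2 * wt_hole l (gp i k))) =
        2 * (\<nu> i)\<^sup>2 * (\<Sum>k\<in>{1..N} - {i}. (1 - real (\<beta> k)) * wt_hole l (gp i k))"
      by (simp add: sum_distrib_left w_def mult_ac)
  qed
  also have "\<dots> \<le> (\<Sum>i\<in>{1..N}. 2 * (\<nu> i)\<^sup>2 * ((real l - 1) *
      ((if i < N then real (\<beta> (i + 1)) else 0) + (if 1 < i then real (\<beta> (i - 1)) else 0)) - win N l \<beta> i))"
    by (intro sum_mono mult_left_mono holes_balance[OF l _ \<beta>]) auto
  also have "\<dots> = 2 * ((real l - 1) * contact N ?z - (\<Sum>i\<in>{1..N}. (\<nu> i)\<^sup>2 * win N l \<beta> i))"
    unfolding contact_eq sum_distrib_left sum_subtractf[symmetric]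
    by (intro sum.cong refl) (simp add: algebra_simps)
  finally show ?thesis by simp
qed

lemma holeF_bounds:
  assumes z: "z \<in> dstates N"
  shows "0 \<le> holeF N l z" "holeF N l z \<le> 2 * real l ^ 3"
proof -
  obtain \<beta> \<zeta> \<nu> where zz: "z = (\<beta>, \<zeta>, \<nu>)" by (cases z)
  have \<beta>: "\<beta> \<in> configs N" and \<nu>: "\<And>k. 0 \<le> \<nu> k" and s1: "(\<Sum>k\<in>{1..N}. \<nu> k) \<le> 1"
    using z by (auto simp: zz dstates_def)
  show "0 \<le> holeF N l z" unfolding holeF_def zz prod.case
    by (intro sum_nonneg mult_nonneg_nonneg holes_nonneg \<beta>) auto
  have h: "holes N l \<beta> i \<le> 2 * real l ^ 3" for i
  proof -
    have "holes N l \<beta> i \<le> (\<Sum>k\<in>{1..N}. if gp i k < l then (real l)\<^sup>2 else 0)"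
      unfolding holes_def
    proof (rule sum_mono)
      fix k assume k: "k \<in> {1..N}"
      have "(1 - real (\<beta> k)) * ker l (gp i k) \<le> 1 * ker l (gp i k)"
        using configs_01[OF \<beta> k] by (intro mult_right_mono ker_nonneg) auto
      then show "(1 - real (\<beta> k)) * ker l (gp i k) \<le> (if gp i k < l then (real l)\<^sup>2 else 0)"
        using ker_le[of l "gp i k"] by simp
    qed
    also have "\<dots> = (\<Sum>k\<in>{k \<in> {1..N}. gp i k < l}. (real l)\<^sup>2)"
      by (simp add: sum.If_cases Int_def)
    also have "\<dots> = real (card {k \<in> {1..N}. gp i k < l}) * (real l)\<^sup>2" by simp
    also have "real (card {k \<in> {1..N}. gp i k < l}) \<le> real (2 * l)"
    proof -
      have "card {k \<in> {1..N}. gp i k < l} \<le> card ({i..<i + l} \<union> {i + 1 - l..<i + 1})"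
        by (intro card_mono) (auto simp: gp_def split: if_splits)
      also have "\<dots> \<le> card {i..<i + l} + card {i + 1 - l..<i + 1}" by (rule card_Un_le)
      also have "\<dots> \<le> 2 * l" by simp
      finally show ?thesis by (simp only: of_nat_le_iff)
    qed
    finally show ?thesis by (simp add: power3_eq_cube power2_eq_square mult_right_mono)
  qed
  have "holeF N l z \<le> (\<Sum>i\<in>{1..N}. \<nu> i * (2 * real l ^ 3))"
    unfolding holeF_def zz prod.case
  proof (rule sum_mono)
    fix i assume "i \<in> {1..N}"
    then have "(\<nu> i)\<^sup>2 \<le> \<nu> i" using dstates_nu_le_1[of \<beta> \<zeta> \<nu> N i] z \<nu>[of i]
      by (simp add: zz power2_eq_square mult_left_le)
    then show "(\<nu> i)\<^sup>2 * holes N l \<beta> i \<le> \<nu> i * (2 * real l ^ 3)"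
      by (intro mult_mono h holes_nonneg \<beta> \<nu>)
  qed
  also have "\<dots> = (\<Sum>i\<in>{1..N}. \<nu> i) * (2 * real l ^ 3)" by (rule sum_distrib_right[symmetric])
  also have "\<dots> \<le> 1 * (2 * real l ^ 3)" using s1 by (intro mult_right_mono) auto
  finally show "holeF N l z \<le> 2 * real l ^ 3" by simp
qed

subsection \<open>Density of the environment\<close>

text \<open>The probability that the walk from \<open>k\<close> leaves at 0 rather than at
  \<open>N + 1\<close>.\<close>

definition lin :: "nat \<Rightarrow> nat \<Rightarrow> real" where
  "lin N k = real (N + 1 - k) / real (N + 1)"

lemma lin_bounds: "0 \<le> lin N k" "lin N k \<le> 1"
  by (auto simp: lin_def)

lemma klap_lin:
  assumes "k \<in> {1..N}"
  shows "klap N (lin N) k = (if k = 1 then - (real N)\<^sup>2 else 0)"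
proof -
  have "real (N + 1) * lin N j = real (N + 1) - real j" if "j \<le> N + 1" for j
    using that by (simp add: lin_def of_nat_diff)
  then have l: "lin N j = 1 - real j / real (N + 1)" if "j \<le> N + 1" for j
    using that by (simp add: lin_def of_nat_diff diff_divide_distrib)
  have a: "zext N (lin N) (k + 1) = 1 - real (k + 1) / real (N + 1)"
    using assms l[of "k + 1"] by (auto simp: zext_def lin_def)
  have b: "zext N (lin N) (k - 1) = (if k = 1 then 0 else 1 - (real k - 1) / real (N + 1))"
    using assms l[of "k - 1"] by (auto simp: zext_def of_nat_diff)
  have c: "lin N k = 1 - real k / real (N + 1)" using l assms by simp
  show ?thesis unfolding klap_def a b c
    by (auto simp: diff_divide_distrib add_divide_distrib)
qed

text \<open>If each environment site \<open>k\<close> is marked independently with probability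
  \<open>\<theta> k\<close>, this is the probability that nothing is marked: the functional in which
  negative dependence and Chernoff bounds are expressed.\<close>

definition fprod :: "nat \<Rightarrow> (nat \<Rightarrow> real) \<Rightarrow> (nat \<Rightarrow> nat) \<Rightarrow> real" where
  "fprod N \<theta> \<beta> = (\<Prod>k\<in>{1..N}. 1 - \<theta> k * real (\<beta> k))"

definition rest :: "nat \<Rightarrow> (nat \<Rightarrow> real) \<Rightarrow> (nat \<Rightarrow> nat) \<Rightarrow> nat set \<Rightarrow> real" where
  "rest N \<theta> \<beta> A = (\<Prod>k\<in>{1..N} - A. 1 - \<theta> k * real (\<beta> k))"

lemma fprod_rest: "k \<in> {1..N} \<Longrightarrow> fprod N \<theta> \<beta> = (1 - \<theta> k * real (\<beta> k)) * rest N \<theta> \<beta> {k}"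
  unfolding fprod_def rest_def by (subst prod.remove[of "{1..N}" k]) auto

lemma rest_rest:
  "k \<in> {1..N} \<Longrightarrow> j \<in> {1..N} \<Longrightarrow> j \<noteq> k \<Longrightarrow>
    rest N \<theta> \<beta> {k} = (1 - \<theta> j * real (\<beta> j)) * rest N \<theta> \<beta> {k, j}"
  unfolding rest_def by (subst prod.remove[of "{1..N} - {k}" j]) (auto intro!: prod.cong)

lemma rest_cong: "(\<And>k. k \<notin> A \<Longrightarrow> \<beta> k = \<beta>' k) \<Longrightarrow> rest N \<theta> \<beta> A = rest N \<theta> \<beta>' A"
  unfolding rest_def by (intro prod.cong) auto

lemma factor_range:
  assumes "\<And>k. k \<in> {1..N} \<Longrightarrow> 0 \<le> \<theta> k \<and> \<theta> k \<le> 1" "\<beta> \<in> configs N" "k \<in> {1..N}"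
  shows "0 \<le> 1 - \<theta> k * real (\<beta> k)" "1 - \<theta> k * real (\<beta> k) \<le> 1"
  using assms(1)[OF assms(3)] configs_01[OF assms(2,3)] by auto

lemma fprod_range:
  assumes "\<And>k. k \<in> {1..N} \<Longrightarrow> 0 \<le> \<theta> k \<and> \<theta> k \<le> 1" "\<beta> \<in> configs N"
  shows "0 \<le> fprod N \<theta> \<beta>" "fprod N \<theta> \<beta> \<le> 1" "0 \<le> rest N \<theta> \<beta> A"
  unfolding fprod_def rest_def using factor_range[of N \<theta> \<beta>] assms
  by (auto intro!: prod_nonneg prod_le_1)

text \<open>The negative dependence of the environment: along the heat flow of \<open>\<theta>\<close>, the expectation of
  the product \<open>fprod N \<theta>\<close> can only decrease.\<close>

lemma fprod_gen_le:
  assumes N: "1 \<le> N" and \<theta>: "\<And>k. k \<in> {1..N} \<Longrightarrow> 0 \<le> \<theta> k \<and> \<theta> k \<le> 1" and \<beta>: "\<beta> \<in> configs N"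
  shows "ssep_gen N 1 0 (fprod N \<theta>) \<beta> + (\<Sum>k\<in>{1..N}. klap N \<theta> k * real (\<beta> k) * rest N \<theta> \<beta> {k})
    \<le> - ((real N)\<^sup>2 * \<theta> 1 * fprod N \<theta> \<beta>)"
proof -
  let ?f = "fprod N \<theta>" and ?b = "\<lambda>k. real (\<beta> k)"
  define w where "w = (\<lambda>k. ?b k * rest N \<theta> \<beta> {k})"
  have mem: "1 \<in> {1..N}" "N \<in> {1..N}" using N by auto
  \<comment> \<open>The left side vanishes unless both ends belong to the environment; there it is
    the negative of \<open>R\<close> times the squared difference of \<open>\<theta> i\<close> and
    \<open>\<theta> (i + 1)\<close>. This is where negative dependence enters.\<close>
  have edge: "(?f (\<beta>(i := \<beta> (i + 1), i + 1 := \<beta> i)) - ?f \<beta>) + (\<theta> (i + 1) - \<theta> i) * (w i - w (i + 1)) \<le> 0"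
    if i: "i \<in> {1..<N}" for i
  proof -
    have ii: "i \<in> {1..N}" "i + 1 \<in> {1..N}" using i by auto
    let ?s = "\<beta>(i := \<beta> (i + 1), i + 1 := \<beta> i)"
    define R where "R = rest N \<theta> \<beta> {i, i + 1}"
    have R: "0 \<le> R" unfolding R_def by (rule fprod_range(3)[OF \<theta> \<beta>])
    have Rs: "rest N \<theta> ?s {i, i + 1} = R" unfolding R_def by (rule rest_cong) auto
    have 1: "?f \<beta> = (1 - \<theta> i * ?b i) * ((1 - \<theta> (i + 1) * ?b (i + 1)) * R)"
      unfolding R_def using fprod_rest[OF ii(1)] rest_rest[OF ii] by simp
    have 2: "?f ?s = (1 - \<theta> i * ?b (i + 1)) * ((1 - \<theta> (i + 1) * ?b i) * R)"
      using fprod_rest[OF ii(1), of \<theta> ?s] rest_rest[OF ii, of \<theta> ?s] Rs by simp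
    have 3: "rest N \<theta> \<beta> {i} = (1 - \<theta> (i + 1) * ?b (i + 1)) * R"
      unfolding R_def using rest_rest[OF ii] by simp
    have 4: "rest N \<theta> \<beta> {i + 1} = (1 - \<theta> i * ?b i) * R"
      unfolding R_def using rest_rest[OF ii(2,1), of \<theta> \<beta>] by (simp add: insert_commute)
    have "0 \<le> (\<theta> (i + 1) - \<theta> i)\<^sup>2 * R" using R by simp
    then show ?thesis unfolding 1 2 w_def 3 4 using configs_01[OF \<beta> ii(1)] configs_01[OF \<beta> ii(2)]
      by (auto simp: power2_eq_square algebra_simps)
  qed
  have left: "(?f (\<beta>(1 := 1)) - ?f \<beta>) - w 1 * \<theta> 1 \<le> - (\<theta> 1 * ?f \<beta>)"
  proof -
    have r: "rest N \<theta> (\<beta>(1 := 1)) {1} = rest N \<theta> \<beta> {1}" by (rule rest_cong) auto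
    have "?f (\<beta>(1 := 1)) = (1 - \<theta> 1) * rest N \<theta> \<beta> {1}"
      using fprod_rest[OF mem(1), of \<theta> "\<beta>(1 := 1)"] r by simp
    moreover have f: "?f \<beta> = (1 - \<theta> 1 * ?b 1) * rest N \<theta> \<beta> {1}" by (rule fprod_rest[OF mem(1)])
    ultimately have "(?f (\<beta>(1 := 1)) - ?f \<beta>) - w 1 * \<theta> 1 = - (\<theta> 1 * rest N \<theta> \<beta> {1})"
      by (simp add: w_def algebra_simps)
    moreover have "?f \<beta> \<le> 1 * rest N \<theta> \<beta> {1}" unfolding f
      by (intro mult_right_mono fprod_range(3)[OF \<theta> \<beta>] factor_range(2)[OF \<theta> \<beta> mem(1)])
    ultimately show ?thesis using \<theta>[OF mem(1)] by (simp add: mult_left_mono)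
  qed
  have right: "(?f (\<beta>(N := 0)) - ?f \<beta>) - w N * \<theta> N = 0"
  proof -
    have r: "rest N \<theta> (\<beta>(N := 0)) {N} = rest N \<theta> \<beta> {N}" by (rule rest_cong) auto
    show ?thesis
      using fprod_rest[OF mem(2), of \<theta> "\<beta>(N := 0)"] r fprod_rest[OF mem(2), of \<theta> \<beta>]
      by (simp add: w_def algebra_simps)
  qed
  have K: "(\<Sum>k\<in>{1..N}. klap N \<theta> k * ?b k * rest N \<theta> \<beta> {k}) = (real N)\<^sup>2 *
    ((\<Sum>i\<in>{1..<N}. (\<theta> (i + 1) - \<theta> i) * (w i - w (i + 1))) - w 1 * \<theta> 1 - w N * \<theta> N)"
    using klap_sum_edges[OF N, of w \<theta>] by (simp add: w_def mult_ac)
  have G: "ssep_gen N 1 0 ?f \<beta> = (real N)\<^sup>2 * ((\<Sum>i\<in>{1..<N}. ?f (\<beta>(i := \<beta> (i + 1), i + 1 := \<beta> i)) - ?f \<beta>)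
      + (?f (\<beta>(1 := 1)) - ?f \<beta>) + (?f (\<beta>(N := 0)) - ?f \<beta>))"
    unfolding ssep_gen_def sum_distrib_left[symmetric] by (simp add: algebra_simps)
  have "(\<Sum>i\<in>{1..<N}. (?f (\<beta>(i := \<beta> (i + 1), i + 1 := \<beta> i)) - ?f \<beta>)
      + (\<theta> (i + 1) - \<theta> i) * (w i - w (i + 1))) \<le> 0"
    by (rule sum_nonpos[OF edge])
  then have "((\<Sum>i\<in>{1..<N}. ?f (\<beta>(i := \<beta> (i + 1), i + 1 := \<beta> i)) - ?f \<beta>)
      + (?f (\<beta>(1 := 1)) - ?f \<beta>) + (?f (\<beta>(N := 0)) - ?f \<beta>)) +
    ((\<Sum>i\<in>{1..<N}. (\<theta> (i + 1) - \<theta> i) * (w i - w (i + 1))) - w 1 * \<theta> 1 - w N * \<theta> N) \<le> - (\<theta> 1 * ?f \<beta>)"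
    unfolding sum.distrib using left right by linarith
  then have "(real N)\<^sup>2 * (((\<Sum>i\<in>{1..<N}. ?f (\<beta>(i := \<beta> (i + 1), i + 1 := \<beta> i)) - ?f \<beta>)
      + (?f (\<beta>(1 := 1)) - ?f \<beta>) + (?f (\<beta>(N := 0)) - ?f \<beta>)) +
    ((\<Sum>i\<in>{1..<N}. (\<theta> (i + 1) - \<theta> i) * (w i - w (i + 1))) - w 1 * \<theta> 1 - w N * \<theta> N)) \<le> (real N)\<^sup>2 * - (\<theta> 1 * ?f \<beta>)"
    by (rule mult_left_mono) simp
  then show ?thesis unfolding G K by (simp add: distrib_left mult.assoc)
qed

lemma fprod_DERIV:
  assumes "\<And>k. k \<in> {1..N} \<Longrightarrow> ((\<lambda>r. \<theta> r k) has_real_derivative \<theta>' k) (at r)"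
  shows "((\<lambda>r. fprod N (\<theta> r) \<beta>) has_real_derivative
    (\<Sum>k\<in>{1..N}. - \<theta>' k * real (\<beta> k) * rest N (\<theta> r) \<beta> {k})) (at r)"
proof -
  have "((\<lambda>r. \<Prod>k\<in>{1..N}. 1 - \<theta> r k * real (\<beta> k)) has_field_derivative
      (\<Sum>k\<in>{1..N}. (- \<theta>' k * real (\<beta> k)) * (\<Prod>j\<in>{1..N} - {k}. 1 - \<theta> r j * real (\<beta> j)))) (at r)"
    by (rule has_field_derivative_prod) (auto intro!: derivative_eq_intros assms)
  then show ?thesis by (simp add: fprod_def rest_def)
qed

text \<open>The probability that the walk from \<open>k\<close> exits on the left before time \<open>r\<close> is at least
  \<open>\<psi> r k\<close> below. The inequality comes from \<open>\<partial>\<^sub>r \<psi> \<le> \<Delta> \<psi>\<close> with left boundary value \<open>r \<le> 1\<close>.\<close>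

lemma fprod_semigroup_le:
  assumes N: "2 \<le> N" and \<theta>: "\<And>k. 0 \<le> \<theta> k \<and> \<theta> k \<le> 1" and \<beta>: "\<beta> \<in> configs N"
  shows "ssep_semigroup N 1 0 1 (fprod N \<theta>) \<beta> \<le> exp (- (\<Sum>k\<in>{1..N}. \<theta> k * lin N k) / 4)"
proof -
  have N1: "1 \<le> N" using N by simp
  interpret S: subgen "configs N" "ssep_gen N 1 0" "ssep_rate N" by (rule ssep_subgen) auto
  \<comment> \<open>In the distance coordinate \<open>j / (N + 1)\<close> is \<open>lin\<close>, so
    \<open>klap N g \<le> - lin\<close>; this compensates the time derivative \<open>lin\<close> of
    \<open>\<psi>\<close>.\<close>
  define g where "g = green N (\<lambda>j. real j / real (N + 1))"
  define \<psi> where "\<psi> = (\<lambda>r k. r * lin N k - g k)"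
  define \<Theta> where "\<Theta> = (\<lambda>r k. sgp (klap N) (1 - r) \<theta> k)"
  define e where "e = (\<lambda>r. \<Sum>k\<in>{1..N}. \<Theta> r k * \<psi> r k)"
  have g_nonneg: "0 \<le> g k" for k unfolding g_def by (rule green_nonneg) simp
  \<comment> \<open>For \<open>2 \<le> N\<close> one has
    \<open>1 / (2 N) \<le> 3 / (4 (N + 1))\<close>. This leaves
    \<open>\<psi> 1 \<ge> lin / 4\<close>, the source of the 4 in the exponent.\<close>
  have g_le: "g k \<le> 3 / 4 * lin N k" if k: "k \<in> {1..N}" for k
  proof -
    have h: "(\<Sum>j\<in>{1..N}. real j / real (N + 1)) = real N / 2"
    proof -
      have "(\<Sum>j\<in>{1..N}. real j) = real N * (real N + 1) / 2"
        by (induction N) (auto simp: field_simps)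
      then show ?thesis by (simp add: sum_divide_distrib[symmetric] field_simps)
    qed
    have "g k \<le> real (N + 1 - k) * (real N / 2) / (real N)\<^sup>2"
      unfolding g_def h[symmetric] by (rule green_le) simp
    also have "\<dots> = real (N + 1 - k) * (1 / (2 * real N))" using N by (simp add: power2_eq_square)
    also have "\<dots> \<le> real (N + 1 - k) * (3 / 4 / real (N + 1))"
      using N by (intro mult_left_mono) (auto simp: field_simps)
    finally show ?thesis by (simp add: lin_def mult.commute)
  qed
  have klap_g: "klap N g k \<le> - lin N k" if "k \<in> {1..N}" for k
    unfolding g_def using klap_green_le[of "\<lambda>j. real j / real (N + 1)" k N] that by (simp add: lin_def)
  have bk: "bounded_fn {1..N} c" for c by (rule bounded_fn_finite) simp
  have \<Theta>_range: "0 \<le> \<Theta> r k \<and> \<Theta> r k \<le> 1" if "k \<in> {1..N}" "r \<le> 1" for r k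
    unfolding \<Theta>_def using that \<theta>
    by (intro conjI K.sgp_nonneg[OF bk] K.sgp_le_const[OF bk]) auto
  have \<Theta>_DERIV: "((\<lambda>r. \<Theta> r k) has_real_derivative - klap N (\<Theta> r) k) (at r)" if k: "k \<in> {1..N}" for r k
  proof -
    have "((\<lambda>r. 1 - r) has_real_derivative -1) (at r)" by (auto intro!: derivative_eq_intros)
    from DERIV_chain2[where f = "\<lambda>s. sgp (klap N) s \<theta> k" and g = "\<lambda>r. 1 - r", OF K.sgp_DERIV[OF bk k] this]
    show ?thesis using K.L_sgp[OF bk k] by (simp add: \<Theta>_def)
  qed
  have e_DERIV: "(e has_real_derivative (\<Sum>k\<in>{1..N}. - klap N (\<Theta> r) k * \<psi> r k + lin N k * \<Theta> r k)) (at r)" for r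
    unfolding e_def
    by (intro DERIV_sum DERIV_mult \<Theta>_DERIV) (auto simp: \<psi>_def intro!: derivative_eq_intros)
  have e_le: "(\<Sum>k\<in>{1..N}. - klap N (\<Theta> r) k * \<psi> r k + lin N k * \<Theta> r k) \<le> (real N)\<^sup>2 * \<Theta> r 1"
    if r: "0 \<le> r" "r \<le> 1" for r
  proof -
    have "(\<Sum>k\<in>{1..N}. - klap N (\<Theta> r) k * \<psi> r k + lin N k * \<Theta> r k) =
        (\<Sum>k\<in>{1..N}. \<Theta> r k * (lin N k - klap N (\<psi> r) k))"
      using klap_symmetric[of "\<Theta> r" N "\<psi> r"]
      by (simp add: sum.distrib sum_negf sum_subtractf right_diff_distrib mult.commute)
    also have "\<dots> \<le> (\<Sum>k\<in>{1..N}. if k = 1 then (real N)\<^sup>2 * \<Theta> r k else 0)"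
    proof (rule sum_mono)
      fix k assume k: "k \<in> {1..N}"
      have "klap N (\<psi> r) k = r * klap N (lin N) k - klap N g k"
        unfolding \<psi>_def K.L_diff[OF k] K.L_cmult[OF k] by simp
      then have "lin N k - klap N (\<psi> r) k \<le> (if k = 1 then (real N)\<^sup>2 else 0)"
        using klap_lin[OF k] klap_g[OF k] mult_left_le_one_le[of "(real N)\<^sup>2" r] r by (auto split: if_splits)
      then have "\<Theta> r k * (lin N k - klap N (\<psi> r) k) \<le> \<Theta> r k * (if k = 1 then (real N)\<^sup>2 else 0)"
        using \<Theta>_range[OF k r(2)] by (intro mult_left_mono) auto
      then show "\<Theta> r k * (lin N k - klap N (\<psi> r) k) \<le> (if k = 1 then (real N)\<^sup>2 * \<Theta> r k else 0)"
        by (simp add: mult.commute split: if_splits)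
    qed
    also have "\<dots> = (real N)\<^sup>2 * \<Theta> r 1" using N by simp
    finally show ?thesis .
  qed
  \<comment> \<open>The factor \<open>exp (e r)\<close> spends exactly the gain that
    \<open>fprod_gen_le\<close> provides at the left reservoir; by \<open>e_le\<close> its
    logarithmic derivative does not exceed that gain.\<close>
  let ?\<Psi> = "\<lambda>r \<beta>. exp (e r) * fprod N (\<Theta> r) \<beta>"
  let ?e' = "\<lambda>r. \<Sum>k\<in>{1..N}. - klap N (\<Theta> r) k * \<psi> r k + lin N k * \<Theta> r k"
  have "sgp (ssep_gen N 1 0) 1 (?\<Psi> 1) \<beta> \<le> sgp (ssep_gen N 1 0) 0 (?\<Psi> 0) \<beta>"
  proof (rule S.sgp_time_antimono[OF finite_configs \<beta>, where \<Psi>' = "\<lambda>r \<beta>. exp (e r) * ?e' r * fprod N (\<Theta> r) \<beta>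
      + (\<Sum>k\<in>{1..N}. - (- klap N (\<Theta> r) k) * real (\<beta> k) * rest N (\<Theta> r) \<beta> {k}) * exp (e r)"])
    fix x r assume x: "x \<in> configs N" and r: "0 \<le> r" "r \<le> (1::real)"
    show "((\<lambda>r. ?\<Psi> r x) has_real_derivative exp (e r) * ?e' r * fprod N (\<Theta> r) x
      + (\<Sum>k\<in>{1..N}. - (- klap N (\<Theta> r) k) * real (x k) * rest N (\<Theta> r) x {k}) * exp (e r)) (at r)"
      by (rule DERIV_mult[OF DERIV_fun_exp[OF e_DERIV] fprod_DERIV[OF \<Theta>_DERIV]])
    have f0: "0 \<le> fprod N (\<Theta> r) x" using fprod_range(1)[of N "\<Theta> r" x] \<Theta>_range r x by auto
    have "ssep_gen N 1 0 (?\<Psi> r) x + (exp (e r) * ?e' r * fprod N (\<Theta> r) x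
      + (\<Sum>k\<in>{1..N}. - (- klap N (\<Theta> r) k) * real (x k) * rest N (\<Theta> r) x {k}) * exp (e r)) =
      exp (e r) * ((ssep_gen N 1 0 (fprod N (\<Theta> r)) x
        + (\<Sum>k\<in>{1..N}. klap N (\<Theta> r) k * real (x k) * rest N (\<Theta> r) x {k})) + ?e' r * fprod N (\<Theta> r) x)"
      unfolding S.L_cmult[OF x] by (simp add: distrib_left mult_ac)
    also have "\<dots> \<le> exp (e r) * (- ((real N)\<^sup>2 * \<Theta> r 1 * fprod N (\<Theta> r) x) + (real N)\<^sup>2 * \<Theta> r 1 * fprod N (\<Theta> r) x)"
      using fprod_gen_le[OF N1 _ x, of "\<Theta> r"] \<Theta>_range r f0 e_le[OF r]
      by (intro mult_left_mono add_mono mult_right_mono) auto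
    finally show "ssep_gen N 1 0 (?\<Psi> r) x + (exp (e r) * ?e' r * fprod N (\<Theta> r) x
      + (\<Sum>k\<in>{1..N}. - (- klap N (\<Theta> r) k) * real (x k) * rest N (\<Theta> r) x {k}) * exp (e r)) \<le> 0" by simp
  qed auto
  also have "\<dots> \<le> 1"
  proof -
    have "e 0 \<le> 0" unfolding e_def \<psi>_def
      using \<Theta>_range[of _ 0] g_nonneg by (intro sum_nonpos mult_nonneg_nonpos) auto
    moreover have "0 \<le> fprod N (\<Theta> 0) \<beta>" "fprod N (\<Theta> 0) \<beta> \<le> 1"
      using fprod_range[of N "\<Theta> 0" \<beta>] \<Theta>_range[of _ 0] \<beta> by auto
    ultimately show ?thesis using mult_mono[of "exp (e 0)" 1 "fprod N (\<Theta> 0) \<beta>" 1] by simp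
  qed
  finally have "exp (e 1) * ssep_semigroup N 1 0 1 (fprod N (\<Theta> 1)) \<beta> \<le> 1"
    by (simp add: ssep_semigroup_sgp S.sgp_cmult[OF bounded_fn_finite[OF finite_configs] \<beta>])
  moreover have "fprod N (\<Theta> 1) = fprod N \<theta>"
    by (auto simp: fprod_def \<Theta>_def fun_eq_iff intro!: prod.cong)
  moreover have "(\<Sum>k\<in>{1..N}. \<theta> k * lin N k) / 4 \<le> e 1"
    unfolding e_def sum_divide_distrib
  proof (rule sum_mono)
    fix k assume k: "k \<in> {1..N}"
    have "\<theta> k * (lin N k / 4) \<le> \<theta> k * \<psi> 1 k"
      using g_le[OF k] \<theta>[of k] by (intro mult_left_mono) (auto simp: \<psi>_def)
    then show "\<theta> k * lin N k / 4 \<le> \<Theta> 1 k * \<psi> 1 k" using k by (simp add: \<Theta>_def)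
  qed
  moreover have "0 \<le> ssep_semigroup N 1 0 1 (fprod N \<theta>) \<beta>"
    using fprod_range(1)[of N \<theta>] \<theta> by (intro ssep_semigroup_nonneg \<beta>) auto
  ultimately have "exp ((\<Sum>k\<in>{1..N}. \<theta> k * lin N k) / 4) * ssep_semigroup N 1 0 1 (fprod N \<theta>) \<beta>
      \<le> exp (e 1) * ssep_semigroup N 1 0 1 (fprod N (\<Theta> 1)) \<beta>"
    by (intro mult_mono) auto
  also have "\<dots> \<le> 1" by fact
  finally show ?thesis by (simp add: exp_minus field_simps)
qed

text \<open>Averaging leaves \<open>\<beta>\<close> alone, and so would a swap of two environment
  sites. Thus \<open>\<beta>\<close> is autonomous, an exclusion process with reservoir densities 1
  on the left and 0 on the right.\<close>

lemma dgen_environment: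
  assumes N: "1 \<le> N" and q: "q \<in> {0..1}" and z: "z \<in> dstates N"
  shows "sgp (dgen N q) t (\<lambda>z. f (fst z)) z = ssep_semigroup N 1 0 t f (fst z)"
  unfolding ssep_semigroup_sgp
proof (rule sgp_intertwine[where \<Phi> = "\<lambda>f z. f (fst z)", OF dgen_subgen[OF N q] ssep_subgen])
  fix F :: "(nat \<Rightarrow> nat) \<Rightarrow> real" and z :: dstate
  obtain \<beta> \<zeta> \<nu> where zz: "z = (\<beta>, \<zeta>, \<nu>)" by (cases z)
  have e: "edge_gen i (\<lambda>z. F (fst z)) z = F (\<beta>(i := \<beta> (i + 1), i + 1 := \<beta> i)) - F \<beta>" for i
    by (auto simp: edge_gen_def zz swp_def fun_upd_idem)
  have b: "bdry_gen N q (\<lambda>z. F (fst z)) z = (F (\<beta>(1 := 1)) - F \<beta>) + (F (\<beta>(N := 0)) - F \<beta>)"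
    by (simp add: bdry_gen_def zz algebra_simps)
  show "dgen N q (\<lambda>z. F (fst z)) z = ssep_gen N 1 0 F (fst z)"
    unfolding dgen_def e b ssep_gen_def sum_distrib_left[symmetric] by (simp add: zz algebra_simps)
next
  fix Fn :: "nat \<Rightarrow> (nat \<Rightarrow> nat) \<Rightarrow> real" and F and z :: dstate
  assume *: "\<And>x. x \<in> configs N \<Longrightarrow> (\<lambda>n. Fn n x) \<longlonglongrightarrow> F x" and "z \<in> dstates N"
  then show "(\<lambda>n. Fn n (fst z)) \<longlonglongrightarrow> F (fst z)" by (auto simp: dstates_def)
qed (use z bounded_fn_finite[OF finite_configs] in auto)

subsection \<open>Spreading of the discrepancy\<close>

definition window :: "nat \<Rightarrow> nat \<Rightarrow> nat \<Rightarrow> real" where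
  "window l i k = (if i + 2 \<le> k \<and> k \<le> i + l then 1 / 2 else 0)"

lemma window_range: "0 \<le> window l i k \<and> window l i k \<le> 1"
  by (auto simp: window_def)

lemma win_nonneg: "0 \<le> win N l \<beta> i"
  unfolding win_def by (intro sum_nonneg) auto

text \<open>The left side is positive only if \<open>win < x\<close>, and then
  \<open>1 \<le> exp (x - win)\<close>. The value 1/2 in \<open>window\<close> is chosen so that
  \<open>exp (- 1) \<le> 1 - 1 / 2\<close> bounds each factor.\<close>

lemma win_chernoff:
  assumes \<beta>: "\<beta> \<in> configs N" and x: "0 \<le> x"
  shows "x - win N l \<beta> i \<le> x * exp x * fprod N (window l i) \<beta>"
proof -
  have "exp (- win N l \<beta> i) = (\<Prod>k\<in>{1..N}. exp (- (if i + 2 \<le> k \<and> k \<le> i + l then real (\<beta> k) else 0)))"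
    unfolding win_def sum_negf[symmetric] by (rule exp_sum) simp
  also have "\<dots> \<le> fprod N (window l i) \<beta>" unfolding fprod_def
  proof (rule prod_mono)
    fix k assume k: "k \<in> {1..N}"
    have "2 \<le> exp (1 :: real)" using exp_ge_add_one_self[of 1] by simp
    then have "exp (- 1 :: real) \<le> 1 / 2" by (simp add: exp_minus field_simps)
    then show "0 \<le> exp (- (if i + 2 \<le> k \<and> k \<le> i + l then real (\<beta> k) else 0)) \<and>
        exp (- (if i + 2 \<le> k \<and> k \<le> i + l then real (\<beta> k) else 0)) \<le> 1 - window l i k * real (\<beta> k)"
      using configs_01[OF \<beta> k] by (auto simp: window_def)
  qed
  finally have f: "exp (- win N l \<beta> i) \<le> fprod N (window l i) \<beta>" .
  show ?thesis
  proof (cases "win N l \<beta> i < x")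
    case True
    have "x * 1 \<le> x * (exp x * exp (- win N l \<beta> i))"
      using True x by (intro mult_left_mono) (auto simp: exp_add[symmetric])
    also have "\<dots> \<le> x * (exp x * fprod N (window l i) \<beta>)" using f x by (intro mult_left_mono) auto
    finally show ?thesis using win_nonneg[of N l \<beta> i] by (simp add: mult.assoc)
  next
    case False
    have "0 \<le> fprod N (window l i) \<beta>" using fprod_range(1)[of N "window l i" \<beta>] window_range \<beta> by auto
    then have "0 \<le> x * exp x * fprod N (window l i) \<beta>" using x by simp
    then show ?thesis using False by simp
  qed
qed

text \<open>The scales: \<open>n\<close> is about \<open>N\<^bsup>1/8\<^esup>\<close>, the averaging length is \<open>n\<^sup>3\<close>, and the density of the
  environment is controlled where \<open>lin N i \<ge> 1 / n\<close>.\<close>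

locale scales =
  fixes N n l :: nat and q :: real
  assumes n: "2 \<le> n" and nN: "n ^ 8 \<le> N" and l: "l = n ^ 3" and q: "q \<in> {0..1}"
begin

lemma l_ge: "8 \<le> l"
  using power_mono[OF n, of 3] by (simp add: l)

lemma N_ge: "256 \<le> N"
  using power_mono[OF n, of 8] nN by simp

text \<open>The origin of the exponent 8. The Chernoff exponent is of order
  \<open>l * lin \<ge> l / n\<close>, so \<open>l = n ^ 3\<close> makes it \<open>n\<close> squared;
  the source at the right end has total size \<open>l\<close> squared and must not exceed
  \<open>N\<close> divided by \<open>n\<close> squared.\<close>

lemma l_sq: "real n ^ 2 * (real l)\<^sup>2 \<le> real N"
proof -
  have "real n ^ 2 * (real l)\<^sup>2 = real (n ^ 8)" by (simp add: l power_add[symmetric] flip: power_mult)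
  also have "\<dots> \<le> real N" using nN by (simp only: of_nat_le_iff)
  finally show ?thesis .
qed

sublocale D: subgen "dstates N" "dgen N q" "drate N"
  by (rule dgen_subgen) (use N_ge q in auto)

text \<open>Since \<open>2 * l \<le> (N + 1) / n \<le> N + 1 - i\<close>, \<open>lin\<close> loses
  at most half of its value across the window. The 8 collects this half, the 1/2 of
  \<open>window\<close>, and \<open>l - 1 \<ge> l / 2\<close>.\<close>

lemma window_mass:
  assumes i: "i \<in> {1..N}" and k: "1 / real n \<le> lin N i"
  shows "real l * lin N i / 8 \<le> (\<Sum>k\<in>{1..N}. window l i k * lin N k)"
proof -
  have "real (N + 1) / real n \<le> real (N + 1 - i)"
  proof -
    have "T / real n \<le> M" if "0 < T" "1 / real n \<le> M / T" for T M :: real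
      using that n by (simp add: field_simps)
    from this[of "real (N + 1)" "real (N + 1 - i)"] show ?thesis using k by (simp add: lin_def)
  qed
  moreover have "2 * real l \<le> real (N + 1) / real n"
  proof -
    have "2 * l * n \<le> n * l * n" using n by simp
    also have "\<dots> = n ^ 5" by (simp add: l power_numeral_reduce)
    also have "\<dots> \<le> n ^ 8" using n by (intro power_increasing) auto
    also have "\<dots> \<le> N + 1" using nN by simp
    finally have "real (2 * l * n) \<le> real (N + 1)" by (simp only: of_nat_le_iff)
    then show ?thesis using n by (simp add: field_simps)
  qed
  ultimately have "2 * real l \<le> real (N + 1 - i)" by simp
  then have il: "2 * l \<le> N + 1 - i" by (metis of_nat_le_iff of_nat_mult of_nat_numeral)
  have "real l / 2 * (1 / 2 * (lin N i / 2)) \<le> real (l - 1) * (1 / 2 * (lin N i / 2))"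
    using l_ge lin_bounds[of N i] by (intro mult_right_mono) (auto simp: of_nat_diff)
  also have "\<dots> = (\<Sum>k\<in>{i + 2..i + l}. 1 / 2 * (lin N i / 2))" using l_ge by (simp add: Suc_diff_le)
  also have "\<dots> \<le> (\<Sum>k\<in>{i + 2..i + l}. window l i k * lin N k)"
  proof (rule sum_mono)
    fix k assume k: "k \<in> {i + 2..i + l}"
    have "N + 1 - i \<le> 2 * (N + 1 - k)" using il k by auto
    then have "real (N + 1 - i) \<le> 2 * real (N + 1 - k)" by (metis of_nat_le_iff of_nat_mult of_nat_numeral)
    then have "real (N + 1 - i) / real (N + 1) \<le> 2 * real (N + 1 - k) / real (N + 1)"
      by (intro divide_right_mono) auto
    then have "lin N i \<le> 2 * lin N k" by (simp only: lin_def times_divide_eq_right)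
    then have "lin N i / 2 \<le> lin N k" by simp
    then show "1 / 2 * (lin N i / 2) \<le> window l i k * lin N k" using k by (simp add: window_def)
  qed
  also have "\<dots> \<le> (\<Sum>k\<in>{1..N}. window l i k * lin N k)"
    using il l_ge window_range lin_bounds by (intro sum_mono2) auto
  finally show ?thesis by simp
qed

definition good :: "nat set" where
  "good = {i \<in> {1..N}. 1 / real n \<le> lin N i}"

text \<open>Half the exponent \<open>l * lin / 32\<close> that \<open>window_mass\<close> and
  \<open>fprod_semigroup_le\<close> provide: the Chernoff cost \<open>exp (lev i)\<close> then still
  leaves \<open>exp (- lev i)\<close>.\<close>

definition lev :: "nat \<Rightarrow> real" where
  "lev i = real l * lin N i / 64"

text \<open>The price of replacing \<open>win\<close> by \<open>lev\<close> in the drift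
  \<open>- 2 / l * win\<close>; the coefficient \<open>lin / 32\<close> is
  \<open>2 / l * lev\<close>.\<close>

definition err :: "(nat \<Rightarrow> nat) \<Rightarrow> real" where
  "err \<beta> = (\<Sum>i\<in>good. lin N i / 32 * exp (lev i) * fprod N (window l i) \<beta>)"

text \<open>The first unit of time fills the environment from an arbitrary start; later times follow
  by the semigroup property from a bound uniform in the state at time \<open>r - 1\<close>.\<close>

lemma err_semigroup_le:
  assumes z: "z \<in> dstates N" and r: "1 \<le> r"
  shows "sgp (dgen N q) r (\<lambda>z. err (fst z)) z \<le> real N * exp (- (real n)\<^sup>2 / 64)"
proof -
  interpret S: subgen "configs N" "ssep_gen N 1 0" "ssep_rate N" by (rule ssep_subgen) auto
  note bd = bounded_fn_finite[OF finite_configs]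
  have \<beta>: "fst z \<in> configs N" using z by (auto simp: dstates_def)
  have N1: "1 \<le> N" "2 \<le> N" using N_ge by auto
  have P: "sgp (ssep_gen N 1 0) r (fprod N (window l i)) (fst z) \<le> exp (- 2 * lev i)" if i: "i \<in> good" for i
  proof -
    have 1: "ssep_semigroup N 1 0 1 (fprod N (window l i)) x \<le> exp (- 2 * lev i)" if x: "x \<in> configs N" for x
    proof -
      have "ssep_semigroup N 1 0 1 (fprod N (window l i)) x \<le> exp (- (\<Sum>k\<in>{1..N}. window l i k * lin N k) / 4)"
        by (rule fprod_semigroup_le[OF N1(2) window_range x])
      also have "\<dots> \<le> exp (- 2 * lev i)"
        using window_mass[of i] i by (auto simp: good_def lev_def)
      finally show ?thesis .
    qed
    have "sgp (ssep_gen N 1 0) ((r - 1) + 1) (fprod N (window l i)) (fst z) =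
        sgp (ssep_gen N 1 0) (r - 1) (sgp (ssep_gen N 1 0) 1 (fprod N (window l i))) (fst z)"
      by (rule S.sgp_semigroup[OF bd \<beta>])
    also have "\<dots> \<le> exp (- 2 * lev i)"
      by (rule S.sgp_le_const[OF bd \<beta>]) (use r 1 in \<open>auto simp: ssep_semigroup_sgp\<close>)
    finally show ?thesis by simp
  qed
  have "sgp (dgen N q) r (\<lambda>z. err (fst z)) z = sgp (ssep_gen N 1 0) r err (fst z)"
    using dgen_environment[OF N1(1) q z] by (simp add: ssep_semigroup_sgp)
  also have "\<dots> = (\<Sum>i\<in>good. lin N i / 32 * exp (lev i) * sgp (ssep_gen N 1 0) r (fprod N (window l i)) (fst z))"
    unfolding err_def[abs_def] by (simp only: S.sgp_sum[OF bd \<beta>] S.sgp_cmult[OF bd \<beta>])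
  also have "\<dots> \<le> (\<Sum>i\<in>good. exp (- (real n)\<^sup>2 / 64))"
  proof (rule sum_mono)
    fix i assume i: "i \<in> good"
    have "real l / (64 * real n) \<le> lev i"
    proof -
      have "real l * (1 / real n) \<le> real l * lin N i" using i by (intro mult_left_mono) (auto simp: good_def)
      then show ?thesis by (simp add: lev_def)
    qed
    moreover have "real l / (64 * real n) = (real n)\<^sup>2 / 64" using n by (simp add: l power_numeral_reduce)
    ultimately have lv: "(real n)\<^sup>2 / 64 \<le> lev i" by simp
    have "lin N i / 32 * exp (lev i) * sgp (ssep_gen N 1 0) r (fprod N (window l i)) (fst z) \<le>
        1 * exp (lev i) * exp (- 2 * lev i)"
      using lin_bounds[of N i] r fprod_range(1)[of N "window l i"] window_range
      by (intro mult_mono P i S.sgp_nonneg[OF bd \<beta>]) auto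
    also have "\<dots> = exp (- lev i)" by (simp add: exp_add[symmetric])
    also have "\<dots> \<le> exp (- (real n)\<^sup>2 / 64)" using lv by simp
    finally show "lin N i / 32 * exp (lev i) * sgp (ssep_gen N 1 0) r (fprod N (window l i)) (fst z)
        \<le> exp (- (real n)\<^sup>2 / 64)" .
  qed
  also have "\<dots> = real (card good) * exp (- (real n)\<^sup>2 / 64)" by simp
  also have "\<dots> \<le> real N * exp (- (real n)\<^sup>2 / 64)"
  proof -
    have "card good \<le> card {1..N}" unfolding good_def by (intro card_mono) auto
    then show ?thesis by (intro mult_right_mono) auto
  qed
  finally show ?thesis .
qed

text \<open>Indexed by the distance \<open>N + 1 - i\<close> to the right end, it pays for two
  defects: sites with \<open>lin < 1 / n\<close>, where the density is not controlled, and the holes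
  created at \<open>N\<close>, where \<open>ker \<le> l^2\<close> is divided by the \<open>l\<close>
  of \<open>lyap\<close>.\<close>

definition src :: "nat \<Rightarrow> real" where
  "src m = (if real m / real (N + 1) < 1 / real n then real m / real (N + 1) / 32 else 0)
    + (if m \<le> l then real l else 0)"

lemma src_nonneg: "0 \<le> src m"
  by (simp add: src_def)

text \<open>The combination in which \<open>contact\<close> cancels, normalized by \<open>l\<close>
  and the speed \<open>N\<close> squared so that the remaining drift is
  \<open>- 2 / l * win\<close>; the last term repairs the right end through
  \<open>src\<close>.\<close>

definition lyap :: "dstate \<Rightarrow> real" where
  "lyap z = 1 / (real l * (real N)\<^sup>2) * (2 * (real l - 1) * meetF N z + holeF N l z) + sqmass N (green N src) z"

lemma bounded_meetF: "bounded_fn (dstates N) (meetF N)"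
  by (rule bounded_fnI[of _ _ "real N"]) (use meet_bounds[of _ N] in \<open>auto simp: meetF_def dstates_def\<close>)

lemma bounded_holeF: "bounded_fn (dstates N) (holeF N l)"
  by (rule bounded_fnI[of _ _ "2 * real l ^ 3"]) (use holeF_bounds[of _ N l] in auto)

lemma bounded_lyap: "bounded_fn (dstates N) lyap"
  unfolding lyap_def[abs_def]
  by (intro bounded_fn_intros bounded_meetF bounded_holeF bounded_sqmass)

text \<open>On good sites \<open>win_chernoff\<close> turns the window occupation into
  \<open>lin / 32\<close> up to \<open>err\<close>; on the other sites \<open>src\<close> supplies
  the same amount.\<close>

lemma dgen_lyap_le:
  assumes z: "z \<in> dstates N"
  shows "dgen N q lyap z \<le> - sqmass N (lin N) z / 32 + err (fst z)"
proof -
  obtain \<beta> \<zeta> \<nu> where zz: "z = (\<beta>, \<zeta>, \<nu>)" by (cases z)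
  have \<beta>: "\<beta> \<in> configs N" using z by (auto simp: zz dstates_def)
  have N1: "1 \<le> N" using N_ge by auto
  have l1: "1 \<le> l" "0 < real l" "1 \<le> real l" using l_ge by auto
  have "dgen N q (\<lambda>z. 1 / (real l * (real N)\<^sup>2) * (2 * (real l - 1) * meetF N z + holeF N l z)) z =
      1 / real l * (2 * (real l - 1) * ugen N q (meetF N) z + ugen N q (holeF N l) z)"
  proof -
    have "dgen N q (\<lambda>z. 1 / (real l * (real N)\<^sup>2) * (2 * (real l - 1) * meetF N z + holeF N l z)) z =
        1 / (real l * (real N)\<^sup>2) * ((2 * (real l - 1)) * dgen N q (meetF N) z + dgen N q (holeF N l) z)"
      by (subst D.L_cmult[OF z], subst D.L_lin[OF z]) (rule refl)
    also have "\<dots> = 1 / real l * (2 * (real l - 1) * ugen N q (meetF N) z + ugen N q (holeF N l) z)"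
      using N1 l1 unfolding dgen_ugen by (simp add: field_simps)
    finally show ?thesis .
  qed
  also have "\<dots> \<le> 1 / real l * (2 * (real l - 1) * (- contact N z) + (2 * ((real l - 1) * contact N z
    - (\<Sum>i\<in>{1..N}. (\<nu> i)\<^sup>2 * win N l \<beta> i)) + (\<Sum>i\<in>{1..<N}. (\<nu> i)\<^sup>2 * ker l (N - i))))"
    using ugen_meetF_le[OF N1 z, of q] ugen_holeF_le[OF l1(1) N1, of \<beta> \<zeta> \<nu> q] z l1 unfolding zz
    by (intro mult_left_mono add_mono) auto
  also have "\<dots> = 1 / real l * ((\<Sum>i\<in>{1..<N}. (\<nu> i)\<^sup>2 * ker l (N - i)) - 2 * (\<Sum>i\<in>{1..N}. (\<nu> i)\<^sup>2 * win N l \<beta> i))"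
    by (simp add: algebra_simps)
  also have "\<dots> \<le> 1 / real l * ((\<Sum>i\<in>{1..N}. (\<nu> i)\<^sup>2 * (if N + 1 - i \<le> l then (real l)\<^sup>2 else 0))
      - 2 * (\<Sum>i\<in>{1..N}. (\<nu> i)\<^sup>2 * win N l \<beta> i))"
  proof -
    have "(\<Sum>i\<in>{1..<N}. (\<nu> i)\<^sup>2 * ker l (N - i)) \<le> (\<Sum>i\<in>{1..<N}. (\<nu> i)\<^sup>2 * (if N + 1 - i \<le> l then (real l)\<^sup>2 else 0))"
    proof (intro sum_mono mult_left_mono)
      fix i assume "i \<in> {1..<N}"
      then have "(N - i < l) = (N + 1 - i \<le> l)" by auto
      then show "ker l (N - i) \<le> (if N + 1 - i \<le> l then (real l)\<^sup>2 else 0)" using ker_le[of l "N - i"] by simp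
    qed auto
    also have "\<dots> \<le> (\<Sum>i\<in>{1..N}. (\<nu> i)\<^sup>2 * (if N + 1 - i \<le> l then (real l)\<^sup>2 else 0))"
      by (intro sum_mono2) auto
    finally show ?thesis using l1 by (intro mult_left_mono) auto
  qed
  also have "\<dots> = (\<Sum>i\<in>{1..N}. (\<nu> i)\<^sup>2 * ((if N + 1 - i \<le> l then real l else 0) - 2 / real l * win N l \<beta> i))"
    unfolding sum_distrib_left sum_subtractf[symmetric] using l1
    by (intro sum.cong refl) (auto simp: power2_eq_square field_simps)
  finally have 1: "dgen N q (\<lambda>z. 1 / (real l * (real N)\<^sup>2) * (2 * (real l - 1) * meetF N z + holeF N l z)) z \<le>
      (\<Sum>i\<in>{1..N}. (\<nu> i)\<^sup>2 * ((if N + 1 - i \<le> l then real l else 0) - 2 / real l * win N l \<beta> i))" .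
  have "dgen N q (sqmass N (green N src)) z \<le> sqmass N (klap N (green N src)) z"
    by (rule dgen_sqmass_le[OF N1 green_nonneg[OF src_nonneg]])
  also have "\<dots> \<le> (\<Sum>i\<in>{1..N}. (\<nu> i)\<^sup>2 * (- src (N + 1 - i)))"
    unfolding sqmass_def zz prod.case
  proof (rule sum_mono)
    fix k assume "k \<in> {1..N}"
    then have "klap N (green N src) k * (\<nu> k)\<^sup>2 \<le> - src (N + 1 - k) * (\<nu> k)\<^sup>2"
      by (intro mult_right_mono klap_green_le[of src, OF src_nonneg]) auto
    then show "klap N (green N src) k * (\<nu> k)\<^sup>2 \<le> (\<nu> k)\<^sup>2 * (- src (N + 1 - k))"
      by (simp add: mult.commute)
  qed
  finally have 2: "dgen N q (sqmass N (green N src)) z \<le> (\<Sum>i\<in>{1..N}. (\<nu> i)\<^sup>2 * (- src (N + 1 - i)))" .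
  have "dgen N q lyap z = dgen N q (\<lambda>z. 1 / (real l * (real N)\<^sup>2) * (2 * (real l - 1) * meetF N z + holeF N l z)) z
      + dgen N q (sqmass N (green N src)) z"
    unfolding lyap_def[abs_def] by (rule D.L_add[OF z])
  also have "\<dots> \<le> (\<Sum>i\<in>{1..N}. (\<nu> i)\<^sup>2 * ((if N + 1 - i \<le> l then real l else 0) - 2 / real l * win N l \<beta> i)
      + (\<nu> i)\<^sup>2 * (- src (N + 1 - i)))"
    using 1 2 by (simp only: sum.distrib)
  also have "\<dots> \<le> (\<Sum>i\<in>{1..N}. - (lin N i * (\<nu> i)\<^sup>2 / 32)
      + (if i \<in> good then lin N i / 32 * exp (lev i) * fprod N (window l i) \<beta> else 0))"
  proof (rule sum_mono)
    fix i assume i: "i \<in> {1..N}"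
    have s: "src (N + 1 - i) = (if lin N i < 1 / real n then lin N i / 32 else 0)
        + (if N + 1 - i \<le> l then real l else 0)"
      by (simp add: src_def lin_def)
    have f0: "0 \<le> fprod N (window l i) \<beta>" using fprod_range(1)[of N "window l i" \<beta>] window_range \<beta> by auto
    have "(\<nu> i)\<^sup>2 * ((if N + 1 - i \<le> l then real l else 0) - 2 / real l * win N l \<beta> i) + (\<nu> i)\<^sup>2 * (- src (N + 1 - i))
        = (\<nu> i)\<^sup>2 * (- 2 / real l * win N l \<beta> i - (if lin N i < 1 / real n then lin N i / 32 else 0))"
      unfolding s by (simp add: algebra_simps)
    also have "\<dots> \<le> - (lin N i * (\<nu> i)\<^sup>2 / 32)
      + (if i \<in> good then lin N i / 32 * exp (lev i) * fprod N (window l i) \<beta> else 0)"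
    proof (cases "i \<in> good")
      case True
      define E where "E = lin N i / 32 * exp (lev i) * fprod N (window l i) \<beta>"
      have E: "0 \<le> E" unfolding E_def using lin_bounds[of N i] f0 by simp
      have "lev i - win N l \<beta> i \<le> lev i * exp (lev i) * fprod N (window l i) \<beta>"
        by (rule win_chernoff[OF \<beta>]) (use lin_bounds[of N i] in \<open>simp add: lev_def\<close>)
      then have "2 / real l * (lev i - win N l \<beta> i) \<le> 2 / real l * (lev i * exp (lev i) * fprod N (window l i) \<beta>)"
        by (intro mult_left_mono) auto
      then have "- 2 / real l * win N l \<beta> i \<le> E - lin N i / 32"
        unfolding E_def lev_def using l1 by (simp add: field_simps)
      then have "(\<nu> i)\<^sup>2 * (- 2 / real l * win N l \<beta> i) \<le> (\<nu> i)\<^sup>2 * (E - lin N i / 32)"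
        by (rule mult_left_mono) simp
      also have "\<dots> \<le> E - lin N i * (\<nu> i)\<^sup>2 / 32"
      proof -
        have "0 \<le> \<nu> i" "\<nu> i \<le> 1" using dstates_nu_le_1[of \<beta> \<zeta> \<nu> N i] z i by (auto simp: zz dstates_def)
        then have "(\<nu> i)\<^sup>2 \<le> 1" by (simp add: power_le_one)
        then have "(\<nu> i)\<^sup>2 * E \<le> 1 * E" using E by (intro mult_right_mono)
        then show ?thesis by (simp add: algebra_simps)
      qed
      finally show ?thesis using True by (simp add: E_def good_def)
    next
      case False
      then have "lin N i < 1 / real n" using i by (auto simp: good_def)
      moreover have "0 \<le> (\<nu> i)\<^sup>2 * (2 / real l * win N l \<beta> i)" using win_nonneg[of N l \<beta> i] by simp
      ultimately show ?thesis using False by (simp add: algebra_simps)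
    qed
    finally show "(\<nu> i)\<^sup>2 * ((if N + 1 - i \<le> l then real l else 0) - 2 / real l * win N l \<beta> i)
        + (\<nu> i)\<^sup>2 * (- src (N + 1 - i)) \<le> - (lin N i * (\<nu> i)\<^sup>2 / 32)
      + (if i \<in> good then lin N i / 32 * exp (lev i) * fprod N (window l i) \<beta> else 0)" .
  qed
  also have "\<dots> = - sqmass N (lin N) z / 32 + err \<beta>"
  proof -
    have "(\<Sum>i\<in>{1..N}. if i \<in> good then lin N i / 32 * exp (lev i) * fprod N (window l i) \<beta> else 0) = err \<beta>"
      unfolding err_def by (rule sum.mono_neutral_cong_right) (auto simp: good_def)
    then show ?thesis unfolding sum.distrib
      by (simp add: sqmass_def zz sum_negf sum_divide_distrib)
  qed
  finally show ?thesis by (simp add: zz)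
qed

lemma src_sum_le: "(\<Sum>m\<in>{1..N}. src m) \<le> real (N + 1) / (32 * (real n)\<^sup>2) + (real l)\<^sup>2"
proof -
  define y where "y = real (N + 1) / real n"
  have y: "0 \<le> y" by (simp add: y_def)
  have "(\<Sum>m\<in>{1..N}. if real m / real (N + 1) < 1 / real n then real m / real (N + 1) / 32 else 0) \<le>
      (\<Sum>m\<in>{1..N}. if m \<in> {1..nat \<lfloor>y\<rfloor>} then 1 / (32 * real n) else 0)"
  proof (rule sum_mono)
    fix m assume m: "m \<in> {1..N}"
    have "m \<le> nat \<lfloor>y\<rfloor>" if "real m / real (N + 1) < 1 / real n"
    proof -
      have "real m \<le> y" using that n by (simp add: y_def field_simps)
      then show ?thesis by (simp add: le_nat_floor)
    qed
    then show "(if real m / real (N + 1) < 1 / real n then real m / real (N + 1) / 32 else 0) \<le>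
        (if m \<in> {1..nat \<lfloor>y\<rfloor>} then 1 / (32 * real n) else 0)"
    proof (cases "real m / real (N + 1) < 1 / real n")
      case True
      then have "real m / real (N + 1) / 32 \<le> 1 / real n / 32" by (intro divide_right_mono) auto
      moreover have "1 / real n / 32 = 1 / (32 * real n)" by simp
      moreover have "m \<in> {1..nat \<lfloor>y\<rfloor>}" using True \<open>_ \<Longrightarrow> m \<le> nat \<lfloor>y\<rfloor>\<close> m by simp
      ultimately show ?thesis using True by simp
    qed simp
  qed
  also have "\<dots> \<le> (\<Sum>m\<in>{1..nat \<lfloor>y\<rfloor>}. 1 / (32 * real n))"
    by (subst sum.inter_restrict[symmetric]) (auto intro!: sum_mono2 divide_right_mono)
  also have "\<dots> = real (nat \<lfloor>y\<rfloor>) / (32 * real n)" by simp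
  also have "\<dots> \<le> y / (32 * real n)" using y by (intro divide_right_mono) auto
  also have "\<dots> = real (N + 1) / (32 * (real n)\<^sup>2)" using n by (simp add: y_def power2_eq_square)
  finally have 1: "(\<Sum>m\<in>{1..N}. if real m / real (N + 1) < 1 / real n then real m / real (N + 1) / 32 else 0)
      \<le> real (N + 1) / (32 * (real n)\<^sup>2)" .
  have "(\<Sum>m\<in>{1..N}. if m \<le> l then real l else 0) = (\<Sum>m\<in>{1..N} \<inter> {m. m \<le> l}. real l)"
    by (subst sum.inter_restrict) auto
  also have "\<dots> \<le> (\<Sum>m\<in>{1..l}. real l)" by (rule sum_mono2) auto
  also have "\<dots> = (real l)\<^sup>2" by (simp add: power2_eq_square)
  finally show ?thesis using 1 by (simp add: src_def sum.distrib)
qed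

text \<open>The bound by \<open>sqmass N (lin N)\<close> itself closes a recursion.
  \<open>green\<close> is at most \<open>lin\<close> times the total source over \<open>N\<close>,
  up to constants, and both parts of \<open>src\<close> have total size O(N / n^2); the constant
  17/8 is rounded to 3.\<close>

lemma lyap_le:
  assumes z: "z \<in> dstates N"
  shows "lyap z \<le> 4 / real N + 3 / (real n)\<^sup>2 * sqmass N (lin N) z"
proof -
  obtain \<beta> \<zeta> \<nu> where zz: "z = (\<beta>, \<zeta>, \<nu>)" by (cases z)
  have Np: "0 < real N" and lp: "0 < real l" "1 \<le> real l" using N_ge l_ge by auto
  have n1: "1 \<le> (real n)\<^sup>2" using n by simp
  have lN: "(real l)\<^sup>2 \<le> real N / (real n)\<^sup>2" using l_sq n by (simp add: field_simps)
  also have "\<dots> \<le> real N / 1" using n1 Np n by (intro divide_left_mono) auto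
  finally have lN': "(real l)\<^sup>2 \<le> real N" by simp
  have "meetF N z \<le> real N" using meet_bounds(2)[of \<nu> N] z by (auto simp: meetF_def zz dstates_def)
  then have "2 * (real l - 1) * meetF N z \<le> 2 * real l * real N"
    using lp Np meet_bounds(1)[of \<nu> N] z by (intro mult_mono) (auto simp: meetF_def zz dstates_def)
  moreover have "holeF N l z \<le> 2 * real l * real N"
  proof -
    have "holeF N l z \<le> 2 * real l * (real l)\<^sup>2" using holeF_bounds(2)[OF z, of l] by (simp add: power_numeral_reduce)
    also have "\<dots> \<le> 2 * real l * real N" using lN' lp by (intro mult_left_mono) auto
    finally show ?thesis .
  qed
  ultimately have "1 / (real l * (real N)\<^sup>2) * (2 * (real l - 1) * meetF N z + holeF N l z) \<le>
      1 / (real l * (real N)\<^sup>2) * (2 * real l * real N + 2 * real l * real N)"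
    by (intro mult_left_mono add_mono) auto
  also have "\<dots> = 4 / real N" using Np lp by (simp add: power2_eq_square field_simps)
  finally have 1: "1 / (real l * (real N)\<^sup>2) * (2 * (real l - 1) * meetF N z + holeF N l z) \<le> 4 / real N" .
  have "green N src k \<le> 3 / (real n)\<^sup>2 * lin N k" for k
  proof -
    have "green N src k \<le> real (N + 1 - k) * (\<Sum>m\<in>{1..N}. src m) / (real N)\<^sup>2"
      by (rule green_le[OF src_nonneg])
    also have "\<dots> = lin N k * (real (N + 1) * (\<Sum>m\<in>{1..N}. src m) / (real N)\<^sup>2)"
      by (simp add: lin_def del: of_nat_add)
    also have "\<dots> \<le> lin N k * (3 / (real n)\<^sup>2)"
    proof (intro mult_left_mono lin_bounds)
      have "(\<Sum>m\<in>{1..N}. src m) \<le> 2 * real N / (32 * (real n)\<^sup>2) + real N / (real n)\<^sup>2"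
      proof -
        have "real (N + 1) / (32 * (real n)\<^sup>2) \<le> 2 * real N / (32 * (real n)\<^sup>2)"
          using N_ge by (intro divide_right_mono) auto
        then show ?thesis using src_sum_le lN by linarith
      qed
      also have "\<dots> = 17 / 16 * (real N / (real n)\<^sup>2)" by simp
      finally have "real (N + 1) * (\<Sum>m\<in>{1..N}. src m) \<le> (2 * real N) * (17 / 16 * (real N / (real n)\<^sup>2))"
        using N_ge by (intro mult_mono sum_nonneg src_nonneg) auto
      also have "\<dots> = 17 / 8 * ((real N)\<^sup>2 / (real n)\<^sup>2)" by (simp add: power2_eq_square)
      also have "\<dots> \<le> 3 * ((real N)\<^sup>2 / (real n)\<^sup>2)" by (intro mult_right_mono) auto
      also have "\<dots> = 3 / (real n)\<^sup>2 * (real N)\<^sup>2" by simp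
      finally show "real (N + 1) * (\<Sum>m\<in>{1..N}. src m) / (real N)\<^sup>2 \<le> 3 / (real n)\<^sup>2"
        using Np by (simp add: pos_divide_le_eq)
    qed
    finally show ?thesis by (simp add: mult.commute)
  qed
  then have "sqmass N (green N src) z \<le> (\<Sum>k\<in>{1..N}. 3 / (real n)\<^sup>2 * lin N k * (\<nu> k)\<^sup>2)"
    unfolding sqmass_def zz prod.case by (intro sum_mono mult_right_mono) auto
  also have "\<dots> = 3 / (real n)\<^sup>2 * sqmass N (lin N) z"
    by (simp add: sqmass_def zz sum_distrib_left mult.assoc)
  finally show ?thesis unfolding lyap_def using 1 by simp
qed

lemma lyap_nonneg:
  assumes z: "z \<in> dstates N"
  shows "0 \<le> lyap z"
proof -
  obtain \<beta> \<zeta> \<nu> where zz: "z = (\<beta>, \<zeta>, \<nu>)" by (cases z)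
  have "0 \<le> meetF N z" using meet_bounds(1)[of \<nu> N] z by (auto simp: meetF_def zz dstates_def)
  moreover have "0 \<le> sqmass N (green N src) z" unfolding sqmass_def zz prod.case
    by (intro sum_nonneg mult_nonneg_nonneg green_nonneg src_nonneg) auto
  ultimately show ?thesis unfolding lyap_def using holeF_bounds(1)[OF z, of l] l_ge by simp
qed

lemma sqmass_lin_antimono:
  assumes z: "z \<in> dstates N" and st: "0 \<le> s" "s \<le> t"
  shows "sgp (dgen N q) t (sqmass N (lin N)) z \<le> sgp (dgen N q) s (sqmass N (lin N)) z"
proof (rule D.sgp_antimono[OF bounded_sqmass z st])
  fix x assume "x \<in> dstates N"
  have "dgen N q (sqmass N (lin N)) x \<le> sqmass N (klap N (lin N)) x"
    by (rule dgen_sqmass_le) (use N_ge lin_bounds in auto)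
  also have "\<dots> \<le> 0" unfolding sqmass_def
    by (cases x) (auto intro!: sum_nonpos mult_nonpos_nonneg simp: klap_lin)
  finally show "dgen N q (sqmass N (lin N)) x \<le> 0" .
qed

text \<open>Integrate the drift of \<open>lyap\<close> over a unit of time. The weighted square mass
  is nonincreasing, so its value at the end bounds the integral from below, and \<open>lyap\<close>
  is nonnegative at the end; multiplying by 32 gives the constants.\<close>

lemma sqmass_lin_step:
  assumes z: "z \<in> dstates N" and s: "1 \<le> s"
  shows "sgp (dgen N q) (s + 1) (sqmass N (lin N)) z \<le>
    32 * (4 / real N + real N * exp (- (real n)\<^sup>2 / 64)) + 96 / (real n)\<^sup>2 * sgp (dgen N q) s (sqmass N (lin N)) z"
proof -
  let ?P = "sgp (dgen N q)" and ?W = "sqmass N (lin N)"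
  define e where "e = real N * exp (- (real n)\<^sup>2 / 64)"
  have bErr: "bounded_fn (dstates N) (\<lambda>z. err (fst z))"
  proof -
    obtain K where K: "\<And>x. x \<in> configs N \<Longrightarrow> \<bar>err x\<bar> \<le> K"
      using bounded_fn_finite[OF finite_configs, of N err] unfolding bounded_fn_def by blast
    show ?thesis by (rule bounded_fnI[of _ _ K]) (auto simp: dstates_def intro: K)
  qed
  have "?P (s + 1) lyap z \<le> ?P s lyap z + (- ?P (s + 1) ?W z / 32 + e) * (s + 1 - s)"
  proof (rule D.sgp_le_deriv[OF bounded_lyap z])
    fix r assume r: "s \<le> r" "r \<le> s + 1"
    have "?P r (dgen N q lyap) z \<le> ?P r (\<lambda>x. (- 1 / 32) * ?W x + err (fst x)) z"
      using dgen_lyap_le r s by (intro D.sgp_mono D.bounded_L bounded_lyap bounded_fn_lin bounded_sqmass bErr z) auto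
    also have "\<dots> = (- 1 / 32) * ?P r ?W z + ?P r (\<lambda>x. err (fst x)) z"
      by (rule D.sgp_lin[OF bounded_sqmass bErr z])
    also have "\<dots> \<le> - ?P (s + 1) ?W z / 32 + e"
      using sqmass_lin_antimono[OF z, of r "s + 1"] err_semigroup_le[OF z, of r] r s by (simp add: e_def)
    finally show "?P r (dgen N q lyap) z \<le> - ?P (s + 1) ?W z / 32 + e" .
  qed simp
  moreover have "0 \<le> ?P (s + 1) lyap z"
    using s by (intro D.sgp_nonneg bounded_lyap z lyap_nonneg) auto
  moreover have "?P s lyap z \<le> 4 / real N + 3 / (real n)\<^sup>2 * ?P s ?W z"
  proof -
    have "?P s lyap z \<le> ?P s (\<lambda>x. 3 / (real n)\<^sup>2 * ?W x + 4 / real N) z"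
      using lyap_le s by (intro D.sgp_mono bounded_lyap bounded_fn_lin bounded_sqmass bounded_fn_const z)
        (auto simp: add.commute)
    also have "\<dots> = 3 / (real n)\<^sup>2 * ?P s ?W z + ?P s (\<lambda>_. 4 / real N) z"
      by (rule D.sgp_lin[OF bounded_sqmass bounded_fn_const z])
    also have "?P s (\<lambda>_. 4 / real N) z \<le> 4 / real N"
      using s by (intro D.sgp_le_const[OF bounded_fn_const z]) auto
    finally show ?thesis by simp
  qed
  ultimately show ?thesis by (simp add: e_def field_simps)
qed

end

lemma power_le_fact_exp:
  fixes x :: real
  assumes "0 \<le> x"
  shows "x ^ k \<le> fact k * exp x"
proof -
  have "x ^ k /\<^sub>R fact k = (\<Sum>n\<in>{k}. x ^ n /\<^sub>R fact n)" by simp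
  also have "\<dots> \<le> (\<Sum>n. x ^ n /\<^sub>R fact n)"
    by (rule sum_le_suminf[OF summable_exp_generic]) (use assms in auto)
  finally show ?thesis by (simp add: exp_def field_simps)
qed

text \<open>The recursion runs from time 1, where the trivial bound 1 holds, to time 5, gaining
  \<open>d = 1 / n^2\<close> per step. During the last unit the weight \<open>lin\<close> is
  exchanged for 1.\<close>

lemma sqmass_spread:
  "\<exists>C>0. \<forall>N q. \<forall>z\<in>dstates N. 1 \<le> N \<longrightarrow> q \<in> {0..1} \<longrightarrow> sgp (dgen N q) 6 (sqmass N (\<lambda>_. 1)) z \<le> C / real N"
proof -
  \<comment> \<open>From \<open>N \<le> 2^8 n^8\<close> and \<open>x^8 \<le> fact 8 * exp x\<close>
    at \<open>x = n^2 / 64\<close>: the squared \<open>N\<close> is at most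
    \<open>K * exp x\<close>, so the error is O(1/N). \<open>C\<close> sums the four steps of the
    recursion, and its factor 2 comes from \<open>u \<le> 2 * lin\<close> below.\<close>
  define K :: real where "K = 2 ^ 16 * 64 ^ 8 * fact 8"
  define a where "a = 32 * (4 + K)"
  define C where "C = 2 * (a * (1 + 96 + 96 ^ 2 + 96 ^ 3) + 96 ^ 4 * 2 ^ 8)"
  have K: "0 < K" by (simp add: K_def)
  then have a: "0 < a" by (simp add: a_def)
  then have C: "256 < C" by (simp add: C_def add_pos_pos)
  have "sgp (dgen N q) 6 (sqmass N (\<lambda>_. 1)) z \<le> C / real N"
    if N: "1 \<le> N" and q: "q \<in> {0..1}" and z: "z \<in> dstates N" for N q z
  proof -
    interpret D: subgen "dstates N" "dgen N q" "drate N" by (rule dgen_subgen[OF N q])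
    let ?P = "sgp (dgen N q)"
    have sq1: "0 \<le> sqmass N u x \<and> sqmass N u x \<le> 1"
      if x: "x \<in> dstates N" and u: "\<And>k. 0 \<le> u k \<and> u k \<le> 1" for u x
    proof -
      obtain \<beta> \<zeta> \<nu> where xx: "x = (\<beta>, \<zeta>, \<nu>)" by (cases x)
      have "(\<Sum>k\<in>{1..N}. u k * (\<nu> k)\<^sup>2) \<le> (\<Sum>k\<in>{1..N}. \<nu> k)"
      proof (rule sum_mono)
        fix k assume k: "k \<in> {1..N}"
        have "0 \<le> \<nu> k" "\<nu> k \<le> 1" using dstates_nu_le_1[of \<beta> \<zeta> \<nu> N k] x k by (auto simp: xx dstates_def)
        then have "(\<nu> k)\<^sup>2 \<le> \<nu> k" by (simp add: power2_eq_square mult_left_le)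
        moreover have "u k * (\<nu> k)\<^sup>2 \<le> 1 * (\<nu> k)\<^sup>2" using u[of k] by (intro mult_right_mono) auto
        ultimately show "u k * (\<nu> k)\<^sup>2 \<le> \<nu> k" by simp
      qed
      then show ?thesis using x u by (auto simp: sqmass_def xx dstates_def intro!: sum_nonneg)
    qed
    show ?thesis
    proof (cases "N < 256")
      case True
      have "?P 6 (sqmass N (\<lambda>_. 1)) z \<le> 1"
        using sq1[of _ "\<lambda>_. 1"] by (intro D.sgp_le_const[OF bounded_sqmass z]) auto
      also have "1 \<le> C / real N" using True C N by (simp add: field_simps)
      finally show ?thesis .
    next
      case False
      \<comment> \<open>The integer part of the eighth root of \<open>N\<close>;
        \<open>N \<ge> 256\<close> guarantees \<open>n \<ge> 2\<close>.\<close>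
      define n where "n = (LEAST n. N < (n + 1) ^ 8)"
      have ex: "N < (N + 1) ^ 8" using self_le_power[of "N + 1" 8] by simp
      have n1: "N < (n + 1) ^ 8" unfolding n_def using LeastI[of "\<lambda>n. N < (n + 1) ^ 8" N] ex by simp
      have n2: "2 \<le> n"
      proof (rule ccontr)
        assume "\<not> 2 \<le> n"
        then have "(n + 1) ^ 8 \<le> 2 ^ 8" by (intro power_mono) auto
        then show False using n1 False by simp
      qed
      have nN: "n ^ 8 \<le> N"
      proof (rule ccontr)
        assume "\<not> n ^ 8 \<le> N"
        then have "N < ((n - 1) + 1) ^ 8" using n2 by simp
        then have "n \<le> n - 1" unfolding n_def by (rule Least_le)
        then show False using n2 by simp
      qed
      interpret scales N n "n ^ 3" q by standard (use n2 nN q in auto)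
      have Np: "0 < real N" using N by simp
      have N2: "real N \<le> 2 ^ 8 * real n ^ 8"
      proof -
        have "(n + 1) ^ 8 \<le> (2 * n) ^ 8" using n2 by (intro power_mono) auto
        then have "N \<le> 2 ^ 8 * n ^ 8" using n1 by (simp add: power_mult_distrib)
        then have "real N \<le> real (2 ^ 8 * n ^ 8)" by (simp only: of_nat_le_iff)
        then show ?thesis by simp
      qed
      have e: "real N * exp (- (real n)\<^sup>2 / 64) \<le> K / real N"
      proof -
        have "(real N)\<^sup>2 \<le> (2 ^ 8 * real n ^ 8)\<^sup>2" using N2 by (intro power_mono) auto
        also have "\<dots> = 2 ^ 16 * 64 ^ 8 * ((real n)\<^sup>2 / 64) ^ 8"
          by (simp add: power_mult_distrib power_divide flip: power_mult)
        also have "\<dots> \<le> 2 ^ 16 * 64 ^ 8 * (fact 8 * exp ((real n)\<^sup>2 / 64))"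
          by (intro mult_left_mono power_le_fact_exp) auto
        finally have "(real N)\<^sup>2 \<le> K * exp ((real n)\<^sup>2 / 64)" by (simp only: K_def mult.assoc)
        then show ?thesis using Np by (simp add: exp_minus field_simps power2_eq_square)
      qed
      define \<omega> where "\<omega> = (\<lambda>s. ?P s (sqmass N (lin N)) z)"
      define d where "d = 1 / (real n)\<^sup>2"
      have d: "0 \<le> d" "d \<le> 1" using n2 by (auto simp: d_def)
      define A where "A = a / real N"
      have step: "\<omega> (s + 1) \<le> A + 96 * d * \<omega> s" if "1 \<le> s" for s
        using sqmass_lin_step[OF z that] e by (simp add: \<omega>_def a_def A_def d_def add_divide_distrib)
      have w1: "\<omega> 1 \<le> 1" unfolding \<omega>_def
        using sq1[of _ "lin N"] lin_bounds by (intro D.sgp_le_const[OF bounded_sqmass z]) auto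
      have mono: "96 * d * x \<le> 96 * d * y" if "x \<le> y" for x y
        using that d by (intro mult_left_mono) auto
      have aN: "0 \<le> A" using a by (simp add: A_def)
      have le: "96 * d * (A * c) \<le> 96 * (A * c)" if "0 \<le> c" for c
      proof -
        have "d * (96 * (A * c)) \<le> 1 * (96 * (A * c))"
          by (rule mult_right_mono[OF d(2)], intro mult_nonneg_nonneg aN that) simp
        then show ?thesis by (simp add: mult_ac)
      qed
      have w2: "\<omega> 2 \<le> A + 96 * d"
        using step[of 1] mono[OF w1] by simp
      have w3: "\<omega> 3 \<le> A * (1 + 96) + (96 * d) ^ 2"
        using step[of 2] mono[OF w2] le[of 1] by (simp add: distrib_left power2_eq_square algebra_simps)
      have w4: "\<omega> 4 \<le> A * (1 + 96 + 96 ^ 2) + (96 * d) ^ 3"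
        using step[of 3] mono[OF w3] le[of "1 + 96"] by (simp add: power2_eq_square power3_eq_cube algebra_simps)
      have w5: "\<omega> 5 \<le> A * (1 + 96 + 96 ^ 2 + 96 ^ 3) + (96 * d) ^ 4"
        using step[of 4] mono[OF w4] le[of "1 + 96 + 96 ^ 2"] by (simp add: power_numeral_reduce algebra_simps)
      have "d ^ 4 \<le> 2 ^ 8 / real N"
      proof -
        have "d ^ 4 = 1 / real n ^ 8" by (simp add: d_def power_divide flip: power_mult)
        also have "\<dots> \<le> 2 ^ 8 / real N" using N2 Np n2 by (simp add: field_simps)
        finally show ?thesis .
      qed
      then have "(96 * d) ^ 4 \<le> 96 ^ 4 * (2 ^ 8 / real N)" unfolding power_mult_distrib by (rule mult_left_mono) simp
      then have w5': "\<omega> 5 \<le> C / 2 / real N" using w5 by (simp add: C_def A_def add_divide_distrib mult.commute)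
      \<comment> \<open>A function with \<open>klap N u \<le> - 1\<close> and
        \<open>u \<le> 2 * lin\<close>: the unweighted square mass, integrated over the last unit of
        time, is at most the \<open>u\<close>-weighted one at time 5.\<close>
      define u where "u = green N (\<lambda>_. 1)"
      have u0: "0 \<le> u k" for k unfolding u_def by (rule green_nonneg) simp
      have u: "u k \<le> 2 * lin N k" for k
      proof -
        have "u k \<le> real (N + 1 - k) * (1 / real N)"
          unfolding u_def using green_le[of "\<lambda>_. 1" N k] Np by (simp add: power2_eq_square)
        also have "\<dots> \<le> real (N + 1 - k) * (2 / real (N + 1))"
          using N by (intro mult_left_mono) (auto simp: field_simps)
        finally show ?thesis by (simp add: lin_def mult.commute)
      qed
      have Lu: "dgen N q (sqmass N u) x \<le> (- 1) * sqmass N (\<lambda>_. 1) x" for x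
      proof -
        have "dgen N q (sqmass N u) x \<le> sqmass N (klap N u) x" by (rule dgen_sqmass_le[OF N u0])
        also have "\<dots> \<le> (- 1) * sqmass N (\<lambda>_. 1) x"
        proof (cases x)
          case (fields \<beta> \<zeta> \<nu>)
          have "klap N u k * (\<nu> k)\<^sup>2 \<le> (- 1) * (\<nu> k)\<^sup>2" if "k \<in> {1..N}" for k
            using klap_green_le[of "\<lambda>_. 1" k N] that unfolding u_def by (intro mult_right_mono) auto
          then show ?thesis unfolding fields sqmass_def prod.case sum_distrib_left by (intro sum_mono) simp
        qed
        finally show ?thesis .
      qed
      have V_mono: "?P 6 (sqmass N (\<lambda>_. 1)) z \<le> ?P r (sqmass N (\<lambda>_. 1)) z" if "0 \<le> r" "r \<le> 6" for r
      proof (rule D.sgp_antimono[OF bounded_sqmass z that])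
        fix x assume "x \<in> dstates N"
        have "dgen N q (sqmass N (\<lambda>_. 1)) x \<le> sqmass N (klap N (\<lambda>_. 1)) x" by (rule dgen_sqmass_le[OF N]) simp
        also have "\<dots> \<le> 0" unfolding sqmass_def
          by (cases x) (auto intro!: sum_nonpos mult_nonpos_nonneg K.L_one)
        finally show "dgen N q (sqmass N (\<lambda>_. 1)) x \<le> 0" .
      qed
      have "?P 6 (sqmass N u) z \<le> ?P 5 (sqmass N u) z + (- ?P 6 (sqmass N (\<lambda>_. 1)) z) * (6 - 5)"
      proof (rule D.sgp_le_deriv[OF bounded_sqmass z])
        fix r :: real assume r: "5 \<le> r" "r \<le> 6"
        have "?P r (dgen N q (sqmass N u)) z \<le> ?P r (\<lambda>x. (- 1) * sqmass N (\<lambda>_. 1) x) z"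
          using Lu r by (intro D.sgp_mono D.bounded_L bounded_sqmass bounded_fn_cmult z) auto
        also have "\<dots> = (- 1) * ?P r (sqmass N (\<lambda>_. 1)) z" by (rule D.sgp_cmult[OF bounded_sqmass z])
        finally show "?P r (dgen N q (sqmass N u)) z \<le> - ?P 6 (sqmass N (\<lambda>_. 1)) z"
          using V_mono[of r] r by simp
      qed simp
      moreover have "0 \<le> ?P 6 (sqmass N u) z"
        using u0 by (intro D.sgp_nonneg[OF bounded_sqmass z]) (auto simp: sqmass_def intro!: sum_nonneg)
      moreover have "?P 5 (sqmass N u) z \<le> 2 * \<omega> 5"
      proof -
        have "sqmass N u x \<le> 2 * sqmass N (lin N) x" for x
          unfolding sqmass_def by (cases x) (auto simp: sum_distrib_left mult.assoc[symmetric] intro!: sum_mono mult_right_mono u)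
        then have "?P 5 (sqmass N u) z \<le> ?P 5 (\<lambda>x. 2 * sqmass N (lin N) x) z"
          by (intro D.sgp_mono bounded_sqmass bounded_fn_cmult z) auto
        then show ?thesis unfolding \<omega>_def D.sgp_cmult[OF bounded_sqmass z] .
      qed
      ultimately show ?thesis using w5' by simp
    qed
  qed
  then show ?thesis using C by (intro exI[of _ C]) auto
qed

subsection \<open>Convergence to the stationary law\<close>

lemma config_telescope:
  assumes grad: "\<And>\<xi> x. \<xi> \<in> configs N \<Longrightarrow> x \<in> {1..N} \<Longrightarrow> \<bar>\<psi> (\<xi>(x := 1)) - \<psi> (\<xi>(x := 0))\<bar> \<le> g x"
    and \<eta>: "\<eta> \<in> configs N" "\<eta>' \<in> configs N"
  shows "\<bar>\<psi> \<eta> - \<psi> \<eta>' :: real\<bar> \<le> (\<Sum>x\<in>{1..N}. g x)"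
proof -
  have "\<forall>\<eta>. \<eta> \<in> configs N \<longrightarrow> (\<forall>k. k \<notin> A \<longrightarrow> \<eta> k = \<eta>' k) \<longrightarrow> \<bar>\<psi> \<eta> - \<psi> \<eta>'\<bar> \<le> (\<Sum>x\<in>A. g x)"
    if "finite A" "A \<subseteq> {1..N}" for A
    using that
  proof (induction A rule: finite_induct)
    case empty
    show ?case by (auto simp: fun_eq_iff[symmetric])
  next
    case (insert x A)
    show ?case
    proof (intro allI impI)
      fix \<eta> assume \<eta>: "\<eta> \<in> configs N" "\<forall>k. k \<notin> insert x A \<longrightarrow> \<eta> k = \<eta>' k"
      have x: "x \<in> {1..N}" using insert by auto
      let ?\<eta> = "\<eta>(x := \<eta>' x)"
      have "?\<eta> \<in> configs N" by (rule configs_upd[OF \<eta>(1) x]) (use configs_01[OF assms(3) x] in auto)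
      then have "\<bar>\<psi> ?\<eta> - \<psi> \<eta>'\<bar> \<le> (\<Sum>x\<in>A. g x)" using insert \<eta>(2) by auto
      moreover have "\<bar>\<psi> \<eta> - \<psi> ?\<eta>\<bar> \<le> g x"
      proof -
        have "0 \<le> g x" using grad[OF \<eta>(1) x] by linarith
        then show ?thesis using configs_01[OF \<eta>(1) x] configs_01[OF assms(3) x] grad[OF \<eta>(1) x]
          by (auto simp: abs_minus_commute fun_upd_idem)
      qed
      ultimately show "\<bar>\<psi> \<eta> - \<psi> \<eta>'\<bar> \<le> (\<Sum>x\<in>insert x A. g x)" using insert by simp
    qed
  qed
  moreover have "\<eta> k = \<eta>' k" if "k \<notin> {1..N}" for k
    using that \<eta> by (auto simp: configs_def PiE_iff extensional_def)
  ultimately show ?thesis using \<eta> by (metis finite_atLeastAtMost subset_refl)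
qed

text \<open>Changing one site at a time and bounding each change by \<open>alive\<close> sums to
  \<open>survivors\<close>: the expected number of discrepancies between two arbitrary starts is at
  most that between the full and the empty one.\<close>

lemma ssep_osc:
  assumes N: "1 \<le> N" and pq: "p \<in> {0..1}" "q \<in> {0..1}" and t: "0 \<le> t"
    and \<phi>: "\<And>\<xi> y. \<xi> \<in> configs N \<Longrightarrow> y \<in> {1..N} \<Longrightarrow> \<bar>\<phi> (\<xi>(y := 1)) - \<phi> (\<xi>(y := 0))\<bar> \<le> G"
    and \<eta>: "\<eta> \<in> configs N" "\<eta>' \<in> configs N"
  shows "\<bar>ssep_semigroup N p q t \<phi> \<eta> - ssep_semigroup N p q t \<phi> \<eta>'\<bar> \<le> G * survivors N t"
  unfolding survivors_def sum_distrib_left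
  by (rule config_telescope[OF _ \<eta>]) (rule ssep_gradient_alive[OF N pq t _ _ \<phi>])

lemma gradient_bound_ex:
  obtains G :: real where "0 \<le> G"
    "\<And>\<xi> y. \<xi> \<in> configs N \<Longrightarrow> y \<in> {1..N} \<Longrightarrow> \<bar>\<phi> (\<xi>(y := 1)) - \<phi> (\<xi>(y := 0))\<bar> \<le> G"
proof -
  obtain K where K: "0 \<le> K" "\<And>x. x \<in> configs N \<Longrightarrow> \<bar>\<phi> x\<bar> \<le> K"
    using bounded_fnD[OF bounded_fn_finite[OF finite_configs], of N \<phi>] by blast
  have "\<bar>\<phi> (\<xi>(y := 1)) - \<phi> (\<xi>(y := 0))\<bar> \<le> 2 * K" if "\<xi> \<in> configs N" "y \<in> {1..N}" for \<xi> y
    using K(2)[OF configs_upd[OF that, of 1]] K(2)[OF configs_upd[OF that, of 0]] by simp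
  then show thesis using that[of "2 * K"] K(1) by simp
qed

lemma survivors_le: "1 \<le> N \<Longrightarrow> 0 \<le> t \<Longrightarrow> survivors N t \<le> 2 * exp (- t / 2) * real N"
  using survivors_decay[of N 0 t] by (simp add: survivors_def alive_def)

lemma survivors_nonneg: "0 \<le> t \<Longrightarrow> 0 \<le> survivors N t"
  unfolding survivors_def by (intro sum_nonneg) (simp add: alive_bounds)

lemma survivors_null: "1 \<le> N \<Longrightarrow> (\<lambda>n. survivors N (real n)) \<longlonglongrightarrow> 0"
proof (rule Lim_null_comparison)
  assume N: "1 \<le> N"
  show "\<forall>\<^sub>F n in sequentially. norm (survivors N (real n)) \<le> 2 * exp (- real n / 2) * real N"
    using survivors_le[OF N] survivors_nonneg by simp
  have "(\<lambda>n. exp (- 1 / 2 :: real) ^ n) \<longlonglongrightarrow> 0" by (rule LIMSEQ_realpow_zero) auto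
  then have "(\<lambda>n. exp (- real n / 2)) \<longlonglongrightarrow> 0" by (simp flip: exp_of_nat_mult)
  then have "(\<lambda>n. 2 * exp (- real n / 2) * real N) \<longlonglongrightarrow> 2 * 0 * real N" by (intro tendsto_intros)
  then show "(\<lambda>n. 2 * exp (- real n / 2) * real N) \<longlonglongrightarrow> 0" by simp
qed

definition mean :: "nat \<Rightarrow> (nat \<Rightarrow> nat) pmf \<Rightarrow> ((nat \<Rightarrow> nat) \<Rightarrow> real) \<Rightarrow> real" where
  "mean N \<pi> \<phi> = (\<Sum>\<eta>\<in>configs N. pmf \<pi> \<eta> * \<phi> \<eta>)"

lemma mean_expectation:
  "set_pmf \<pi> \<subseteq> configs N \<Longrightarrow> measure_pmf.expectation \<pi> \<phi> = mean N \<pi> \<phi>"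
  unfolding mean_def by (subst integral_measure_pmf_real[OF finite_configs]) (auto simp: mult.commute)

lemma mean_one: "set_pmf \<pi> \<subseteq> configs N \<Longrightarrow> mean N \<pi> (\<lambda>_. 1) = 1"
  using mean_expectation[of \<pi> N "\<lambda>_. 1"] by simp

lemma mean_mono: "(\<And>\<xi>. \<xi> \<in> configs N \<Longrightarrow> \<phi> \<xi> \<le> \<psi> \<xi>) \<Longrightarrow> mean N \<pi> \<phi> \<le> mean N \<pi> \<psi>"
  unfolding mean_def by (intro sum_mono mult_left_mono) auto

lemma mean_lin: "mean N \<pi> (\<lambda>\<xi>. a * \<phi> \<xi> + \<psi> \<xi>) = a * mean N \<pi> \<phi> + mean N \<pi> \<psi>"
  by (simp add: mean_def sum.distrib sum_distrib_left algebra_simps)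

lemma mean_const:
  assumes "set_pmf \<pi> \<subseteq> configs N"
  shows "mean N \<pi> (\<lambda>_. a) = a"
proof -
  have "mean N \<pi> (\<lambda>_. a) = a * mean N \<pi> (\<lambda>_. 1)" by (simp add: mean_def sum_distrib_left mult.commute)
  then show ?thesis using mean_one[OF assms] by simp
qed

lemma mean_close:
  assumes \<pi>: "set_pmf \<pi> \<subseteq> configs N" and le: "\<And>\<xi>. \<xi> \<in> configs N \<Longrightarrow> \<bar>\<phi> \<xi> - a\<bar> \<le> D"
  shows "\<bar>mean N \<pi> \<phi> - a\<bar> \<le> D"
proof -
  have "mean N \<pi> \<phi> \<le> mean N \<pi> (\<lambda>_. a + D)" using le by (intro mean_mono) (smt (verit))
  moreover have "mean N \<pi> (\<lambda>_. a - D) \<le> mean N \<pi> \<phi>" using le by (intro mean_mono) (smt (verit))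
  ultimately show ?thesis by (simp add: mean_const[OF \<pi>])
qed

lemma ssep_invariant_iff:
  assumes pq: "p \<in> {0..1}" "q \<in> {0..1}" and \<pi>: "set_pmf \<pi> \<subseteq> configs N"
  shows "ssep_invariant N p q \<pi> \<longleftrightarrow>
    (\<forall>t\<ge>0. \<forall>\<xi>. pmf \<pi> \<xi> = mean N \<pi> (ssep_semigroup N p q t (indicator {\<xi>})))"
proof -
  have "pmf (bind_pmf \<pi> (\<lambda>\<eta>. ssep_law N p q \<eta> t)) \<xi> = mean N \<pi> (ssep_semigroup N p q t (indicator {\<xi>}))"
    if "0 \<le> t" for t \<xi>
    unfolding pmf_bind mean_expectation[OF \<pi>] mean_def
    by (intro sum.cong refl) (simp add: pmf_ssep_law[OF pq _ that])
  then show ?thesis unfolding ssep_invariant_def using \<pi> by (auto simp: pmf_eq_iff)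
qed

lemma mean_invariant:
  assumes pq: "p \<in> {0..1}" "q \<in> {0..1}" and \<pi>: "ssep_invariant N p q \<pi>" and t: "0 \<le> t"
  shows "mean N \<pi> (ssep_semigroup N p q t \<phi>) = mean N \<pi> \<phi>"
proof -
  have \<pi>s: "set_pmf \<pi> \<subseteq> configs N" using \<pi> by (simp add: ssep_invariant_def)
  have "mean N \<pi> (ssep_semigroup N p q t \<phi>) =
      (\<Sum>\<eta>\<in>configs N. pmf \<pi> \<eta> * (\<Sum>\<xi>\<in>configs N. \<phi> \<xi> * ssep_semigroup N p q t (indicator {\<xi>}) \<eta>))"
    unfolding mean_def by (intro sum.cong refl) (simp add: ssep_semigroup_expand[OF pq, where \<phi> = \<phi>])
  also have "\<dots> = (\<Sum>\<xi>\<in>configs N. \<phi> \<xi> * mean N \<pi> (ssep_semigroup N p q t (indicator {\<xi>})))"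
    unfolding mean_def sum_distrib_left by (subst sum.swap) (simp add: mult_ac)
  also have "\<dots> = mean N \<pi> \<phi>"
    unfolding mean_def[of N \<pi> \<phi>]
    using \<pi> t unfolding ssep_invariant_iff[OF pq \<pi>s] by (intro sum.cong refl) (simp add: mult.commute)
  finally show ?thesis .
qed

lemma ssep_close_to_mean:
  assumes pq: "p \<in> {0..1}" "q \<in> {0..1}" and \<pi>: "ssep_invariant N p q \<pi>" and t: "0 \<le> t"
    and \<eta>: "\<eta> \<in> configs N"
    and D: "\<And>\<xi>. \<xi> \<in> configs N \<Longrightarrow> \<bar>ssep_semigroup N p q t \<phi> \<xi> - ssep_semigroup N p q t \<phi> \<eta>\<bar> \<le> D"
  shows "\<bar>ssep_semigroup N p q t \<phi> \<eta> - mean N \<pi> \<phi>\<bar> \<le> D"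
proof -
  have "set_pmf \<pi> \<subseteq> configs N" using \<pi> by (simp add: ssep_invariant_def)
  then have "\<bar>mean N \<pi> (ssep_semigroup N p q t \<phi>) - ssep_semigroup N p q t \<phi> \<eta>\<bar> \<le> D"
    by (rule mean_close) (rule D)
  then show ?thesis unfolding mean_invariant[OF pq \<pi> t] by (simp add: abs_minus_commute)
qed

lemma ssep_tendsto_mean:
  assumes N: "1 \<le> N" and pq: "p \<in> {0..1}" "q \<in> {0..1}" and \<pi>: "ssep_invariant N p q \<pi>"
    and \<eta>: "\<eta> \<in> configs N"
  shows "(\<lambda>n. ssep_semigroup N p q (real n) \<phi> \<eta>) \<longlonglongrightarrow> mean N \<pi> \<phi>"
proof -
  obtain G where G: "0 \<le> G" "\<And>\<xi> y. \<xi> \<in> configs N \<Longrightarrow> y \<in> {1..N} \<Longrightarrow> \<bar>\<phi> (\<xi>(y := 1)) - \<phi> (\<xi>(y := 0))\<bar> \<le> G"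
    using gradient_bound_ex[of N \<phi>] by blast
  have "(\<lambda>n. ssep_semigroup N p q (real n) \<phi> \<eta> - mean N \<pi> \<phi>) \<longlonglongrightarrow> 0"
  proof (rule Lim_null_comparison)
    show "\<forall>\<^sub>F n in sequentially. norm (ssep_semigroup N p q (real n) \<phi> \<eta> - mean N \<pi> \<phi>) \<le> G * survivors N (real n)"
      using ssep_close_to_mean[OF pq \<pi> _ \<eta> ssep_osc[OF N pq _ G(2) _ \<eta>]] by simp
    show "(\<lambda>n. G * survivors N (real n)) \<longlonglongrightarrow> 0"
      using tendsto_mult[OF tendsto_const survivors_null[OF N], of G] by simp
  qed
  then show ?thesis by (rule LIM_zero_cancel)
qed

lemma full_config_configs: "full_config N \<in> configs N"
  by (auto simp: full_config_def configs_def)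

text \<open>The laws from one start at integer times converge because oscillations decay like
  \<open>survivors\<close>. The limit is invariant because a shift by \<open>t\<close> does not
  change it.\<close>

lemma ssep_invariant_ex:
  assumes N: "1 \<le> N" and pq: "p \<in> {0..1}" "q \<in> {0..1}"
  shows "\<exists>\<pi>. ssep_invariant N p q \<pi>"
proof -
  interpret S: subgen "configs N" "ssep_gen N p q" "ssep_rate N" by (rule ssep_subgen[OF pq])
  note bd = bounded_fn_finite[OF finite_configs]
  define \<eta> where "\<eta> = full_config N"
  have \<eta>: "\<eta> \<in> configs N" unfolding \<eta>_def by (rule full_config_configs)
  let ?P = "ssep_semigroup N p q"
  \<comment> \<open>The value at time \<open>s + t\<close> is an average of values at time
    \<open>t\<close> over starting points, so it differs from any of them by at most the
    oscillation.\<close>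
  have shift: "\<exists>G. \<forall>s\<ge>0. \<forall>t\<ge>0. \<bar>?P (s + t) \<phi> \<eta> - ?P t \<phi> \<eta>\<bar> \<le> G * survivors N t" for \<phi>
  proof -
    obtain G where G: "0 \<le> G" "\<And>\<xi> y. \<xi> \<in> configs N \<Longrightarrow> y \<in> {1..N} \<Longrightarrow> \<bar>\<phi> (\<xi>(y := 1)) - \<phi> (\<xi>(y := 0))\<bar> \<le> G"
      using gradient_bound_ex[of N \<phi>] by blast
    have "\<bar>?P (s + t) \<phi> \<eta> - ?P t \<phi> \<eta>\<bar> \<le> G * survivors N t" if s: "0 \<le> s" and t: "0 \<le> t" for s t
    proof -
      have e: "?P (s + t) \<phi> \<eta> = mean N (ssep_law N p q \<eta> s) (?P t \<phi>)"
        using S.sgp_semigroup[OF bd \<eta>, of s t \<phi>] expectation_ssep_law[OF pq \<eta> s, of "?P t \<phi>"]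
          mean_expectation[OF set_pmf_ssep_law[OF pq \<eta> s], of "?P t \<phi>"]
        by (simp add: ssep_semigroup_sgp)
      show ?thesis unfolding e
        by (rule mean_close[OF set_pmf_ssep_law[OF pq \<eta> s]]) (rule ssep_osc[OF N pq t G(2) _ \<eta>])
    qed
    then show ?thesis by blast
  qed
  have conv: "convergent (\<lambda>n. ?P (real n) \<phi> \<eta>)" for \<phi>
  proof -
    obtain G where G: "\<forall>s\<ge>0. \<forall>t\<ge>0. \<bar>?P (s + t) \<phi> \<eta> - ?P t \<phi> \<eta>\<bar> \<le> G * survivors N t" using shift by blast
    have lim: "(\<lambda>n. G * survivors N (real n)) \<longlonglongrightarrow> 0"
      using tendsto_mult[OF tendsto_const survivors_null[OF N], of G] by simp
    have "Cauchy (\<lambda>n. ?P (real n) \<phi> \<eta>)"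
    proof (rule CauchyI')
      fix e :: real assume "0 < e"
      then obtain M where M: "\<And>n. M \<le> n \<Longrightarrow> norm (G * survivors N (real n)) < e"
        using lim unfolding LIMSEQ_iff by (metis diff_zero)
      have "dist (?P (real m) \<phi> \<eta>) (?P (real n) \<phi> \<eta>) < e" if "M \<le> m" "m < n" for m n
      proof -
        have "\<bar>?P (real (n - m) + real m) \<phi> \<eta> - ?P (real m) \<phi> \<eta>\<bar> \<le> G * survivors N (real m)" using G by simp
        moreover have "real (n - m) + real m = real n" using that by simp
        ultimately show ?thesis using M[of m] that by (simp add: dist_real_def abs_minus_commute)
      qed
      then show "\<exists>M. \<forall>m\<ge>M. \<forall>n>m. dist (?P (real m) \<phi> \<eta>) (?P (real n) \<phi> \<eta>) < e" by blast
    qed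
    then show ?thesis by (simp add: Cauchy_convergent_iff)
  qed
  define a where "a = (\<lambda>\<xi>. lim (\<lambda>n. ?P (real n) (indicator {\<xi>}) \<eta>))"
  have a: "(\<lambda>n. ?P (real n) (indicator {\<xi>}) \<eta>) \<longlonglongrightarrow> a \<xi>" for \<xi>
    unfolding a_def using conv by (simp add: convergent_LIMSEQ_iff)
  have a_nonneg: "0 \<le> a \<xi>" for \<xi>
    by (rule LIMSEQ_le_const[OF a]) (auto intro!: exI[of _ 0] ssep_semigroup_nonneg[OF pq \<eta>])
  have a_out: "a \<xi> = 0" if "\<xi> \<notin> configs N" for \<xi>
    using a[of \<xi>] ssep_semigroup_outside[OF pq \<eta> that] by (simp add: LIMSEQ_const_iff)
  have "(\<lambda>n. \<Sum>\<xi>\<in>configs N. ?P (real n) (indicator {\<xi>}) \<eta>) \<longlonglongrightarrow> (\<Sum>\<xi>\<in>configs N. a \<xi>)"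
    by (intro tendsto_sum a)
  moreover have "(\<Sum>\<xi>\<in>configs N. ?P t (indicator {\<xi>}) \<eta>) = 1" for t
    using ssep_semigroup_expand[OF pq \<eta>, of t "\<lambda>_. 1"] by (simp add: ssep_semigroup_one)
  ultimately have a_sum: "(\<Sum>\<xi>\<in>configs N. a \<xi>) = 1" by (simp add: LIMSEQ_const_iff)
  define \<pi> where "\<pi> = embed_pmf a"
  have pmf_\<pi>: "pmf \<pi> \<xi> = a \<xi>" for \<xi>
    unfolding \<pi>_def
  proof (rule pmf_embed_pmf[OF a_nonneg])
    have "(\<integral>\<^sup>+x. ennreal (a x) \<partial>count_space UNIV) = (\<Sum>x\<in>configs N. ennreal (a x))"
      by (rule nn_integral_count_space') (use finite_configs a_out in auto)
    also have "\<dots> = ennreal (\<Sum>x\<in>configs N. a x)" by (rule sum_ennreal) (rule a_nonneg)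
    finally show "(\<integral>\<^sup>+x. ennreal (a x) \<partial>count_space UNIV) = 1" by (simp add: a_sum)
  qed
  have \<pi>s: "set_pmf \<pi> \<subseteq> configs N" using a_out by (metis pmf_\<pi> set_pmf_iff subsetI)
  have "pmf \<pi> \<xi> = mean N \<pi> (?P t (indicator {\<xi>}))" if t: "0 \<le> t" for t \<xi>
  proof -
    let ?f = "indicator {\<xi>} :: (nat \<Rightarrow> nat) \<Rightarrow> real"
    have "?P (real n + t) ?f \<eta> = (\<Sum>\<zeta>\<in>configs N. ?P (real n) (indicator {\<zeta>}) \<eta> * ?P t ?f \<zeta>)" for n
      using S.sgp_semigroup[OF bd \<eta>, of "real n" t ?f] ssep_semigroup_expand[OF pq \<eta>, of "real n" "?P t ?f"]
      by (simp add: ssep_semigroup_sgp mult.commute)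
    moreover have "(\<lambda>n. \<Sum>\<zeta>\<in>configs N. ?P (real n) (indicator {\<zeta>}) \<eta> * ?P t ?f \<zeta>) \<longlonglongrightarrow> mean N \<pi> (?P t ?f)"
      unfolding mean_def pmf_\<pi> by (intro tendsto_intros a)
    ultimately have 1: "(\<lambda>n. ?P (real n + t) ?f \<eta>) \<longlonglongrightarrow> mean N \<pi> (?P t ?f)" by simp
    obtain G where G: "\<forall>s\<ge>0. \<forall>t\<ge>0. \<bar>?P (s + t) ?f \<eta> - ?P t ?f \<eta>\<bar> \<le> G * survivors N t" using shift by blast
    have "(\<lambda>n. ?P (real n + t) ?f \<eta> - ?P (real n) ?f \<eta>) \<longlonglongrightarrow> 0"
    proof (rule Lim_null_comparison)
      show "\<forall>\<^sub>F n in sequentially. norm (?P (real n + t) ?f \<eta> - ?P (real n) ?f \<eta>) \<le> G * survivors N (real n)"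
        using G t by (simp add: add.commute)
      show "(\<lambda>n. G * survivors N (real n)) \<longlonglongrightarrow> 0"
        using tendsto_mult[OF tendsto_const survivors_null[OF N], of G] by simp
    qed
    from tendsto_add[OF this a[of \<xi>]] have "(\<lambda>n. ?P (real n + t) ?f \<eta>) \<longlonglongrightarrow> a \<xi>" by simp
    with 1 have "mean N \<pi> (?P t ?f) = a \<xi>" by (rule LIMSEQ_unique)
    then show ?thesis by (simp add: pmf_\<pi>)
  qed
  then show ?thesis using ssep_invariant_iff[OF pq \<pi>s] by blast
qed

text \<open>Every invariant law is the limit of the same sequence, hence unique; this gives meaning
  to the definite description in \<open>ssep_stationary\<close>.\<close>

lemma ssep_stationary_invariant:
  assumes N: "1 \<le> N" and pq: "p \<in> {0..1}" "q \<in> {0..1}"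
  shows "ssep_invariant N p q (ssep_stationary N p q)"
proof -
  obtain \<pi> where \<pi>: "ssep_invariant N p q \<pi>" using ssep_invariant_ex[OF assms] by blast
  have "\<pi>' = \<pi>" if \<pi>': "ssep_invariant N p q \<pi>'" for \<pi>'
  proof (rule pmf_eqI)
    fix \<xi>
    have "mean N \<pi> (indicator {\<xi>}) = mean N \<pi>' (indicator {\<xi>})"
      using ssep_tendsto_mean[OF N pq \<pi> full_config_configs] ssep_tendsto_mean[OF N pq \<pi>' full_config_configs]
      by (rule LIMSEQ_unique)
    moreover have "mean N \<mu> (indicator {\<xi>}) = pmf \<mu> \<xi>" if "ssep_invariant N p q \<mu>" for \<mu>
      using mean_expectation[of \<mu> N "indicator {\<xi>}"] that by (simp add: ssep_invariant_def pmf.rep_eq)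
    ultimately show "pmf \<pi>' \<xi> = pmf \<pi> \<xi>" using \<pi> \<pi>' by simp
  qed
  with \<pi> show ?thesis unfolding ssep_stationary_def by (rule theI)
qed

subsection \<open>Total variation distance\<close>

lemma prob_ssep_law:
  assumes "p \<in> {0..1}" "q \<in> {0..1}" "\<eta> \<in> configs N" "0 \<le> t"
  shows "measure_pmf.prob (ssep_law N p q \<eta> t) A = ssep_semigroup N p q t (indicator A) \<eta>"
  using expectation_ssep_law[OF assms, of "indicator A"] by simp

lemma prob_stationary:
  "set_pmf \<pi> \<subseteq> configs N \<Longrightarrow> measure_pmf.prob \<pi> A = mean N \<pi> (indicator A)"
  using mean_expectation[of \<pi> N "indicator A"] by simp

text \<open>The stationary probability of \<open>A\<close> is an average over starting points, so
  oscillation in the start bounds the distance to equilibrium.\<close>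

lemma ssep_dist_le:
  assumes N: "1 \<le> N" and pq: "p \<in> {0..1}" "q \<in> {0..1}" and t: "0 \<le> t"
    and D: "\<And>A \<eta> \<eta>'. \<eta> \<in> configs N \<Longrightarrow> \<eta>' \<in> configs N \<Longrightarrow>
      \<bar>ssep_semigroup N p q t (indicator A) \<eta> - ssep_semigroup N p q t (indicator A) \<eta>'\<bar> \<le> D"
  shows "ssep_dist N p q t \<le> D"
proof -
  let ?\<pi> = "ssep_stationary N p q"
  have inv: "ssep_invariant N p q ?\<pi>" by (rule ssep_stationary_invariant[OF N pq])
  then have \<pi>s: "set_pmf ?\<pi> \<subseteq> configs N" by (simp add: ssep_invariant_def)
  have "dTV (configs N) (ssep_law N p q \<eta> t) ?\<pi> \<le> D" if \<eta>: "\<eta> \<in> configs N" for \<eta>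
    unfolding dTV_def
  proof (rule Max.boundedI)
    fix x assume "x \<in> (\<lambda>A. \<bar>measure_pmf.prob (ssep_law N p q \<eta> t) A - measure_pmf.prob ?\<pi> A\<bar>) ` Pow (configs N)"
    then show "x \<le> D"
      using ssep_close_to_mean[OF pq inv t \<eta> D[OF _ \<eta>]]
      by (auto simp: prob_ssep_law[OF pq \<eta> t] prob_stationary[OF \<pi>s])
  qed (auto simp: finite_configs)
  then show ?thesis unfolding ssep_dist_def using full_config_configs finite_configs
    by (intro Max.boundedI) auto
qed

lemma ssep_dist_ge:
  assumes N: "1 \<le> N" and pq: "p \<in> {0..1}" "q \<in> {0..1}" and t: "0 \<le> t"
    and \<eta>: "\<eta> \<in> configs N" and A: "A \<subseteq> configs N"
  shows "ssep_semigroup N p q t (indicator A) \<eta> - mean N (ssep_stationary N p q) (indicator A) \<le> ssep_dist N p q t"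
proof -
  let ?\<pi> = "ssep_stationary N p q"
  have \<pi>s: "set_pmf ?\<pi> \<subseteq> configs N"
    using ssep_stationary_invariant[OF N pq] by (simp add: ssep_invariant_def)
  have "\<bar>measure_pmf.prob (ssep_law N p q \<eta> t) A - measure_pmf.prob ?\<pi> A\<bar> \<le> dTV (configs N) (ssep_law N p q \<eta> t) ?\<pi>"
    unfolding dTV_def using A finite_configs by (intro Max_ge) auto
  also have "\<dots> \<le> ssep_dist N p q t" unfolding ssep_dist_def using \<eta> finite_configs by (intro Max_ge) auto
  finally show ?thesis by (simp add: prob_ssep_law[OF pq \<eta> t] prob_stationary[OF \<pi>s])
qed

subsection \<open>The threshold time\<close>

text \<open>With zero densities the profile vanishes and the mean weight from the full configuration
  is \<open>survivors\<close>. Continuity makes the set of admissible times closed, so the infimum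
  is attained and finite.\<close>

lemma tstar_survivors:
  assumes N: "1 \<le> N"
  shows "\<exists>T\<ge>0. tstar N p = ereal T \<and> survivors N T \<le> max (sqrt (real N * p)) 1 \<and>
    (\<forall>t. 0 \<le> t \<longrightarrow> t < T \<longrightarrow> max (sqrt (real N * p)) 1 < survivors N t)"
proof -
  define m where "m = max (sqrt (real N * p)) 1"
  define X where "X = {t. 0 \<le> t \<and> survivors N t \<le> m}"
  have E: "measure_pmf.expectation (ssep_law N 0 0 (full_config N) t) (weight N) = survivors N t" if "0 \<le> t" for t
    using expectation_ssep_law[of 0 0 "full_config N" N t] that full_config_configs
      ssep_semigroup_weight[OF N, of 0 0 "full_config N" t]
    by (simp add: profile_def survivors_def full_config_def)
  have ts: "tstar N p = (INF t\<in>X. ereal t)"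
    unfolding tstar_def X_def m_def using E by (intro INF_cong) auto
  have cont: "continuous_on UNIV (survivors N)"
    using survivors_DERIV by (intro continuous_at_imp_continuous_on) (metis DERIV_isCont)
  have "closed ({0..} \<inter> (survivors N -` {..m} \<inter> UNIV))"
    by (intro closed_Int closed_atLeast continuous_closed_vimage) (use cont in \<open>auto simp: continuous_on_eq_continuous_at intro: closed_Int\<close>)
  then have cl: "closed X" by (simp add: X_def Int_def)
  have ne: "X \<noteq> {}"
  proof -
    have "\<forall>\<^sub>F n in sequentially. survivors N (real n) < 1"
      using survivors_null[OF N] by (rule order_tendstoD) simp
    then obtain n where "survivors N (real n) < 1" using eventually_happens by force
    then have "real n \<in> X" by (simp add: X_def m_def)
    then show ?thesis by blast
  qed
  have bb: "bdd_below X" by (rule bdd_belowI[of _ 0]) (simp add: X_def)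
  define T where "T = Inf X"
  have T: "T \<in> X" unfolding T_def by (rule closed_contains_Inf[OF ne bb cl])
  have lt: "t \<notin> X" if "t < T" for t using cInf_lower[OF _ bb, of t] that by (auto simp: T_def)
  have "tstar N p = ereal T" unfolding ts
  proof (rule antisym)
    show "(INF t\<in>X. ereal t) \<le> ereal T" by (rule INF_lower[OF T])
    show "ereal T \<le> (INF t\<in>X. ereal t)" using lt by (intro INF_greatest) force
  qed
  moreover have "m < survivors N t" if "0 \<le> t" "t < T" for t
    using lt[OF that(2)] that(1) by (simp add: X_def)
  ultimately show ?thesis using T unfolding X_def m_def by blast
qed

subsection \<open>Upper bound\<close>

lemma ssep_dist_le_survivors:
  assumes N: "1 \<le> N" and pq: "p \<in> {0..1}" "q \<in> {0..1}" and t: "0 \<le> t"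
  shows "ssep_dist N p q t \<le> survivors N t"
proof (rule ssep_dist_le[OF N pq t])
  fix A :: "(nat \<Rightarrow> nat) set" and \<eta> \<eta>' assume "\<eta> \<in> configs N" "\<eta>' \<in> configs N"
  then show "\<bar>ssep_semigroup N p q t (indicator A) \<eta> - ssep_semigroup N p q t (indicator A) \<eta>'\<bar> \<le> survivors N t"
    using ssep_osc[OF N pq t, of "indicator A" 1 \<eta> \<eta>'] by (auto simp: indicator_def)
qed

text \<open>The last 6 units of time act on the indicator first and make its gradient small; the
  first \<open>s\<close> units then reduce the number of discrepancies.\<close>

lemma ssep_dist_le_regularized:
  assumes N: "1 \<le> N" and p: "0 < p" "p < 1" and q: "q \<in> {0..1}" and s: "0 \<le> s"
    and C: "0 < C" "\<And>z. z \<in> dstates N \<Longrightarrow> sgp (dgen N q) 6 (sqmass N (\<lambda>_. 1)) z \<le> C / real N"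
  shows "ssep_dist N p q (s + 6) \<le> sqrt (C / (real N * (p * (1 - p)))) * survivors N s"
proof (rule ssep_dist_le[OF N _ q])
  have p': "p \<in> {0..1}" using p by auto
  interpret S: subgen "configs N" "ssep_gen N p q" "ssep_rate N" by (rule ssep_subgen[OF p' q])
  show "p \<in> {0..1}" by fact
  show "0 \<le> s + 6" using s by simp
  fix A :: "(nat \<Rightarrow> nat) set" and \<eta> \<eta>' assume \<eta>: "\<eta> \<in> configs N" "\<eta>' \<in> configs N"
  let ?f = "indicator A :: (nat \<Rightarrow> nat) \<Rightarrow> real"
  let ?g = "ssep_semigroup N p q 6 ?f"
  have sem: "ssep_semigroup N p q (s + 6) ?f x = ssep_semigroup N p q s ?g x" if "x \<in> configs N" for x
    unfolding ssep_semigroup_sgp using S.sgp_semigroup[OF bounded_fn_finite[OF finite_configs] that] by simp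
  have "\<bar>?g (\<xi>(y := 1)) - ?g (\<xi>(y := 0))\<bar> \<le> sqrt (C / (real N * (p * (1 - p))))"
    if \<xi>: "\<xi> \<in> configs N" and y: "y \<in> {1..N}" for \<xi> y
  proof (rule real_le_rsqrt)
    have "(?g (\<xi>(y := 1)) - ?g (\<xi>(y := 0)))\<^sup>2 \<le> sgp (dgen N q) 6 (sqmass N (\<lambda>_. 1)) (dpoint N y \<xi>) / (p * (1 - p))"
      by (rule ssep_gradient_sqmass[OF N p q _ y \<xi>]) (auto simp: indicator_def)
    also have "\<dots> \<le> (C / real N) / (p * (1 - p))"
      using p by (intro divide_right_mono C(2) dpoint_dstates y \<xi>) auto
    finally show "\<bar>?g (\<xi>(y := 1)) - ?g (\<xi>(y := 0))\<bar>\<^sup>2 \<le> C / (real N * (p * (1 - p)))" by simp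
  qed
  from ssep_osc[OF N p' q s this \<eta>] show "\<bar>ssep_semigroup N p q (s + 6) ?f \<eta> - ssep_semigroup N p q (s + 6) ?f \<eta>'\<bar>
      \<le> sqrt (C / (real N * (p * (1 - p)))) * survivors N s"
    unfolding sem[OF \<eta>(1)] sem[OF \<eta>(2)] .
qed

lemma tmix_upper:
  "\<exists>C1>0. \<forall>N p q \<epsilon>. 1 \<le> N \<longrightarrow> p \<in> {0..<1} \<longrightarrow> q \<in> {0..1} \<longrightarrow> \<epsilon> \<in> {0<..<1} \<longrightarrow>
    tmix N p q \<epsilon> \<le> tstar N p + ereal (C1 * (1 + ln (1 / \<epsilon>) + ln (1 / (1 - p))))"
proof -
  obtain C where C: "0 < C" "\<forall>N q. \<forall>z\<in>dstates N. 1 \<le> N \<longrightarrow> q \<in> {0..1} \<longrightarrow>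
      sgp (dgen N q) 6 (sqmass N (\<lambda>_. 1)) z \<le> C / real N"
    using sqmass_spread by blast
  \<comment> \<open>6 units are spent on the regularization and \<open>2 * ln 2\<close> on the
    prefactor 2 of the decay; \<open>ln (C + 1)\<close> absorbs the square root of \<open>C\<close>.
    Decay at rate 1/2 doubles the logarithm of \<open>1 / \<epsilon>\<close>.\<close>
  define C1 where "C1 = 8 + 2 * ln 2 + ln (C + 1)"
  have C1: "8 \<le> C1" using C(1) by (simp add: C1_def)
  have "tmix N p q \<epsilon> \<le> tstar N p + ereal (C1 * (1 + ln (1 / \<epsilon>) + ln (1 / (1 - p))))"
    if N: "1 \<le> N" and p: "p \<in> {0..<1}" and q: "q \<in> {0..1}" and \<epsilon>: "\<epsilon> \<in> {0<..<1}" for N p q \<epsilon>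
  proof -
    have p': "p \<in> {0..1}" using p by auto
    obtain T where T: "0 \<le> T" "tstar N p = ereal T" "survivors N T \<le> max (sqrt (real N * p)) 1"
      using tstar_survivors[OF N, of p] by blast
    define a b where "a = ln (1 / \<epsilon>)" and "b = ln (1 / (1 - p))"
    have ab: "0 \<le> a" "0 \<le> b" using \<epsilon> p by (auto simp: a_def b_def)
    have ea: "exp (- a) = \<epsilon>" "exp (- b) = 1 - p" using \<epsilon> p by (auto simp: a_def b_def ln_div)
    define r where "r = C1 * (1 + a + b)"
    have "2 * a \<le> C1 * a" "2 * b \<le> C1 * b" using ab C1 by (auto intro: mult_right_mono)
    then have r: "C1 + 2 * a + 2 * b \<le> r" by (simp add: r_def algebra_simps)
    have r0: "0 \<le> r" "6 \<le> r" using r ab C1 by auto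
    have "ssep_dist N p q (T + r) \<le> \<epsilon>"
    proof (cases "real N * p \<le> 1")
      case True
      have "ssep_dist N p q (T + r) \<le> survivors N (T + r)"
        using T r0 by (intro ssep_dist_le_survivors[OF N p' q]) auto
      also have "\<dots> \<le> 2 * exp (- r / 2) * survivors N T" by (rule survivors_decay[OF N T(1) r0(1)])
      also have "\<dots> \<le> 2 * exp (- r / 2) * 1"
        using T(3) True by (intro mult_left_mono) (auto simp: max_def split: if_splits)
      also have "\<dots> \<le> 2 * exp (- ln 2 - a)"
      proof -
        have "0 \<le> ln (C + 1)" using C(1) by simp
        then have "ln 2 + a \<le> r / 2" using r ab by (simp add: C1_def)
        then show ?thesis by simp
      qed
      also have "\<dots> = \<epsilon>" using ea by (simp add: exp_diff exp_minus field_simps)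
      finally show ?thesis .
    next
      case False
      then have p0: "0 < p" using p by (cases "p = 0") auto
      have m: "max (sqrt (real N * p)) 1 = sqrt (real N * p)" using False by (simp add: max_def)
      have "ssep_dist N p q ((T + (r - 6)) + 6) \<le> sqrt (C / (real N * (p * (1 - p)))) * survivors N (T + (r - 6))"
        using C p T r0 N q by (intro ssep_dist_le_regularized p0) auto
      also have "\<dots> \<le> sqrt (C / (real N * (p * (1 - p)))) * (2 * exp (- (r - 6) / 2) * sqrt (real N * p))"
      proof (intro mult_left_mono)
        have "survivors N (T + (r - 6)) \<le> 2 * exp (- (r - 6) / 2) * survivors N T"
          by (rule survivors_decay[OF N T(1)]) (use r0 in auto)
        also have "\<dots> \<le> 2 * exp (- (r - 6) / 2) * sqrt (real N * p)"
          using T(3) unfolding m by (intro mult_left_mono) auto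
        finally show "survivors N (T + (r - 6)) \<le> 2 * exp (- (r - 6) / 2) * sqrt (real N * p)" .
      qed (use C p in auto)
      also have "\<dots> = 2 * exp (- (r - 6) / 2) * sqrt (C / (1 - p))"
      proof -
        have "sqrt (C / (real N * (p * (1 - p)))) * sqrt (real N * p) = sqrt (C / (1 - p))"
          unfolding real_sqrt_mult[symmetric] using N p0 p by (simp add: field_simps)
        then show ?thesis by (simp add: mult_ac)
      qed
      also have "sqrt (C / (1 - p)) \<le> exp ((ln (C + 1) + b) / 2)"
      proof (rule real_le_lsqrt)
        have "C / (1 - p) \<le> (C + 1) / (1 - p)" using p by (intro divide_right_mono) auto
        also have "\<dots> = (C + 1) * exp b" using ea(2) by (simp add: exp_minus divide_inverse flip: ea(2))
        also have "\<dots> = exp (ln (C + 1) + b)" using C(1) by (simp add: exp_add)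
        also have "\<dots> = (exp ((ln (C + 1) + b) / 2))\<^sup>2" by (simp add: power2_eq_square exp_add[symmetric])
        finally show "C / (1 - p) \<le> (exp ((ln (C + 1) + b) / 2))\<^sup>2" .
      qed (use C p in auto)
      then have "2 * exp (- (r - 6) / 2) * sqrt (C / (1 - p)) \<le> 2 * exp (- (r - 6) / 2) * exp ((ln (C + 1) + b) / 2)"
        by (rule mult_left_mono) simp
      also have "\<dots> = 2 * exp (- (r - 6) / 2 + (ln (C + 1) + b) / 2)" by (simp add: exp_add)
      also have "\<dots> \<le> 2 * exp (- ln 2 - a)"
      proof -
        have "- (r - 6) / 2 + (v + b) / 2 \<le> - u - a" if "8 + 2 * u + v + 2 * a + 2 * b \<le> r" for u v
          using that ab by (simp add: field_simps)
        from this[of "ln 2" "ln (C + 1)"] have "- (r - 6) / 2 + (ln (C + 1) + b) / 2 \<le> - ln 2 - a"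
          using r unfolding C1_def by blast
        then show ?thesis by simp
      qed
      also have "\<dots> = \<epsilon>" using ea by (simp add: exp_diff exp_minus field_simps)
      finally show ?thesis by (simp add: add.assoc)
    qed
    then have "tmix N p q \<epsilon> \<le> ereal (T + r)" unfolding tmix_def using T(1) r0 by (intro INF_lower) auto
    then show ?thesis by (simp add: T(2) r_def a_def b_def)
  qed
  then show ?thesis using C1 by (intro exI[of _ C1]) auto
qed

subsection \<open>Lower bound\<close>

lemma stationary_weight:
  assumes N: "1 \<le> N" and pq: "p \<in> {0..1}" "q \<in> {0..1}" and \<pi>: "ssep_invariant N p q \<pi>"
  shows "mean N \<pi> (weight N) = (\<Sum>k\<in>{1..N}. profile N p q k)"
    and "mean N \<pi> (\<lambda>\<xi>. (weight N \<xi>)\<^sup>2) \<le> (\<Sum>k\<in>{1..N}. profile N p q k)\<^sup>2 + (\<Sum>k\<in>{1..N}. profile N p q k)"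
proof -
  let ?\<eta> = "full_config N" and ?\<mu> = "\<Sum>k\<in>{1..N}. profile N p q k"
  note \<eta> = full_config_configs[of N]
  have al: "(\<lambda>n. alive N (real n) k) \<longlonglongrightarrow> 0" if k: "k \<in> {1..N}" for k
  proof (rule tendsto_sandwich[OF _ _ tendsto_const survivors_null[OF N]])
    show "\<forall>\<^sub>F n in sequentially. 0 \<le> alive N (real n) k" using alive_bounds[OF k] by simp
    show "\<forall>\<^sub>F n in sequentially. alive N (real n) k \<le> survivors N (real n)"
      unfolding survivors_def using k alive_bounds by (intro always_eventually allI member_le_sum) auto
  qed
  have "(\<lambda>n. ssep_semigroup N p q (real n) (weight N) ?\<eta>) \<longlonglongrightarrow>
      ?\<mu> + (\<Sum>k\<in>{1..N}. 0 * (real (?\<eta> k) - profile N p q k))"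
    unfolding ssep_semigroup_weight[OF N pq \<eta>] by (intro tendsto_intros al)
  then have 1: "(\<lambda>n. ssep_semigroup N p q (real n) (weight N) ?\<eta>) \<longlonglongrightarrow> ?\<mu>" by simp
  with ssep_tendsto_mean[OF N pq \<pi> \<eta>] show "mean N \<pi> (weight N) = ?\<mu>" by (rule LIMSEQ_unique)
  show "mean N \<pi> (\<lambda>\<xi>. (weight N \<xi>)\<^sup>2) \<le> ?\<mu>\<^sup>2 + ?\<mu>"
  proof (rule LIMSEQ_le[OF ssep_tendsto_mean[OF N pq \<pi> \<eta>]])
    show "(\<lambda>n. (ssep_semigroup N p q (real n) (weight N) ?\<eta>)\<^sup>2 + ssep_semigroup N p q (real n) (weight N) ?\<eta>)
        \<longlonglongrightarrow> ?\<mu>\<^sup>2 + ?\<mu>" by (intro tendsto_intros 1)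
  qed (use ssep_weight_second_moment[OF N pq \<eta>] in auto)
qed

text \<open>Chebyshev on both sides of the level \<open>\<mu>0 + \<Delta> / 2\<close>, the variances
  being at most the means \<open>\<mu>0 + \<Delta>\<close> and \<open>\<mu>0\<close>. The condition
  on \<open>q\<close> gives \<open>q \<le> 1/2\<close>, so \<open>1 - profile\<close> is at least
  half of \<open>k / (N + 1)\<close> and \<open>\<Delta>\<close> is at least a quarter of the
  survivors.\<close>

lemma ssep_dist_lower:
  assumes N: "1 \<le> N" and pq: "p \<in> {0..1}" "q \<in> {0..1}" and qp: "q \<le> min p (1 - p)" and t: "0 \<le> t"
    and f: "0 < survivors N t"
  shows "1 - (128 * (real N * p) / (survivors N t)\<^sup>2 + 16 / survivors N t) \<le> ssep_dist N p q t"
proof -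
  let ?\<pi> = "ssep_stationary N p q" and ?\<eta> = "full_config N" and ?S = "weight N"
  let ?P = "ssep_semigroup N p q t"
  interpret L: subgen "configs N" "ssep_gen N p q" "ssep_rate N" by (rule ssep_subgen[OF pq])
  note \<eta> = full_config_configs[of N] and bd = bounded_fn_finite[OF finite_configs]
  have inv: "ssep_invariant N p q ?\<pi>" by (rule ssep_stationary_invariant[OF N pq])
  then have \<pi>s: "set_pmf ?\<pi> \<subseteq> configs N" by (simp add: ssep_invariant_def)
  define \<mu>0 \<Delta> where "\<mu>0 = (\<Sum>k\<in>{1..N}. profile N p q k)"
    and "\<Delta> = (\<Sum>k\<in>{1..N}. alive N t k * (1 - profile N p q k))"
  define f where "f = survivors N t"
  have x: "0 \<le> real k / real (N + 1)" "real k / real (N + 1) \<le> 1" if "k \<in> {1..N}" for k using that by auto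
  have prof: "0 \<le> profile N p q k" "profile N p q k \<le> p" "1 / 2 * (real k / real (N + 1)) \<le> 1 - profile N p q k"
    if k: "k \<in> {1..N}" for k
  proof -
    let ?x = "real k / real (N + 1)"
    have e: "profile N p q k = p * (1 - ?x) + q * ?x" by (simp add: profile_def algebra_simps diff_divide_distrib)
    show "0 \<le> profile N p q k" unfolding e using x[OF k] pq by (intro add_nonneg_nonneg mult_nonneg_nonneg) auto
    have "q * ?x \<le> p * ?x" using qp x[OF k] by (intro mult_right_mono) auto
    then show "profile N p q k \<le> p" unfolding e by (simp add: algebra_simps)
    have "1 / 2 * y \<le> 1 - (p * (1 - y) + q * y)" if "0 \<le> y" "y \<le> 1" for y
    proof -
      have "q \<le> 1 / 2" using qp by (auto simp: min_def split: if_splits)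
      then have "p * (1 - y) + q * y \<le> 1 * (1 - y) + 1 / 2 * y"
        using pq that by (intro add_mono mult_right_mono) auto
      also have "\<dots> = 1 - 1 / 2 * y" by simp
      finally show ?thesis by simp
    qed
    then show "1 / 2 * ?x \<le> 1 - profile N p q k" unfolding e using x[OF k] by blast
  qed
  have \<mu>0: "0 \<le> \<mu>0" "\<mu>0 \<le> real N * p"
    unfolding \<mu>0_def using prof sum_bounded_above[of "{1..N}" "profile N p q" p] by (auto intro: sum_nonneg)
  have al: "0 \<le> alive N t k" if "k \<in> {1..N}" for k using alive_bounds[OF that t] by simp
  have "1 / 2 * (f / 2) = (\<Sum>k\<in>{1..N}. alive N t k * (1 / 2 * (real k / real (N + 1))))"
    unfolding f_def alive_sum_linear[symmetric] sum_distrib_left by (intro sum.cong refl) simp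
  also have "\<dots> \<le> \<Delta>" unfolding \<Delta>_def by (intro sum_mono mult_left_mono prof al)
  finally have \<Delta>: "f / 4 \<le> \<Delta>" by simp
  have f0: "0 < f" using f by (simp add: f_def)
  then have \<Delta>0: "0 < \<Delta>" using \<Delta> by linarith
  have m1: "?P ?S ?\<eta> = \<mu>0 + \<Delta>"
    unfolding ssep_semigroup_weight[OF N pq \<eta>] \<mu>0_def \<Delta>_def
    by (simp add: full_config_def)
  have v1: "?P (\<lambda>\<xi>. (?S \<xi> - (\<mu>0 + \<Delta>))\<^sup>2) ?\<eta> \<le> \<mu>0 + \<Delta>"
  proof -
    have "?P (\<lambda>\<xi>. (?S \<xi> - (\<mu>0 + \<Delta>))\<^sup>2) ?\<eta> =
        ?P (\<lambda>\<xi>. (- 2 * (\<mu>0 + \<Delta>)) * ?S \<xi> + ((?S \<xi>)\<^sup>2 + (\<mu>0 + \<Delta>)\<^sup>2 * 1)) ?\<eta>"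
      by (intro arg_cong[where f = "\<lambda>F. ?P F ?\<eta>"]) (simp add: fun_eq_iff power2_eq_square algebra_simps)
    also have "\<dots> = (- 2 * (\<mu>0 + \<Delta>)) * ?P ?S ?\<eta> + (?P (\<lambda>\<xi>. (?S \<xi>)\<^sup>2) ?\<eta> + (\<mu>0 + \<Delta>)\<^sup>2 * ?P (\<lambda>_. 1) ?\<eta>)"
      unfolding ssep_semigroup_sgp L.sgp_lin[OF bd bd \<eta>] L.sgp_add[OF bd bd \<eta>] L.sgp_cmult[OF bd \<eta>] ..
    finally show ?thesis
      using ssep_weight_second_moment[OF N pq \<eta> t] unfolding m1 ssep_semigroup_one
      by (simp add: power2_eq_square algebra_simps)
  qed
  have v0: "mean N ?\<pi> (\<lambda>\<xi>. (?S \<xi> - \<mu>0)\<^sup>2) \<le> \<mu>0"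
  proof -
    have "mean N ?\<pi> (\<lambda>\<xi>. (?S \<xi> - \<mu>0)\<^sup>2) = mean N ?\<pi> (\<lambda>\<xi>. (- 2 * \<mu>0) * ?S \<xi> + (1 * (?S \<xi>)\<^sup>2 + \<mu>0\<^sup>2))"
      by (intro arg_cong[where f = "mean N ?\<pi>"]) (simp add: fun_eq_iff power2_eq_square algebra_simps)
    also have "\<dots> = (- 2 * \<mu>0) * \<mu>0 + (1 * mean N ?\<pi> (\<lambda>\<xi>. (?S \<xi>)\<^sup>2) + \<mu>0\<^sup>2)"
      unfolding mean_lin mean_const[OF \<pi>s] stationary_weight(1)[OF N pq inv] \<mu>0_def ..
    finally show ?thesis using stationary_weight(2)[OF N pq inv] unfolding \<mu>0_def[symmetric]
      by (simp add: power2_eq_square algebra_simps)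
  qed
  define A where "A = {\<xi> \<in> configs N. \<mu>0 + \<Delta> / 2 \<le> ?S \<xi>}"
  have sq: "1 \<le> (y / (\<Delta> / 2))\<^sup>2" if "\<Delta> / 2 \<le> \<bar>y\<bar>" for y
  proof -
    have "1 \<le> \<bar>y / (\<Delta> / 2)\<bar>" using that \<Delta>0 by (simp add: abs_divide field_simps)
    then show ?thesis using abs_le_square_iff[of 1 "y / (\<Delta> / 2)"] by simp
  qed
  have c: "4 / \<Delta>\<^sup>2 * y\<^sup>2 = (y / (\<Delta> / 2))\<^sup>2" for y by (simp add: power_divide)
  have "mean N ?\<pi> (indicator A) \<le> mean N ?\<pi> (\<lambda>\<xi>. 4 / \<Delta>\<^sup>2 * (?S \<xi> - \<mu>0)\<^sup>2 + 0)"
  proof (rule mean_mono)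
    fix \<xi>
    show "indicator A \<xi> \<le> 4 / \<Delta>\<^sup>2 * (?S \<xi> - \<mu>0)\<^sup>2 + 0"
    proof (cases "\<xi> \<in> A")
      case True
      then have "\<mu>0 + \<Delta> / 2 \<le> ?S \<xi>" by (simp add: A_def)
      then have "\<Delta> / 2 \<le> \<bar>?S \<xi> - \<mu>0\<bar>" by linarith
      from sq[OF this] show ?thesis using True unfolding c by simp
    qed simp
  qed
  also have "\<dots> \<le> 4 / \<Delta>\<^sup>2 * \<mu>0"
    unfolding mean_lin mean_const[OF \<pi>s] using mult_left_mono[OF v0, of "4 / \<Delta>\<^sup>2"] by simp
  finally have b0: "mean N ?\<pi> (indicator A) \<le> 4 / \<Delta>\<^sup>2 * \<mu>0" .
  have "?P (\<lambda>\<xi>. 1 - 4 / \<Delta>\<^sup>2 * (?S \<xi> - (\<mu>0 + \<Delta>))\<^sup>2) ?\<eta> \<le> ?P (indicator A) ?\<eta>"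
    unfolding ssep_semigroup_sgp
  proof (rule L.sgp_mono[OF bd bd \<eta> t])
    fix \<xi> assume \<xi>: "\<xi> \<in> configs N"
    show "1 - 4 / \<Delta>\<^sup>2 * (?S \<xi> - (\<mu>0 + \<Delta>))\<^sup>2 \<le> indicator A \<xi>"
    proof (cases "\<xi> \<in> A")
      case False
      then have "?S \<xi> < \<mu>0 + \<Delta> / 2" using \<xi> by (simp add: A_def not_le)
      then have "\<Delta> / 2 \<le> \<bar>?S \<xi> - (\<mu>0 + \<Delta>)\<bar>" by linarith
      from sq[OF this] show ?thesis using False unfolding c by simp
    qed simp
  qed
  moreover have "?P (\<lambda>\<xi>. 1 - 4 / \<Delta>\<^sup>2 * (?S \<xi> - (\<mu>0 + \<Delta>))\<^sup>2) ?\<eta> =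
      ?P (\<lambda>_. 1) ?\<eta> - 4 / \<Delta>\<^sup>2 * ?P (\<lambda>\<xi>. (?S \<xi> - (\<mu>0 + \<Delta>))\<^sup>2) ?\<eta>"
    unfolding ssep_semigroup_sgp L.sgp_diff[OF bd bd \<eta>] L.sgp_cmult[OF bd \<eta>] ..
  ultimately have b1: "1 - 4 / \<Delta>\<^sup>2 * (\<mu>0 + \<Delta>) \<le> ?P (indicator A) ?\<eta>"
    using mult_left_mono[OF v1, of "4 / \<Delta>\<^sup>2"] by (simp add: ssep_semigroup_one)
  have "1 - (8 * \<mu>0 / \<Delta>\<^sup>2 + 4 / \<Delta>) = (1 - 4 / \<Delta>\<^sup>2 * (\<mu>0 + \<Delta>)) - 4 / \<Delta>\<^sup>2 * \<mu>0"
    using \<Delta>0 by (simp add: power2_eq_square field_simps)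
  also have "\<dots> \<le> ssep_dist N p q t"
    using b0 b1 ssep_dist_ge[OF N pq t \<eta>, of A] by (auto simp: A_def)
  finally have main: "1 - (8 * \<mu>0 / \<Delta>\<^sup>2 + 4 / \<Delta>) \<le> ssep_dist N p q t" .
  have "8 * \<mu>0 / \<Delta>\<^sup>2 \<le> 8 * (real N * p) / (f / 4)\<^sup>2"
    using \<mu>0 \<Delta> f0 by (intro frac_le power_mono mult_left_mono) auto
  moreover have "4 / \<Delta> \<le> 4 / (f / 4)" using \<Delta> f0 by (intro divide_left_mono) auto
  ultimately show ?thesis using main by (simp add: f_def power_divide)
qed

text \<open>\<open>survivors_decay\<close> read backwards: at a time earlier than the threshold by
  more than \<open>r\<close> there are more than \<open>m * exp (r / 2) / 2\<close> survivors, which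
  beats both error terms of \<open>ssep_dist_lower\<close>.\<close>

lemma tmix_lower:
  "\<exists>C2>0. \<forall>N p q \<epsilon>. 1 \<le> N \<longrightarrow> p \<in> {0..1} \<longrightarrow> q \<in> {0..1} \<longrightarrow> q \<le> min p (1 - p) \<longrightarrow> \<epsilon> \<in> {0<..<1} \<longrightarrow>
    tstar N p - ereal (C2 * (1 + ln (1 / (1 - \<epsilon>)))) \<le> tmix N p q \<epsilon>"
proof -
  \<comment> \<open>The two error terms below are at most \<open>512 * E\<close> and
    \<open>32 * E\<close>; 600 exceeds their sum and makes the final inequality strict.\<close>
  define C2 :: real where "C2 = 2 * ln 600 + 2"
  have "0 \<le> ln (600 :: real)" by simp
  then have C2: "2 \<le> C2" by (simp add: C2_def)
  have "tstar N p - ereal (C2 * (1 + ln (1 / (1 - \<epsilon>)))) \<le> tmix N p q \<epsilon>"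
    if N: "1 \<le> N" and p: "p \<in> {0..1}" and q: "q \<in> {0..1}" and qp: "q \<le> min p (1 - p)"
      and \<epsilon>: "\<epsilon> \<in> {0<..<1}" for N p q \<epsilon>
  proof -
    define m where "m = max (sqrt (real N * p)) 1"
    obtain T where T: "0 \<le> T" "tstar N p = ereal T"
      "\<forall>t. 0 \<le> t \<longrightarrow> t < T \<longrightarrow> m < survivors N t"
      using tstar_survivors[OF N, of p] unfolding m_def by blast
    define a where "a = ln (1 / (1 - \<epsilon>))"
    have a: "0 \<le> a" "exp (- a) = 1 - \<epsilon>" using \<epsilon> by (auto simp: a_def ln_div)
    define r where "r = C2 * (1 + a)"
    have "2 * a \<le> C2 * a" using a C2 by (intro mult_right_mono) auto
    then have r: "C2 + 2 * a \<le> r" by (simp add: r_def algebra_simps)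
    have r0: "0 \<le> r" using r C2 a by auto
    have "ereal (T - r) \<le> ereal t" if t: "0 \<le> t" and d: "ssep_dist N p q t \<le> \<epsilon>" for t
    proof (rule ccontr)
      assume "\<not> ereal (T - r) \<le> ereal t"
      then have "t + r < T" by simp
      then have "m < survivors N (t + r)" using T(3) t r0 by auto
      also have "\<dots> \<le> 2 * exp (- r / 2) * survivors N t" by (rule survivors_decay[OF N t r0])
      finally have sm: "m < 2 * exp (- r / 2) * survivors N t" .
      define f where "f = survivors N t"
      define E where "E = exp (- r / 2)"
      have mf: "m < 2 * E * f" using sm by (simp add: f_def E_def)
      have m1: "1 \<le> m" by (simp add: m_def)
      have Np: "real N * p \<le> m\<^sup>2"
      proof -
        have "real N * p = (sqrt (real N * p))\<^sup>2" using p by simp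
        also have "\<dots> \<le> m\<^sup>2" using p by (intro power_mono) (auto simp: m_def)
        finally show ?thesis .
      qed
      have E: "0 < E" "E \<le> 1" using r0 by (auto simp: E_def)
      have f0: "0 < f"
      proof (rule ccontr)
        assume "\<not> 0 < f"
        then have "2 * E * f \<le> 0" using E by (intro mult_nonneg_nonpos) auto
        then show False using mf m1 by linarith
      qed
      have "128 * (real N * p) / f\<^sup>2 \<le> 512 * E"
      proof -
        have "real N * p \<le> (2 * E * f)\<^sup>2" using Np mf m1 power_mono[of m "2 * E * f" 2] by linarith
        also have "\<dots> = 4 * E * E * f\<^sup>2" by (simp add: power2_eq_square)
        also have "\<dots> \<le> 4 * E * 1 * f\<^sup>2" using E by (intro mult_left_mono mult_right_mono) auto
        finally show ?thesis using f0 by (simp add: field_simps)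
      qed
      moreover have "16 / f \<le> 32 * E"
      proof -
        have "1 \<le> 2 * E * f" using mf m1 by simp
        then show ?thesis using f0 by (simp add: field_simps)
      qed
      moreover have "1 - (128 * (real N * p) / f\<^sup>2 + 16 / f) \<le> \<epsilon>"
        using ssep_dist_lower[OF N p q qp t] f0 d unfolding f_def by linarith
      ultimately have "1 - \<epsilon> \<le> 544 * E" by linarith
      also have "544 * E < 600 * E" using E by simp
      also have "600 * E \<le> exp (- a)"
      proof -
        have "600 * E = exp (ln 600) * exp (- r / 2)" by (simp add: E_def)
        also have "\<dots> = exp (ln 600 - r / 2)" by (simp only: exp_add[symmetric]) simp
        also have "\<dots> \<le> exp (- a)" using r by (simp add: C2_def)
        finally show ?thesis .
      qed
      finally show False using a by simp
    qed
    then have "ereal (T - r) \<le> tmix N p q \<epsilon>" unfolding tmix_def by (intro INF_greatest) auto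
    then show ?thesis by (simp add: T(2) r_def a_def)
  qed
  then show ?thesis using C2 by (intro exI[of _ C2]) auto
qed

theorem theorem2:
  shows "\<exists>C::real. C > 0 \<and>
    (\<forall>N p q \<epsilon>. 1 \<le> N \<longrightarrow> p \<in> {0..1} \<longrightarrow> q \<in> {0..1} \<longrightarrow> q \<le> min p (1 - p) \<longrightarrow>
       \<epsilon> \<in> {0<..<1} \<longrightarrow>
       tstar N p - ereal C * (1 + log_inv (1 - \<epsilon>)) \<le> tmix N p q \<epsilon> \<and>
       tmix N p q \<epsilon> \<le> tstar N p + ereal C * (1 + log_inv \<epsilon> + log_inv (1 - p)))"
proof -
  obtain C1 where C1: "0 < C1" and upper: "\<And>N p q \<epsilon>. 1 \<le> N \<Longrightarrow> p \<in> {0..<1} \<Longrightarrow> q \<in> {0..1} \<Longrightarrow> \<epsilon> \<in> {0<..<1} \<Longrightarrow>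
      tmix N p q \<epsilon> \<le> tstar N p + ereal (C1 * (1 + ln (1 / \<epsilon>) + ln (1 / (1 - p))))"
    using tmix_upper by blast
  obtain C2 where C2: "0 < C2" and lower: "\<And>N p q \<epsilon>. 1 \<le> N \<Longrightarrow> p \<in> {0..1} \<Longrightarrow> q \<in> {0..1} \<Longrightarrow>
      q \<le> min p (1 - p) \<Longrightarrow> \<epsilon> \<in> {0<..<1} \<Longrightarrow>
      tstar N p - ereal (C2 * (1 + ln (1 / (1 - \<epsilon>)))) \<le> tmix N p q \<epsilon>"
    using tmix_lower by blast
  define C where "C = C1 + C2"
  have "tstar N p - ereal C * (1 + log_inv (1 - \<epsilon>)) \<le> tmix N p q \<epsilon> \<and>
      tmix N p q \<epsilon> \<le> tstar N p + ereal C * (1 + log_inv \<epsilon> + log_inv (1 - p))"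
    if N: "1 \<le> N" and p: "p \<in> {0..1}" and q: "q \<in> {0..1}" and qp: "q \<le> min p (1 - p)"
      and \<epsilon>: "\<epsilon> \<in> {0<..<1}" for N p q \<epsilon>
  proof
    obtain T where T: "tstar N p = ereal T" using tstar_survivors[OF N, of p] by metis
    have l: "log_inv (1 - \<epsilon>) = ereal (ln (1 / (1 - \<epsilon>)))" "log_inv \<epsilon> = ereal (ln (1 / \<epsilon>))"
      using \<epsilon> by (auto simp: log_inv_def)
    have nn: "0 \<le> ln (1 / (1 - \<epsilon>))" "0 \<le> ln (1 / \<epsilon>)" using \<epsilon> by auto
    have "C2 * (1 + ln (1 / (1 - \<epsilon>))) \<le> C * (1 + ln (1 / (1 - \<epsilon>)))"
      using nn C1 by (intro mult_right_mono) (auto simp: C_def)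
    then have "tstar N p - ereal C * (1 + log_inv (1 - \<epsilon>)) \<le> tstar N p - ereal (C2 * (1 + ln (1 / (1 - \<epsilon>))))"
      by (simp add: T l one_ereal_def)
    also have "\<dots> \<le> tmix N p q \<epsilon>" by (rule lower[OF N p q qp \<epsilon>])
    finally show "tstar N p - ereal C * (1 + log_inv (1 - \<epsilon>)) \<le> tmix N p q \<epsilon>" .
    show "tmix N p q \<epsilon> \<le> tstar N p + ereal C * (1 + log_inv \<epsilon> + log_inv (1 - p))"
    proof (cases "p = 1")
      \<comment> \<open>Here \<open>log_inv (1 - p)\<close> is infinite, and so is the right
        side.\<close>
      case True
      then show ?thesis using C1 C2 by (simp add: T l log_inv_def C_def one_ereal_def)
    next
      case False
      then have p1: "p \<in> {0..<1}" using p by auto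
      have l2: "log_inv (1 - p) = ereal (ln (1 / (1 - p)))" using False by (simp add: log_inv_def)
      have "0 \<le> ln (1 / (1 - p))" using p1 by auto
      then have "C1 * (1 + ln (1 / \<epsilon>) + ln (1 / (1 - p))) \<le> C * (1 + ln (1 / \<epsilon>) + ln (1 / (1 - p)))"
        using nn C2 by (intro mult_right_mono) (auto simp: C_def)
      then have "tstar N p + ereal (C1 * (1 + ln (1 / \<epsilon>) + ln (1 / (1 - p)))) \<le>
          tstar N p + ereal C * (1 + log_inv \<epsilon> + log_inv (1 - p))"
        by (simp add: T l l2 one_ereal_def)
      with upper[OF N p1 q \<epsilon>] show ?thesis by (rule order_trans)
    qed
  qed
  then show ?thesis using C1 C2 by (intro exI[of _ C]) (auto simp: C_def)
qed

end
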